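(* Let $T\in\Lambda^3_{12}(\mathbb R^6)$ be a $3$-form and denote by $G_T\subset U(3)$ the connected component of its isotropy group. If the dimension of $G_T$ is at least three, then one of the following two cases occurs. (1) The group $G_T$ is isomorphic to $U(2)$ and the embedding into $U(3)$ is given by the homomorphism $$G_T=\left\{\begin{pmatrix} g&0\\0&\det(g)\end{pmatrix}: g\in U(2)\right\}.$$ Up to a complex factor, there exists one orbit of that type, represented by the $3$-form $$T=e_{135}-e_{245}+e_{236}+e_{146}.$$ (2) The group $G_T$ is isomorphic to $SU(2)/\{\pm1\}=SO(3)$ and the embedding into $U(3)$ is the unique $3$-dimensional irreducible complex representation of $SU(2)$. Up to a complex factor, there exists one orbit of that type, represented by the $3$-form $$T=2(e_{123}-e_{356})-(e_{246}+e_{136})+(e_{145}-e_{235}).$$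
   Context: $\mathbb R^6$ is Euclidean space with orthonormal, positively oriented basis $e_1,\dots,e_6$; vectors and covectors are identified, $e_{i_1\dots i_l}=e_{i_1}\wedge\dots\wedge e_{i_l}$, and $*$ is the Hodge operator. The complex structure is $Je_{2i-1}=e_{2i}$, $Je_{2i}=-e_{2i-1}$ ($i=1,2,3$); $U(3)\subset SO(6)$ is the subgroup commuting with $J$ (identified with unitary $3\times 3$ matrices via $\mathbb R^6=\mathbb C^3$). $\Omega(X,Y)=\langle JX,Y\rangle$, i.e. $\Omega=e_{12}+e_{34}+e_{56}$. On $3$-forms, $(JT)(X,Y,Z)=T(JX,JY,JZ)$ and $\tau(T)=\sum_{i=1}^6(e_i\lrcorner\,\Omega)\wedge(e_i\lrcorner\, T)$. The space $\Lambda^3_{12}(\mathbb R^6)=\{T\in\Lambda^3(\mathbb R^6):\tau^2(T)=-T,\ J(T)=*T\}$ is a $12$-dimensional irreducible $U(3)$-representation. It is a complex vector space with complex structure $*$ (note $*^2=-1$ on $3$-forms), and "complex factor" refers to multiplication by a complex number in this sense. The isotropy group of $T$ is $\{A\in U(3): A\cdot T=T\}$, and orbits are $U(3)$-orbits in $\Lambda^3_{12}(\mathbb R^6)$.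
   Formalization: The 3-form T is assumed nonzero (for T = 0 the isotropy group is all of U(3), of dimension 9, and neither case occurs); for general T the embeddings are understood up to a unitary change of basis. *)

theory Defs
  imports "HOL-Analysis.Analysis" "HOL-Algebra.Coset"
begin

section \<open>Forms on Euclidean 6-space\<close>

text \<open>
  The index type \<open>6\<close> is the ring of integers modulo 6, so \<open>6 = 0\<close> as an index.  This is harmless:
  the indices \<open>1, \<dots>, 6\<close> are distinct, and no definition uses the order of the index type.
  Vectors and covectors are identified by means of the inner product.  Wedge products are normalised
  so that \<open>(v \<and> w)(X, Y) = (v \<bullet> X) (w \<bullet> Y) - (v \<bullet> Y) (w \<bullet> X)\<close>, without factorials.
\<close>

type_synonym form1 = "real^6 \<Rightarrow> real"
type_synonym form2 = "real^6 \<Rightarrow> real^6 \<Rightarrow> real"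
type_synonym form3 = "real^6 \<Rightarrow> real^6 \<Rightarrow> real^6 \<Rightarrow> real"

definition Lambda3 :: "form3 set" where
  "Lambda3 = {T. (\<forall>Y Z. linear (\<lambda>X. T X Y Z)) \<and> (\<forall>X Z. linear (\<lambda>Y. T X Y Z)) \<and>
                 (\<forall>X Y. linear (\<lambda>Z. T X Y Z)) \<and>
                 (\<forall>X Y. T X X Y = 0 \<and> T X Y X = 0 \<and> T Y X X = 0)}"

definition zero_form3 :: form3 where
  "zero_form3 = (\<lambda>X Y Z. 0)"

definition ee :: "6 \<Rightarrow> real^6" where
  "ee i = axis i 1"

definition covector :: "real^6 \<Rightarrow> form1" where
  "covector v = (\<lambda>X. v \<bullet> X)"

definition wedge11 :: "form1 \<Rightarrow> form1 \<Rightarrow> form2" where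
  "wedge11 a b = (\<lambda>X Y. a X * b Y - a Y * b X)"

definition wedge12 :: "form1 \<Rightarrow> form2 \<Rightarrow> form3" where
  "wedge12 a b = (\<lambda>X Y Z. a X * b Y Z - a Y * b X Z + a Z * b X Y)"

definition e3 :: "6 \<Rightarrow> 6 \<Rightarrow> 6 \<Rightarrow> form3" where
  "e3 i j k = wedge12 (covector (ee i)) (wedge11 (covector (ee j)) (covector (ee k)))"

definition interior2 :: "real^6 \<Rightarrow> form2 \<Rightarrow> form1" where
  "interior2 v a = (\<lambda>X. a v X)"

definition interior3 :: "real^6 \<Rightarrow> form3 \<Rightarrow> form2" where
  "interior3 v T = (\<lambda>X Y. T v X Y)"

definition vol :: "real^6 \<Rightarrow> real^6 \<Rightarrow> real^6 \<Rightarrow> real^6 \<Rightarrow> real^6 \<Rightarrow> real^6 \<Rightarrow> real" where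
  "vol v1 v2 v3 v4 v5 v6 = det (vector [v1, v2, v3, v4, v5, v6] :: real^6^6)"

text \<open>
  The Hodge operator on 3-forms, characterised by \<open>S \<and> *T = \<langle>S, T\<rangle> e\<^sub>1\<^sub>2\<^sub>3\<^sub>4\<^sub>5\<^sub>6\<close>; for instance
  \<open>*e\<^sub>1\<^sub>2\<^sub>3 = e\<^sub>4\<^sub>5\<^sub>6\<close>.  The factor \<open>1/6\<close> compensates for summing over all triples
  instead of the increasing ones.
\<close>

definition hodge :: "form3 \<Rightarrow> form3" where
  "hodge T = (\<lambda>X Y Z. (\<Sum>i\<in>UNIV. \<Sum>j\<in>UNIV. \<Sum>k\<in>UNIV.
      T (ee i) (ee j) (ee k) * vol (ee i) (ee j) (ee k) X Y Z) / 6)"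


section \<open>The Hermitian structure and the space of forms\<close>

definition J :: "real^6 \<Rightarrow> real^6" where
  "J X = X $ 1 *\<^sub>R ee 2 - X $ 2 *\<^sub>R ee 1 + X $ 3 *\<^sub>R ee 4 - X $ 4 *\<^sub>R ee 3 + X $ 5 *\<^sub>R ee 6 - X $ 6 *\<^sub>R ee 5"

definition Omega :: form2 where
  "Omega = (\<lambda>X Y. J X \<bullet> Y)"

definition J3 :: "form3 \<Rightarrow> form3" where
  "J3 T = (\<lambda>X Y Z. T (J X) (J Y) (J Z))"

definition tau :: "form3 \<Rightarrow> form3" where
  "tau T = (\<lambda>X Y Z. \<Sum>i\<in>UNIV. wedge12 (interior2 (ee i) Omega) (interior3 (ee i) T) X Y Z)"

definition Lambda3_12 :: "form3 set" where
  "Lambda3_12 = {T \<in> Lambda3. tau (tau T) = (\<lambda>X Y Z. - T X Y Z) \<and> J3 T = hodge T}"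

text \<open>Multiplication by a complex number, where the imaginary unit acts as the Hodge operator.\<close>

definition cmul :: "complex \<Rightarrow> form3 \<Rightarrow> form3" where
  "cmul c T = (\<lambda>X Y Z. Re c * T X Y Z + Im c * hodge T X Y Z)"


section \<open>Matrix groups\<close>

definition U3 :: "(real^6^6) set" where
  "U3 = {A. rotation_matrix A \<and> (\<forall>X. A *v J X = J (A *v X))}"

definition unitary_matrix :: "complex^'n^'n \<Rightarrow> bool" where
  "unitary_matrix M \<longleftrightarrow> map_matrix cnj (transpose M) ** M = mat 1 \<and> M ** map_matrix cnj (transpose M) = mat 1"

definition unitary_group :: "(complex^'n^'n) set" where
  "unitary_group = {M. unitary_matrix M}"

definition U2 :: "(complex^2^2) set" where
  "U2 = unitary_group"

definition SU2 :: "(complex^2^2) set" where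
  "SU2 = {g \<in> U2. det g = 1}"

definition SO3 :: "(real^3^3) set" where
  "SO3 = {R. rotation_matrix R}"

definition to_C3 :: "real^6 \<Rightarrow> complex^3" where
  "to_C3 X = vector [Complex (X $ 1) (X $ 2), Complex (X $ 3) (X $ 4), Complex (X $ 5) (X $ 6)]"

definition of_C3 :: "complex^3 \<Rightarrow> real^6" where
  "of_C3 z = Re (z $ 1) *\<^sub>R ee 1 + Im (z $ 1) *\<^sub>R ee 2 + Re (z $ 2) *\<^sub>R ee 3 + Im (z $ 2) *\<^sub>R ee 4
           + Re (z $ 3) *\<^sub>R ee 5 + Im (z $ 3) *\<^sub>R ee 6"

text \<open>
  The identification of complex \<open>3 \<times> 3\<close> matrices with the real \<open>6 \<times> 6\<close> matrices commuting with
  \<open>J\<close>; it maps the unitary matrices onto \<open>U3\<close>.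
\<close>

definition realify :: "complex^3^3 \<Rightarrow> real^6^6" where
  "realify M = matrix (\<lambda>X. of_C3 (M *v to_C3 X))"

definition mat_grp :: "('a::semiring_1^'n^'n) set \<Rightarrow> ('a^'n^'n) monoid" where
  "mat_grp G = \<lparr>carrier = G, mult = (**), one = mat 1\<rparr>"

text \<open>
  Isomorphism of topological groups.  For the closed matrix groups considered here this is the same
  as isomorphism of Lie groups.
\<close>

definition top_group_iso ::
    "('a::{semiring_1,topological_space}^'n^'n) set \<Rightarrow>
     ('b::{semiring_1,topological_space}^'m^'m) set \<Rightarrow> bool" where
  "top_group_iso G H \<longleftrightarrow> (\<exists>f h. f \<in> iso (mat_grp G) (mat_grp H) \<and> homeomorphism G H f h)"

text \<open>
  The dimension of a matrix Lie group, as the dimension of its tangent space at the identity (its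
  Lie algebra).
\<close>

definition tangent_space :: "(real^'n^'n) set \<Rightarrow> (real^'n^'n) set" where
  "tangent_space G = {X. \<exists>\<gamma>. \<gamma> C1_differentiable_on UNIV \<and> (\<forall>t::real. \<gamma> t \<in> G) \<and> \<gamma> 0 = mat 1 \<and>
                             (\<gamma> has_vector_derivative X) (at 0)}"

definition group_dim :: "(real^'n^'n) set \<Rightarrow> nat" where
  "group_dim G = dim (tangent_space G)"


section \<open>Isotropy groups and their types\<close>

definition act :: "real^6^6 \<Rightarrow> form3 \<Rightarrow> form3" where
  "act A T = (\<lambda>X Y Z. T (matrix_inv A *v X) (matrix_inv A *v Y) (matrix_inv A *v Z))"

definition isotropy :: "form3 \<Rightarrow> (real^6^6) set" where
  "isotropy T = {A \<in> U3. act A T = T}"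

definition isotropy0 :: "form3 \<Rightarrow> (real^6^6) set" where
  "isotropy0 T = connected_component_set (isotropy T) (mat 1)"

definition diag_det :: "complex^2^2 \<Rightarrow> complex^3^3" where
  "diag_det g = vector [vector [g $ 1 $ 1, g $ 1 $ 2, 0],
                        vector [g $ 2 $ 1, g $ 2 $ 2, 0],
                        vector [0,         0,         det g]]"

text \<open>
  The identity component of the isotropy group is isomorphic to \<open>U(2)\<close>, embedded in \<open>U(3)\<close> by
  \<open>diag_det\<close> with respect to some unitary basis.
\<close>

definition type_U2 :: "form3 \<Rightarrow> bool" where
  "type_U2 T \<longleftrightarrow>
     top_group_iso (isotropy0 T) U2 \<and>
     (\<exists>B\<in>U3. isotropy0 T = (\<lambda>g. B ** realify (diag_det g) ** matrix_inv B) ` U2)"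

text \<open>
  A continuous unitary irreducible representation of \<open>SU(2)\<close> on complex 3-space.  Note that
  \<open>vec.subspace\<close> refers to complex linear subspaces.
\<close>

definition irreducible_rep3 :: "(complex^2^2 \<Rightarrow> complex^3^3) \<Rightarrow> bool" where
  "irreducible_rep3 \<rho> \<longleftrightarrow>
     \<rho> \<in> hom (mat_grp SU2) (mat_grp unitary_group) \<and> continuous_on SU2 \<rho> \<and>
     (\<forall>W. vec.subspace W \<and> (\<forall>g\<in>SU2. \<forall>w\<in>W. \<rho> g *v w \<in> W) \<longrightarrow> W = {0} \<or> W = UNIV)"

text \<open>
  The identity component of the isotropy group is isomorphic to \<open>SU(2)/{\<plusminus>1} = SO(3)\<close>, and its
  embedding in \<open>U(3)\<close> is induced by the 3-dimensional irreducible representation of \<open>SU(2)\<close>.  That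
  representation is unique only up to unitary equivalence, so \<open>\<rho>\<close> ranges over all its realisations
  on complex 3-space.
\<close>

definition type_SO3 :: "form3 \<Rightarrow> bool" where
  "type_SO3 T \<longleftrightarrow>
     mat_grp SU2 Mod {mat 1, - mat 1} \<cong> mat_grp (isotropy0 T) \<and>
     top_group_iso (isotropy0 T) SO3 \<and>
     (\<exists>\<rho>. irreducible_rep3 \<rho> \<and>
          kernel (mat_grp SU2) (mat_grp unitary_group) \<rho> = {mat 1, - mat 1} \<and>
          isotropy0 T = realify ` \<rho> ` SU2)"

definition T_U2 :: form3 where
  "T_U2 = (\<lambda>X Y Z. e3 1 3 5 X Y Z - e3 2 4 5 X Y Z + e3 2 3 6 X Y Z + e3 1 4 6 X Y Z)"

definition T_SO3 :: form3 where
  "T_SO3 = (\<lambda>X Y Z. 2 * (e3 1 2 3 X Y Z - e3 3 5 6 X Y Z) - (e3 2 4 6 X Y Z + e3 1 3 6 X Y Z)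
                    + (e3 1 4 5 X Y Z - e3 2 3 5 X Y Z))"

end

theory Submission
  imports Defs
begin

text \<open>
  Write \<open>x, y, z\<close> for vectors of \<open>\<real>\<^sup>6 = \<complex>\<^sup>3\<close> and \<open>x \<times> y\<close> for the complex bilinear cross product. A complex
  \<open>3 \<times> 3\<close> matrix \<open>S\<close> defines the real 3-form
  \<open>T\<^sub>S(x, y, z) = Re ((x \<times> y)\<^sup>t S cnj z + (y \<times> z)\<^sup>t S cnj x + (z \<times> x)\<^sup>t S cnj y)\<close>. The equation \<open>\<tau>\<^sup>2 = -1\<close> selects the forms of type
  \<open>(2,1) + (1,2)\<close>, which are exactly the \<open>T\<^sub>S\<close>, and \<open>J T = *T\<close> then says that \<open>S\<close> is symmetric
  (\<open>form_of_Lambda3_12\<close>, \<open>Lambda3_12_form_of\<close>). Thus the twelve-dimensional space of the theorem is the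
  space of complex symmetric matrices. The Hodge operator acts on it as multiplication of \<open>S\<close> by the
  imaginary unit, and a unitary \<open>A\<close> sends \<open>S\<close> to \<open>det(A)\<^sup>-\<^sup>1 A S A\<^sup>t\<close> (\<open>act_form_of\<close>). The isotropy group of
  \<open>T\<^sub>S\<close> therefore consists of the unitary \<open>A\<close> with \<open>A S A\<^sup>t = det(A) S\<close>.

  By Takagi's factorisation (\<open>takagi\<close>) every symmetric \<open>S\<close> is \<open>U D U\<^sup>t\<close> with \<open>U\<close> unitary and \<open>D\<close> real,
  diagonal and nonnegative, so everything reduces to the diagonal entries \<open>s\<^sub>1, s\<^sub>2, s\<^sub>3\<close> of \<open>D\<close>. An
  element \<open>a\<close> of the Lie algebra of the isotropy group is skew-Hermitian with
  \<open>a D + D a\<^sup>t = tr(a) D\<close>. Off the diagonal this makes \<open>a\<^sub>i\<^sub>j\<close> vanish when \<open>s\<^sub>i \<noteq> s\<^sub>j\<close> and real when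
  \<open>s\<^sub>i = s\<^sub>j \<noteq> 0\<close>; on the diagonal it leaves at most one parameter
  if at most one \<open>s\<^sub>i\<close> vanishes. Counting parameters, the dimension is at most two unless the \<open>s\<^sub>i\<close>
  all agree or only one of them is nonzero (\<open>group_dim_le_2\<close>, \<open>group_dim_ge_3\<close>).

  If only one \<open>s\<^sub>i\<close> is nonzero, \<open>S\<close> is equivalent to a multiple of the matrix unit \<open>E33\<close>, whose
  stabiliser is computed directly as the group of all \<open>diag(g, det g)\<close> (\<open>Stab_E33\<close>). If all \<open>s\<^sub>i\<close> are
  equal and nonzero, \<open>S\<close> is equivalent to a multiple of the identity, whose stabiliser is the real
  rotation group \<open>SO(3)\<close> (\<open>Stab_mat1\<close>); composing with the double cover \<open>SU(2) \<rightarrow> SO(3)\<close> gives the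
  irreducible representation. Both stabilisers are connected, so they are their own identity
  components.

  Conversely, the type of the isotropy group determines \<open>S\<close>. If all \<open>diag(g, det g)\<close> stabilise \<open>S\<close>
  in some unitary basis, the single element \<open>diag(i, i, -1)\<close> already forces \<open>S\<close> to be a multiple of
  \<open>E33\<close> in that basis (\<open>type_U2_rank_one\<close>). If the isotropy group acts irreducibly, then, because it
  preserves the eigenspaces of \<open>D\<^sup>2\<close>, all \<open>s\<^sub>i\<close> agree (\<open>type_SO3_conformal\<close>). The form \<open>T = 0\<close> is
  excluded by the element \<open>-1\<close> of its isotropy group. The two orbits are thus the classes of \<open>E33\<close>
  and of the identity under \<open>S \<mapsto> c U S U\<^sup>t\<close>, and \<open>T_U2\<close> and \<open>T_SO3\<close> are members of them.
\<close>

section \<open>Complex coordinates\<close>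

lemma exhaust_6:
  fixes x :: 6
  shows "x = 1 \<or> x = 2 \<or> x = 3 \<or> x = 4 \<or> x = 5 \<or> x = 6"
proof (induct x)
  case (of_int z)
  then have "z = 0 \<or> z = 1 \<or> z = 2 \<or> z = 3 \<or> z = 4 \<or> z = 5" by fastforce
  then show ?case by auto
qed

lemma forall_6: "(\<forall>i::6. P i) \<longleftrightarrow> P 1 \<and> P 2 \<and> P 3 \<and> P 4 \<and> P 5 \<and> P 6"
  by (metis exhaust_6)

lemma UNIV_6: "UNIV = {1, 2, 3, 4, 5, 6::6}"
  using exhaust_6 by auto

lemma sum_6: "sum f (UNIV::6 set) = f 1 + f 2 + f 3 + f 4 + f 5 + f 6"
  unfolding UNIV_6 by (simp add: ac_simps)

lemma vector_6:
  "vector [a,b,c,d,e,f] $ (1::6) = a" "vector [a,b,c,d,e,f] $ (2::6) = b"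
  "vector [a,b,c,d,e,f] $ (3::6) = c" "vector [a,b,c,d,e,f] $ (4::6) = d"
  "vector [a,b,c,d,e,f] $ (5::6) = e" "vector [a,b,c,d,e,f] $ (6::6) = f"
  unfolding vector_def by simp_all

lemma ee_nth: "ee i $ j = (if j = i then 1 else 0)"
  by (simp add: ee_def axis_def)

lemma ee_inner: "ee i \<bullet> X = X $ i" "X \<bullet> ee i = X $ i"
  by (simp_all add: ee_def inner_axis inner_axis')

lemma to_C3_nth: "to_C3 X $ 1 = Complex (X $ 1) (X $ 2)" "to_C3 X $ 2 = Complex (X $ 3) (X $ 4)"
  "to_C3 X $ 3 = Complex (X $ 5) (X $ 6)"
  by (simp_all add: to_C3_def)

lemma of_C3_nth: "of_C3 z $ 1 = Re (z $ 1)" "of_C3 z $ 2 = Im (z $ 1)" "of_C3 z $ 3 = Re (z $ 2)"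
  "of_C3 z $ 4 = Im (z $ 2)" "of_C3 z $ 5 = Re (z $ 3)" "of_C3 z $ 6 = Im (z $ 3)"
  by (simp_all add: of_C3_def ee_nth)

lemma to_of_C3 [simp]: "to_C3 (of_C3 z) = z"
  by (simp add: vec_eq_iff forall_3 to_C3_nth of_C3_nth)

lemma of_to_C3 [simp]: "of_C3 (to_C3 X) = X"
  by (simp add: vec_eq_iff forall_6 to_C3_nth of_C3_nth)

lemma linear_to_C3: "linear to_C3"
  by (rule linearI) (simp_all add: vec_eq_iff forall_3 to_C3_nth complex_eq_iff)

lemma linear_of_C3: "linear of_C3"
  by (rule linearI) (simp_all add: vec_eq_iff forall_6 of_C3_nth)

lemma J_nth: "J X $ 1 = - X $ 2" "J X $ 2 = X $ 1" "J X $ 3 = - X $ 4" "J X $ 4 = X $ 3"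
  "J X $ 5 = - X $ 6" "J X $ 6 = X $ 5"
  by (simp_all add: J_def ee_nth)

lemma to_C3_J: "to_C3 (J X) = \<i> *s to_C3 X"
  by (simp add: vec_eq_iff forall_3 to_C3_nth J_nth complex_eq_iff)

lemma to_C3_inner: "to_C3 X \<bullet> to_C3 Y = X \<bullet> Y"
  by (simp add: inner_vec_def sum_3 sum_6 to_C3_nth inner_complex_def)

lemma linear_J: "linear J"
  by (rule linearI) (simp_all add: vec_eq_iff forall_6 J_nth)

lemma J_J: "J (J X) = - X"
  by (simp add: vec_eq_iff forall_6 J_nth)

lemma J_skew: "J X \<bullet> Y = - (X \<bullet> J Y)"
  by (simp add: inner_vec_def sum_6 J_nth)

section \<open>The unitary group inside SO(6)\<close>

definition adj :: "complex^'n^'m \<Rightarrow> complex^'m^'n" where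
  "adj M = map_matrix cnj (transpose M)"

lemma adj_nth [simp]: "adj M $ i $ j = cnj (M $ j $ i)"
  by (simp add: adj_def transpose_def)

lemma adj_adj [simp]: "adj (adj M) = M" by (simp add: vec_eq_iff)

lemma adj_mult: "adj (M ** N) = adj N ** adj M"
  by (simp add: vec_eq_iff matrix_matrix_mult_def mult.commute)

lemma adj_mat1 [simp]: "adj (mat 1) = mat 1" by (simp add: vec_eq_iff mat_def)

lemma unitary_iff: "M \<in> unitary_group \<longleftrightarrow> adj M ** M = mat 1"
  using matrix_left_right_inverse[of "adj M" M]
  by (auto simp: unitary_group_def unitary_matrix_def adj_def)

lemma unitary_iff': "M \<in> unitary_group \<longleftrightarrow> M ** adj M = mat 1"
  using matrix_left_right_inverse[of "adj M" M] by (auto simp: unitary_iff)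

lemma unitary_mult: "M \<in> unitary_group \<Longrightarrow> N \<in> unitary_group \<Longrightarrow> M ** N \<in> unitary_group"
  by (metis (no_types, lifting) adj_mult matrix_mul_assoc matrix_mul_rid unitary_iff)

lemma unitary_adj: "M \<in> unitary_group \<Longrightarrow> adj M \<in> unitary_group"
  by (metis adj_adj unitary_iff unitary_iff')

lemma unitary_mat1: "mat 1 \<in> unitary_group"
  by (simp add: unitary_iff)

lemma det_adj: "det (adj M) = cnj (det (M::complex^'n^'n))"
proof -
  have "det (map_matrix cnj M) = cnj (det M)" for M :: "complex^'n^'n"
    by (simp add: det_def)
  then show ?thesis by (simp add: adj_def det_transpose)
qed

lemma unitary_det: "M \<in> unitary_group \<Longrightarrow> cnj (det M) * det M = 1"
  by (metis det_I det_adj det_mul unitary_iff)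

lemma realify_mv: "realify M *v X = of_C3 (M *v to_C3 X)"
proof -
  have "linear (\<lambda>X. of_C3 (M *v to_C3 X))"
    using linear_compose[OF linear_compose[OF linear_to_C3 matrix_vector_mul_linear] linear_of_C3, of M]
    by (simp add: o_def)
  then show ?thesis unfolding realify_def by (simp add: matrix_works linear_matrix_vector_mul_eq)
qed

lemma to_C3_realify: "to_C3 (realify M *v X) = M *v to_C3 X"
  by (simp add: realify_mv)

lemma realify_mult: "realify (M ** N) = realify M ** realify N"
  by (simp add: matrix_eq realify_mv flip: matrix_vector_mul_assoc)

lemma realify_mat1 [simp]: "realify (mat 1) = mat 1"
  by (simp add: matrix_eq realify_mv)

text \<open>The inverse of \<open>realify\<close> on matrices that commute with \<open>J\<close>.\<close>

definition complexify :: "real^6^6 \<Rightarrow> complex^3^3" where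
  "complexify A = (\<chi> i j. to_C3 (A *v of_C3 (axis j 1)) $ i)"

lemma complexify_realify [simp]: "complexify (realify M) = M"
  by (simp add: complexify_def to_C3_realify)
    (simp add: vec_eq_iff matrix_vector_mult_def axis_def if_distrib cong: if_cong)

lemma inj_realify: "inj realify"
  by (metis complexify_realify injI)

lemma linear_complexify: "linear complexify"
  by (rule linearI)
     (simp_all add: vec_eq_iff complexify_def matrix_vector_mult_add_rdistrib linear_add[OF linear_to_C3]
      flip: scaleR_matrix_vector_assoc add: linear_cmul[OF linear_to_C3])

lemma linear_realify: "linear realify"
proof -
  have "(r *\<^sub>R M) *v z = r *\<^sub>R (M *v z)" for r M and z :: "complex^3"
    by (simp add: vec_eq_iff matrix_vector_mult_def scaleR_sum_right)
  note sc = this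
  show ?thesis
    by (intro linearI)
       (simp_all add: matrix_eq realify_mv matrix_vector_mult_add_rdistrib linear_add[OF linear_of_C3]
         sc linear_cmul[OF linear_of_C3] scaleR_matrix_vector_assoc[symmetric])
qed

lemma realify_J: "realify M *v J X = J (realify M *v X)"
proof -
  have "to_C3 (realify M *v J X) = to_C3 (J (realify M *v X))"
    by (simp add: to_C3_realify to_C3_J matrix_vector_mult_scaleR vector_scalar_commute)
  then show ?thesis by (metis of_to_C3)
qed

lemma realify_complexify:
  assumes "\<And>X. A *v J X = J (A *v X)"
  shows "realify (complexify A) = A"
proof -
  define f where "f z = to_C3 (A *v of_C3 z)" for z
  have fi: "f (\<i> *s z) = \<i> *s f z" for z
  proof -
    have "of_C3 (\<i> *s z) = J (of_C3 z)" by (metis to_C3_J of_to_C3 to_of_C3)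
    then show ?thesis by (simp add: f_def assms to_C3_J)
  qed
  have fl: "linear f"
    unfolding f_def
    using linear_compose[OF linear_compose[OF linear_of_C3 matrix_vector_mul_linear] linear_to_C3, of A]
    by (simp add: o_def)
  have fs: "f (c *s z) = c *s f z" for c z
  proof -
    have "c *s z = Re c *\<^sub>R z + Im c *\<^sub>R (\<i> *s z)" for z :: "complex^3"
      by (simp add: vec_eq_iff complex_eq_iff)
    then show ?thesis by (simp add: linear_add[OF fl] linear_cmul[OF fl] fi)
  qed
  have "f z = complexify A *v z" for z
  proof -
    have "z = z$1 *s axis 1 1 + z$2 *s axis 2 1 + z$3 *s axis 3 1"
      by (simp add: vec_eq_iff forall_3 axis_def)
    then have "f z = f (z$1 *s axis 1 1 + z$2 *s axis 2 1 + z$3 *s axis 3 1)" by simp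
    also have "\<dots> = complexify A *v z"
      by (simp add: linear_add[OF fl] fs)
        (simp add: f_def complexify_def vec_eq_iff matrix_vector_mult_def sum_3 mult.commute)
    finally show ?thesis .
  qed
  then show ?thesis by (simp add: matrix_eq realify_mv f_def flip: f_def) (metis f_def of_to_C3)
qed

lemma transpose_realify: "transpose (realify M) = realify (adj M)"
proof -
  have 1: "z \<bullet> (M *v w) = (adj M *v z) \<bullet> w" for z w :: "complex^3"
    by (simp add: inner_vec_def matrix_vector_mult_def sum_3 inner_complex_def algebra_simps)
  have "(transpose (realify M) *v X) \<bullet> Y = (realify (adj M) *v X) \<bullet> Y" for X Y
  proof -
    have "(transpose (realify M) *v X) \<bullet> Y = X \<bullet> (realify M *v Y)"
      by (simp add: dot_lmul_matrix)
    also have "\<dots> = (realify (adj M) *v X) \<bullet> Y"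
      by (simp add: 1 to_C3_realify flip: to_C3_inner)
    finally show ?thesis .
  qed
  then have "transpose (realify M) *v X = realify (adj M) *v X" for X
    by (intro vector_eq_rdot[THEN iffD1]) blast
  then show ?thesis by (simp only: matrix_eq) blast
qed

lemma orthogonal_realify: "orthogonal_matrix (realify M) \<longleftrightarrow> M \<in> unitary_group"
  by (metis inj_realify injD orthogonal_matrix realify_mat1 realify_mult transpose_realify unitary_iff)

text \<open>A complex invertible matrix can be joined to the identity inside the invertible
  matrices, since a complex line minus finitely many points is connected.\<close>

lemma det_realify_pos:
  assumes M: "det M \<noteq> 0"
  shows "det (realify M) > 0"
proof -
  define N where "N z = (\<chi> i j. (1 - z) * mat 1 $ i $ j + z * M $ i $ j)" for z
  define Z where "Z = {z. det (N z) = 0}"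
  define p where "p = det (\<chi> i j. [: mat 1 $ i $ j, M $ i $ j - mat 1 $ i $ j :] :: complex poly^3^3)"
  have p: "det (N z) = poly p z" for z
    by (simp add: det_3 N_def p_def algebra_simps)
  have N0: "N 0 = mat 1" and N1: "N 1 = M" by (simp_all add: N_def vec_eq_iff)
  have "poly p 0 = 1" by (simp add: N0 flip: p)
  then have "p \<noteq> 0" by auto
  then have "finite Z" unfolding Z_def p by (rule poly_roots_finite)
  then have "connected (UNIV - Z)"
    by (intro connected_open_delete_finite) auto
  moreover have "continuous_on (UNIV - Z) (\<lambda>z. det (realify (N z)))"
  proof -
    have "continuous_on UNIV N"
      unfolding N_def by (intro continuous_intros)
    then have "continuous_on UNIV (\<lambda>z. realify (N z))"
      by (rule linear_continuous_on_compose[OF _ linear_realify])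
    then show ?thesis
      unfolding det_def by (intro continuous_intros) (auto intro: continuous_on_subset)
  qed
  ultimately have conn: "connected ((\<lambda>z. det (realify (N z))) ` (UNIV - Z))"
    by (rule connected_continuous_image[rotated])
  have nz: "det (realify (N z)) \<noteq> 0" if "z \<notin> Z" for z
  proof -
    from that have "invertible (N z)" by (simp add: Z_def invertible_det_nz)
    then obtain B where "N z ** B = mat 1" unfolding invertible_def by blast
    then have "det (realify (N z)) * det (realify B) = 1"
      by (simp flip: det_mul realify_mult)
    then show ?thesis by auto
  qed
  have "0 \<notin> Z" "1 \<notin> Z" using M by (simp_all add: Z_def N0 N1)
  show ?thesis
  proof (rule ccontr)
    assume "\<not> ?thesis"
    then have le: "det (realify (N 1)) \<le> 0" by (simp add: N1)
    have "det (realify (N z)) \<in> (\<lambda>z. det (realify (N z))) ` (UNIV - Z)" if "z \<notin> Z" for z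
      using that by blast
    from connectedD_interval[OF conn this[OF \<open>1 \<notin> Z\<close>] this[OF \<open>0 \<notin> Z\<close>] le]
    have "0 \<in> (\<lambda>z. det (realify (N z))) ` (UNIV - Z)"
      by (simp add: N0)
    then show False using nz by auto
  qed
qed

text \<open>The orientation condition in \<open>U3\<close> is automatic: an orthogonal matrix that commutes with \<open>J\<close> has
  determinant 1 or -1, and complex matrices have positive real determinant.\<close>

lemma U3_eq: "U3 = realify ` unitary_group"
proof (intro subset_antisym subsetI)
  fix A assume "A \<in> U3"
  then have "rotation_matrix A" "\<And>X. A *v J X = J (A *v X)" by (auto simp: U3_def)
  then show "A \<in> realify ` unitary_group"
  proof -
    have eq: "realify (complexify A) = A" by (rule realify_complexify) fact
    then have "complexify A \<in> unitary_group"
      using \<open>rotation_matrix A\<close> orthogonal_realify[of "complexify A"] by (simp add: rotation_matrix_def)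
    then show ?thesis using eq by (metis image_eqI)
  qed
next
  fix A assume "A \<in> realify ` unitary_group"
  then obtain M where A: "A = realify M" and M: "M \<in> unitary_group" by blast
  have "det M \<noteq> 0" using unitary_det[OF M] by auto
  then have "det A > 0" unfolding A by (rule det_realify_pos)
  moreover have "orthogonal_matrix A" using M by (simp add: A orthogonal_realify)
  ultimately have "rotation_matrix A"
    using det_orthogonal_matrix[of A] by (auto simp: rotation_matrix_def)
  then show "A \<in> U3" by (simp add: U3_def A realify_J)
qed

lemma matrix_inv_realify:
  assumes "M \<in> unitary_group"
  shows "matrix_inv (realify M) = realify (adj M)"
proof -
  have 1: "realify M ** realify (adj M) = mat 1" "realify (adj M) ** realify M = mat 1"
    using assms unitary_iff[of M] unitary_iff'[of M] by (simp_all flip: realify_mult)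
  have "realify M ** matrix_inv (realify M) = mat 1 \<and> matrix_inv (realify M) ** realify M = mat 1"
    unfolding matrix_inv_def by (rule someI[of _ "realify (adj M)"]) (simp add: 1)
  then have "matrix_inv (realify M) = (realify (adj M) ** realify M) ** matrix_inv (realify M)"
    by (simp add: 1)
  also have "\<dots> = realify (adj M) ** (realify M ** matrix_inv (realify M))"
    by (simp only: matrix_mul_assoc)
  finally show ?thesis
    using \<open>realify M ** matrix_inv (realify M) = mat 1 \<and> _\<close> by simp
qed

section \<open>Alternating forms on basis triples\<close>

lemma Lambda3D:
  assumes "T \<in> Lambda3"
  shows "linear (\<lambda>X. T X Y Z)" "linear (\<lambda>Y. T X Y Z)" "linear (\<lambda>Z. T X Y Z)"
    "T X X Y = 0" "T X Y X = 0" "T Y X X = 0"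
  using assms by (auto simp: Lambda3_def)

lemma Lambda3_swap:
  assumes "T \<in> Lambda3"
  shows "T Y X Z = - T X Y Z" "T X Z Y = - T X Y Z"
proof -
  have "T (X + Y) (X + Y) Z = 0" "T X (Y + Z) (Y + Z) = 0"
    using Lambda3D(4,6)[OF assms] by blast+
  moreover have "T (X + Y) V Z = T X V Z + T Y V Z" "T X (Y + Z) V = T X Y V + T X Z V" for V
    using linear_add[OF Lambda3D(1)[OF assms]] linear_add[OF Lambda3D(2)[OF assms]] by blast+
  moreover have "T V (X + Y) Z = T V X Z + T V Y Z" "T X V (Y + Z) = T X V Y + T X V Z" for V
    using linear_add[OF Lambda3D(2)[OF assms]] linear_add[OF Lambda3D(3)[OF assms]] by blast+
  ultimately have "T X Y Z + T Y X Z = 0" "T X Y Z + T X Z Y = 0"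
    using Lambda3D(4,6)[OF assms] by (metis add.left_neutral add.right_neutral)+
  then show "T Y X Z = - T X Y Z" "T X Z Y = - T X Y Z" by linarith+
qed

lemma Lambda3_neg:
  assumes "T \<in> Lambda3"
  shows "T (- X) Y Z = - T X Y Z" "T X (- Y) Z = - T X Y Z" "T X Y (- Z) = - T X Y Z"
  using linear_neg[OF Lambda3D(1)[OF assms]] linear_neg[OF Lambda3D(2)[OF assms]]
    linear_neg[OF Lambda3D(3)[OF assms]] by auto

text \<open>Natural numbers as labels of the basis vectors, because sorting triples of basis vectors needs an
  order, which the cyclic index type does not provide.\<close>

definition bb :: "nat \<Rightarrow> real^6" where
  "bb n = ee (of_nat n)"

lemma ee_bb: "ee 1 = bb 1" "ee 2 = bb 2" "ee 3 = bb 3" "ee 4 = bb 4" "ee 5 = bb 5" "ee 6 = bb 6"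
  by (simp_all add: bb_def)

lemma sum_6_nat: "(\<Sum>i\<in>UNIV. h (i::6)) = (\<Sum>i\<in>{1..6::nat}. h (of_nat i))"
proof -
  have "{1..6} = {1,2,3,4,5,6::nat}" by auto
  then show ?thesis by (simp add: sum_6 add.assoc)
qed

lemma linear_bb_expand:
  fixes f :: "real^6 \<Rightarrow> real"
  assumes "linear f"
  shows "f X = (\<Sum>i\<in>{1..6}. X $ of_nat i * f (bb i))"
proof -
  have "X = (\<Sum>i\<in>UNIV. X $ i *\<^sub>R ee i)"
    by (simp add: vec_eq_iff ee_nth if_distrib cong: if_cong)
  then have "f X = f (\<Sum>i\<in>UNIV. X $ i *\<^sub>R ee i)" by simp
  also have "\<dots> = (\<Sum>i\<in>UNIV. X $ i * f (ee i))"
    by (simp add: linear_sum[OF assms] linear_cmul[OF assms])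
  also have "\<dots> = (\<Sum>i\<in>{1..6}. X $ of_nat i * f (bb i))"
    by (simp add: sum_6_nat bb_def)
  finally show ?thesis .
qed

text \<open>Multilinearity reduces an equality of 3-forms to triples of basis vectors, and antisymmetry
  reduces it to increasing triples.\<close>

lemma form3_eqI:
  assumes T: "T \<in> Lambda3" and T': "T' \<in> Lambda3"
    and eq: "\<And>i j k. 1 \<le> i \<Longrightarrow> i < j \<Longrightarrow> j < k \<Longrightarrow> k \<le> 6 \<Longrightarrow> T (bb i) (bb j) (bb k) = T' (bb i) (bb j) (bb k)"
  shows "T = T'"
proof (intro ext)
  fix X Y Z
  note sw = Lambda3_swap[OF T] Lambda3_swap[OF T']
  note ze = Lambda3D(4-6)[OF T] Lambda3D(4-6)[OF T']
  have 1: "T (bb i) (bb j) (bb k) = T' (bb i) (bb j) (bb k)"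
    if "i \<in> {1..6}" "j \<in> {1..6}" "k \<in> {1..6}" for i j k
  proof -
    have s: "T (bb i) (bb j) (bb k) = T' (bb i) (bb j) (bb k)"
      if "i \<le> j" "j \<le> k" "1 \<le> i" "k \<le> 6" for i j k
      using eq[of i j k] that ze by (cases "i = j"; cases "j = k") auto
    have s2: "T (bb i) (bb j) (bb k) = T' (bb i) (bb j) (bb k)"
      if "i \<le> j" "1 \<le> i" "1 \<le> j" "1 \<le> k" "k \<le> 6" "i \<le> 6" "j \<le> 6" for i j k
    proof -
      consider "j \<le> k" | "i \<le> k" "k \<le> j" | "k \<le> i" by linarith
      then show ?thesis
      proof cases
        case 1 then show ?thesis using s that by blast
      next
        case 2
        then have "T (bb i) (bb k) (bb j) = T' (bb i) (bb k) (bb j)" using s that by blast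
        then show ?thesis using sw(2)[of "bb i" "bb j" "bb k"] sw(4)[of "bb i" "bb j" "bb k"] by simp
      next
        case 3
        then have "T (bb k) (bb i) (bb j) = T' (bb k) (bb i) (bb j)" using s that by blast
        then show ?thesis
          using sw(2)[of "bb i" "bb j" "bb k"] sw(4)[of "bb i" "bb j" "bb k"]
            sw(1)[of "bb k" "bb i" "bb j"] sw(3)[of "bb k" "bb i" "bb j"] by simp
      qed
    qed
    show ?thesis
    proof (cases "i \<le> j")
      case True then show ?thesis using s2 that by simp
    next
      case False
      then have "T (bb j) (bb i) (bb k) = T' (bb j) (bb i) (bb k)" using s2 that by simp
      then show ?thesis using sw(1)[of "bb i" "bb j" "bb k"] sw(3)[of "bb i" "bb j" "bb k"] by simp
    qed
  qed
  have ex: "A X Y Z = (\<Sum>i\<in>{1..6}. X $ of_nat i * (\<Sum>j\<in>{1..6}. Y $ of_nat j *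
        (\<Sum>k\<in>{1..6}. Z $ of_nat k * A (bb i) (bb j) (bb k))))"
    if "A \<in> Lambda3" for A
    by (subst linear_bb_expand[OF Lambda3D(1)[OF that]], subst linear_bb_expand[OF Lambda3D(2)[OF that]],
        subst linear_bb_expand[OF Lambda3D(3)[OF that]]) simp
  show "T X Y Z = T' X Y Z"
    unfolding ex[OF T] ex[OF T'] using 1 by (intro sum.cong refl arg_cong2[where f="(*)"]) auto
qed

lemma all_triples_6:
  assumes "P 1 2 3" "P 1 2 4" "P 1 2 5" "P 1 2 6" "P 1 3 4" "P 1 3 5" "P 1 3 6" "P 1 4 5" "P 1 4 6" "P 1 5 6"
    "P 2 3 4" "P 2 3 5" "P 2 3 6" "P 2 4 5" "P 2 4 6" "P 2 5 6" "P 3 4 5" "P 3 4 6" "P 3 5 6" "P 4 5 6"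
    and "1 \<le> i" "i < j" "j < k" "k \<le> (6::nat)"
  shows "P i j k"
proof -
  have "\<forall>i\<in>{1,2,3,4,5,6}. \<forall>j\<in>{1,2,3,4,5,6}. \<forall>k\<in>{1,2,3,4,5,6}. i < j \<longrightarrow> j < k \<longrightarrow> P i j k"
    by (simp add: assms(1-20) del: One_nat_def)
  moreover have "i \<in> {1,2,3,4,5,6}" "j \<in> {1,2,3,4,5,6}" "k \<in> {1,2,3,4,5,6}"
    using assms(21-24) by auto
  ultimately show ?thesis using assms(22,23) by blast
qed

text \<open>The twenty increasing triples written out: an identity between forms becomes twenty linear
  relations between real components, which simplification can settle.\<close>

lemma form3_eqI_bb:
  assumes "T \<in> Lambda3" "T' \<in> Lambda3"
    "T (bb 1) (bb 2) (bb 3) = T' (bb 1) (bb 2) (bb 3)" "T (bb 1) (bb 2) (bb 4) = T' (bb 1) (bb 2) (bb 4)"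
    "T (bb 1) (bb 2) (bb 5) = T' (bb 1) (bb 2) (bb 5)" "T (bb 1) (bb 2) (bb 6) = T' (bb 1) (bb 2) (bb 6)"
    "T (bb 1) (bb 3) (bb 4) = T' (bb 1) (bb 3) (bb 4)" "T (bb 1) (bb 3) (bb 5) = T' (bb 1) (bb 3) (bb 5)"
    "T (bb 1) (bb 3) (bb 6) = T' (bb 1) (bb 3) (bb 6)" "T (bb 1) (bb 4) (bb 5) = T' (bb 1) (bb 4) (bb 5)"
    "T (bb 1) (bb 4) (bb 6) = T' (bb 1) (bb 4) (bb 6)" "T (bb 1) (bb 5) (bb 6) = T' (bb 1) (bb 5) (bb 6)"
    "T (bb 2) (bb 3) (bb 4) = T' (bb 2) (bb 3) (bb 4)" "T (bb 2) (bb 3) (bb 5) = T' (bb 2) (bb 3) (bb 5)"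
    "T (bb 2) (bb 3) (bb 6) = T' (bb 2) (bb 3) (bb 6)" "T (bb 2) (bb 4) (bb 5) = T' (bb 2) (bb 4) (bb 5)"
    "T (bb 2) (bb 4) (bb 6) = T' (bb 2) (bb 4) (bb 6)" "T (bb 2) (bb 5) (bb 6) = T' (bb 2) (bb 5) (bb 6)"
    "T (bb 3) (bb 4) (bb 5) = T' (bb 3) (bb 4) (bb 5)" "T (bb 3) (bb 4) (bb 6) = T' (bb 3) (bb 4) (bb 6)"
    "T (bb 3) (bb 5) (bb 6) = T' (bb 3) (bb 5) (bb 6)" "T (bb 4) (bb 5) (bb 6) = T' (bb 4) (bb 5) (bb 6)"
  shows "T = T'"
  using assms(1,2)
proof (rule form3_eqI)
  show "T (bb i) (bb j) (bb k) = T' (bb i) (bb j) (bb k)" if "1 \<le> i" "i < j" "j < k" "k \<le> 6" for i j k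
    by (rule all_triples_6[of "\<lambda>i j k. T (bb i) (bb j) (bb k) = T' (bb i) (bb j) (bb k)"])
       (fact assms that)+
qed

section \<open>The volume form and the Hodge operator\<close>

lemma vol_swap:
  "vol b a c d e f = - vol a b c d e f" "vol a c b d e f = - vol a b c d e f"
  "vol a b d c e f = - vol a b c d e f" "vol a b c e d f = - vol a b c d e f"
  "vol a b c d f e = - vol a b c d e f"
proof -
  have *: "det (\<chi> i. A $ Transposition.transpose m n i) = - det A" if "m \<noteq> n" for A :: "real^6^6" and m n :: 6
    using that by (simp add: det_permute_rows permutes_swap_id sign_swap_id)
  have "(vector [b,a,c,d,e,f] :: real^6^6) = (\<chi> i. vector [a,b,c,d,e,f] $ Transposition.transpose 1 2 i)"
    by (simp add: vec_eq_iff[where 'b=6 and 'a="real^6"] forall_6 vector_6 Transposition.transpose_def)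
  then show "vol b a c d e f = - vol a b c d e f" unfolding vol_def by (simp add: *)
  have "(vector [a,c,b,d,e,f] :: real^6^6) = (\<chi> i. vector [a,b,c,d,e,f] $ Transposition.transpose 2 3 i)"
    by (simp add: vec_eq_iff[where 'b=6 and 'a="real^6"] forall_6 vector_6 Transposition.transpose_def)
  then show "vol a c b d e f = - vol a b c d e f" unfolding vol_def by (simp add: *)
  have "(vector [a,b,d,c,e,f] :: real^6^6) = (\<chi> i. vector [a,b,c,d,e,f] $ Transposition.transpose 3 4 i)"
    by (simp add: vec_eq_iff[where 'b=6 and 'a="real^6"] forall_6 vector_6 Transposition.transpose_def)
  then show "vol a b d c e f = - vol a b c d e f" unfolding vol_def by (simp add: *)
  have "(vector [a,b,c,e,d,f] :: real^6^6) = (\<chi> i. vector [a,b,c,d,e,f] $ Transposition.transpose 4 5 i)"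
    by (simp add: vec_eq_iff[where 'b=6 and 'a="real^6"] forall_6 vector_6 Transposition.transpose_def)
  then show "vol a b c e d f = - vol a b c d e f" unfolding vol_def by (simp add: *)
  have "(vector [a,b,c,d,f,e] :: real^6^6) = (\<chi> i. vector [a,b,c,d,e,f] $ Transposition.transpose 5 6 i)"
    by (simp add: vec_eq_iff[where 'b=6 and 'a="real^6"] forall_6 vector_6 Transposition.transpose_def)
  then show "vol a b c d f e = - vol a b c d e f" unfolding vol_def by (simp add: *)
qed

lemma vol_eq:
  "vol a a c d e f = 0" "vol a c c d e f = 0" "vol a b d d e f = 0" "vol a b c d d f = 0"
  "vol a b c d e e = 0"
  using vol_swap(1)[of a a c d e f] vol_swap(2)[of a c c d e f] vol_swap(3)[of a b d d e f]
    vol_swap(4)[of a b c d d f] vol_swap(5)[of a b c d e e] by simp_all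

lemma linear_vol_1: "linear (\<lambda>X. vol X b c d e f)"
proof -
  have v: "vol X b c d e f = det (\<chi> i. if i = 1 then X else vector [0,b,c,d,e,f] $ i)" for X
    unfolding vol_def
    by (rule arg_cong[where f=det]) (simp add: vec_eq_iff[where 'b=6 and 'a="real^6"] forall_6 vector_6)
  show ?thesis
    by (rule linearI) (simp_all add: v det_row_add det_row_mul flip: scalar_mult_eq_scaleR)
qed

lemma linear_vol: "linear (\<lambda>X. vol a b c X e f)" "linear (\<lambda>X. vol a b c d X f)" "linear (\<lambda>X. vol a b c d e X)"
proof -
  have "(\<lambda>X. vol a b c X e f) = (\<lambda>X. - vol X a b c e f)"
    by (metis (no_types) vol_swap(1-3) minus_minus)
  then show "linear (\<lambda>X. vol a b c X e f)"
    using linear_compose_neg[OF linear_vol_1] by simp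
  have "(\<lambda>X. vol a b c d X f) = (\<lambda>X. vol X a b c d f)"
    by (metis (no_types) vol_swap(1-4) minus_minus)
  then show "linear (\<lambda>X. vol a b c d X f)"
    using linear_vol_1 by simp
  have "(\<lambda>X. vol a b c d e X) = (\<lambda>X. - vol X a b c d e)"
    by (metis (no_types) vol_swap(1-5) minus_minus)
  then show "linear (\<lambda>X. vol a b c d e X)"
    using linear_compose_neg[OF linear_vol_1] by simp
qed

lemma hodge_Lambda3: "hodge T \<in> Lambda3"
proof -
  have a: "vol a b c X Y X = 0" for a b c X Y
    using vol_swap(4)[of a b c X X Y] vol_swap(5)[of a b c X X Y] vol_eq(4)[of a b c X Y]
    by (metis add.inverse_inverse neg_0_equal_iff_equal vol_swap(5))
  show ?thesis
    unfolding Lambda3_def hodge_def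
    by (auto intro!: linearI
        simp: a vol_eq linear_add[OF linear_vol(1)] linear_add[OF linear_vol(2)] linear_add[OF linear_vol(3)]
          linear_cmul[OF linear_vol(1)] linear_cmul[OF linear_vol(2)] linear_cmul[OF linear_vol(3)]
          algebra_simps sum.distrib sum_distrib_left sum_divide_distrib add_divide_distrib)
qed

text \<open>In a sum over ordered triples of a symmetric function that vanishes on repetitions, every
  increasing triple is counted six times; this explains the factor \<open>1/6\<close> in the Hodge operator.\<close>

lemma sum_triples_6:
  fixes f :: "nat \<Rightarrow> nat \<Rightarrow> nat \<Rightarrow> real"
  assumes "\<And>i j k. f j i k = f i j k" "\<And>i j k. f i k j = f i j k" "\<And>i j. f i i j = 0"
  shows "(\<Sum>i\<in>{1..6}. \<Sum>j\<in>{1..6}. \<Sum>k\<in>{1..6}. f i j k) = 6 *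
    (f 1 2 3 + f 1 2 4 + f 1 2 5 + f 1 2 6 + f 1 3 4 + f 1 3 5 + f 1 3 6 + f 1 4 5 + f 1 4 6 + f 1 5 6 +
     f 2 3 4 + f 2 3 5 + f 2 3 6 + f 2 4 5 + f 2 4 6 + f 2 5 6 + f 3 4 5 + f 3 4 6 + f 3 5 6 + f 4 5 6)"
proof -
  have z: "f i i k = 0" "f i k k = 0" "f i k i = 0" for i k
    using assms by metis+
  have p: "f i j k = f i k j" "f i j k = f j i k" "f i j k = f j k i" "f i j k = f k i j"
    "f i j k = f k j i" for i j k
    using assms by metis+
  have e6: "(\<Sum>i\<in>{1..6}. g i) = g 1 + g 2 + g 3 + g 4 + g 5 + g 6" for g :: "nat \<Rightarrow> real"
    by (simp add: eval_nat_numeral)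
  show ?thesis
    unfolding e6 z
      p[of 1 2 3, symmetric] p[of 1 2 4, symmetric] p[of 1 2 5, symmetric] p[of 1 2 6, symmetric] p[of 1 3 4, symmetric]
      p[of 1 3 5, symmetric] p[of 1 3 6, symmetric] p[of 1 4 5, symmetric] p[of 1 4 6, symmetric] p[of 1 5 6, symmetric]
      p[of 2 3 4, symmetric] p[of 2 3 5, symmetric] p[of 2 3 6, symmetric] p[of 2 4 5, symmetric] p[of 2 4 6, symmetric]
      p[of 2 5 6, symmetric] p[of 3 4 5, symmetric] p[of 3 4 6, symmetric] p[of 3 5 6, symmetric] p[of 4 5 6, symmetric]
    by simp
qed

lemma hodge_expand:
  assumes T: "T \<in> Lambda3"
  defines "f \<equiv> \<lambda>X Y Z i j k. T (bb i) (bb j) (bb k) * vol (bb i) (bb j) (bb k) X Y Z"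
  shows "hodge T X Y Z =
    f X Y Z 1 2 3 + f X Y Z 1 2 4 + f X Y Z 1 2 5 + f X Y Z 1 2 6 + f X Y Z 1 3 4 + f X Y Z 1 3 5 + f X Y Z 1 3 6 + f X Y Z 1 4 5
   + f X Y Z 1 4 6 + f X Y Z 1 5 6 + f X Y Z 2 3 4 + f X Y Z 2 3 5 + f X Y Z 2 3 6 + f X Y Z 2 4 5 + f X Y Z 2 4 6 + f X Y Z 2 5 6
   + f X Y Z 3 4 5 + f X Y Z 3 4 6 + f X Y Z 3 5 6 + f X Y Z 4 5 6"
proof -
  have h: "hodge T X Y Z = (\<Sum>i\<in>{1..6}. \<Sum>j\<in>{1..6}. \<Sum>k\<in>{1..6}. f X Y Z i j k) / 6"
    by (simp add: hodge_def f_def sum_6_nat bb_def)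
  have "f X Y Z j i k = f X Y Z i j k" "f X Y Z i k j = f X Y Z i j k" "f X Y Z i i j = 0" for i j k
    unfolding f_def
    using Lambda3_swap(1)[OF T, of "bb j" "bb i" "bb k"] Lambda3_swap(2)[OF T, of "bb i" "bb k" "bb j"]
      vol_swap(1)[of "bb j" "bb i" "bb k"] vol_swap(2)[of "bb i" "bb k" "bb j"]
    by (simp_all add: vol_eq)
  from sum_triples_6[of "f X Y Z", OF this] show ?thesis unfolding h by simp
qed

lemma vol_bb: "vol (bb 1) (bb 2) (bb 3) (bb 4) (bb 5) (bb 6) = 1"
proof -
  have "(vector [bb 1, bb 2, bb 3, bb 4, bb 5, bb 6] :: real^6^6) = mat 1"
    by (simp add: vec_eq_iff forall_6 vector_6 mat_def ee_nth flip: ee_bb del: One_nat_def)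
  then show ?thesis by (simp add: vol_def)
qed

text \<open>Oriented by the numerical side condition, these rules sort the arguments, so that rewriting
  evaluates the volume form on any six basis vectors.\<close>

lemma vol_sort:
  "i < h \<Longrightarrow> vol (bb h) (bb i) c d e f = - vol (bb i) (bb h) c d e f"
  "i < h \<Longrightarrow> vol a (bb h) (bb i) d e f = - vol a (bb i) (bb h) d e f"
  "i < h \<Longrightarrow> vol a b (bb h) (bb i) e f = - vol a b (bb i) (bb h) e f"
  "i < h \<Longrightarrow> vol a b c (bb h) (bb i) f = - vol a b c (bb i) (bb h) f"
  "i < h \<Longrightarrow> vol a b c d (bb h) (bb i) = - vol a b c d (bb i) (bb h)"
  by (rule vol_swap)+

lemma hodge_bb:
  assumes T: "T \<in> Lambda3"
  shows
  "hodge T (bb 1) (bb 2) (bb 3) = - T (bb 4) (bb 5) (bb 6)"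
  "hodge T (bb 1) (bb 2) (bb 4) = T (bb 3) (bb 5) (bb 6)"
  "hodge T (bb 1) (bb 2) (bb 5) = - T (bb 3) (bb 4) (bb 6)"
  "hodge T (bb 1) (bb 2) (bb 6) = T (bb 3) (bb 4) (bb 5)"
  "hodge T (bb 1) (bb 3) (bb 4) = - T (bb 2) (bb 5) (bb 6)"
  "hodge T (bb 1) (bb 3) (bb 5) = T (bb 2) (bb 4) (bb 6)"
  "hodge T (bb 1) (bb 3) (bb 6) = - T (bb 2) (bb 4) (bb 5)"
  "hodge T (bb 1) (bb 4) (bb 5) = - T (bb 2) (bb 3) (bb 6)"
  "hodge T (bb 1) (bb 4) (bb 6) = T (bb 2) (bb 3) (bb 5)"
  "hodge T (bb 1) (bb 5) (bb 6) = - T (bb 2) (bb 3) (bb 4)"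
  "hodge T (bb 2) (bb 3) (bb 4) = T (bb 1) (bb 5) (bb 6)"
  "hodge T (bb 2) (bb 3) (bb 5) = - T (bb 1) (bb 4) (bb 6)"
  "hodge T (bb 2) (bb 3) (bb 6) = T (bb 1) (bb 4) (bb 5)"
  "hodge T (bb 2) (bb 4) (bb 5) = T (bb 1) (bb 3) (bb 6)"
  "hodge T (bb 2) (bb 4) (bb 6) = - T (bb 1) (bb 3) (bb 5)"
  "hodge T (bb 2) (bb 5) (bb 6) = T (bb 1) (bb 3) (bb 4)"
  "hodge T (bb 3) (bb 4) (bb 5) = - T (bb 1) (bb 2) (bb 6)"
  "hodge T (bb 3) (bb 4) (bb 6) = T (bb 1) (bb 2) (bb 5)"
  "hodge T (bb 3) (bb 5) (bb 6) = - T (bb 1) (bb 2) (bb 4)"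
  "hodge T (bb 4) (bb 5) (bb 6) = T (bb 1) (bb 2) (bb 3)"
  by (simp_all add: hodge_expand[OF T] vol_sort vol_eq vol_bb del: One_nat_def)

section \<open>The forms of a complex symmetric matrix\<close>

definition ccross :: "complex^3 \<Rightarrow> complex^3 \<Rightarrow> complex^3" where
  "ccross x y = vector [x$2 * y$3 - x$3 * y$2, x$3 * y$1 - x$1 * y$3, x$1 * y$2 - x$2 * y$1]"

definition cdot :: "complex^3 \<Rightarrow> complex^3 \<Rightarrow> complex" where
  "cdot x y = (\<Sum>i\<in>UNIV. x $ i * y $ i)"

definition vcnj :: "complex^3 \<Rightarrow> complex^3" where
  "vcnj z = (\<chi> i. cnj (z $ i))"

text \<open>One of the three cyclic summands of the form of a matrix. It is complex linear and alternating in
  the first two arguments and antilinear in the third, hence of type \<open>(2,1)\<close>.\<close>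

definition pairing :: "complex^3^3 \<Rightarrow> complex^3 \<Rightarrow> complex^3 \<Rightarrow> complex^3 \<Rightarrow> complex" where
  "pairing S x y z = cdot (ccross x y) (S *v vcnj z)"

definition form_of :: "complex^3^3 \<Rightarrow> form3" where
  "form_of S = (\<lambda>X Y Z. Re (pairing S (to_C3 X) (to_C3 Y) (to_C3 Z) + pairing S (to_C3 Y) (to_C3 Z) (to_C3 X)
                          + pairing S (to_C3 Z) (to_C3 X) (to_C3 Y)))"

lemmas pairing_expand = pairing_def cdot_def ccross_def vcnj_def matrix_vector_mult_def sum_3 vector_3

lemma pairing_add:
  "pairing S (x + x') y z = pairing S x y z + pairing S x' y z"
  "pairing S x (y + y') z = pairing S x y z + pairing S x y' z"
  "pairing S x y (z + z') = pairing S x y z + pairing S x y z'"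
  by (simp_all add: pairing_expand algebra_simps)

lemma pairing_scale:
  "pairing S (c *s x) y z = c * pairing S x y z"
  "pairing S x (c *s y) z = c * pairing S x y z"
  "pairing S x y (c *s z) = cnj c * pairing S x y z"
  by (simp_all add: pairing_expand algebra_simps)

lemma pairing_swap: "pairing S y x z = - pairing S x y z"
  by (simp add: pairing_expand algebra_simps)

lemma to_C3_scaleR: "to_C3 (r *\<^sub>R X) = complex_of_real r *s to_C3 X"
  by (simp add: vec_eq_iff forall_3 to_C3_nth complex_eq_iff)

lemma form_of_cyclic: "form_of S Y Z X = form_of S X Y Z"
  by (simp add: form_of_def)

lemma form_of_swap: "form_of S Y X Z = - form_of S X Y Z"
  unfolding form_of_def
  using pairing_swap[of S "to_C3 X" "to_C3 Y" "to_C3 Z"] pairing_swap[of S "to_C3 Y" "to_C3 Z" "to_C3 X"]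
    pairing_swap[of S "to_C3 Z" "to_C3 X" "to_C3 Y"] by simp

lemma form_of_Lambda3: "form_of S \<in> Lambda3"
proof -
  have 1: "linear (\<lambda>X. form_of S X Y Z)" for Y Z
    by (rule linearI)
       (simp_all add: form_of_def linear_add[OF linear_to_C3] to_C3_scaleR pairing_add pairing_scale algebra_simps)
  have 2: "form_of S X X Y = 0" for X Y
    using form_of_swap[of S X X Y] by simp
  have 3: "form_of S X Y Z = form_of S Y Z X" "form_of S X Y Z = form_of S Z X Y" for X Y Z
    using form_of_cyclic[of S Y Z X] form_of_cyclic[of S X Y Z] by simp_all
  have "linear (\<lambda>Y. form_of S X Y Z)" for X Z
    by (subst 3(1)) (rule 1)
  moreover have "linear (\<lambda>Z. form_of S X Y Z)" for X Y
    by (subst 3(2)) (rule 1)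
  moreover have "form_of S X Y X = 0" "form_of S Y X X = 0" for X Y
    by (subst 3(2), rule 2) (subst 3(1), rule 2)
  ultimately show ?thesis
    unfolding Lambda3_def using 1 2 by blast
qed

lemma to_C3_bb:
  "to_C3 (bb 1) = vector [1, 0, 0]" "to_C3 (bb 2) = vector [\<i>, 0, 0]"
  "to_C3 (bb 3) = vector [0, 1, 0]" "to_C3 (bb 4) = vector [0, \<i>, 0]"
  "to_C3 (bb 5) = vector [0, 0, 1]" "to_C3 (bb 6) = vector [0, 0, \<i>]"
  by (simp_all add: vec_eq_iff forall_3 to_C3_nth ee_nth complex_eq_iff del: One_nat_def flip: ee_bb)

text \<open>The components of \<open>form_of S\<close>. The off-diagonal entries of \<open>S\<close> appear on the triples that contain a
  pair \<open>e\<^sub>2\<^sub>i\<^sub>-\<^sub>1, e\<^sub>2\<^sub>i\<close>, the diagonal ones on the remaining eight.\<close>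

lemma form_of_bb:
  "form_of S (bb 1) (bb 2) (bb 3) = - 2 * Im (S $ 3 $ 1)"
  "form_of S (bb 1) (bb 2) (bb 4) = - 2 * Re (S $ 3 $ 1)"
  "form_of S (bb 1) (bb 2) (bb 5) = 2 * Im (S $ 2 $ 1)"
  "form_of S (bb 1) (bb 2) (bb 6) = 2 * Re (S $ 2 $ 1)"
  "form_of S (bb 1) (bb 3) (bb 4) = 2 * Im (S $ 3 $ 2)"
  "form_of S (bb 1) (bb 3) (bb 5) = Re (S $ 1 $ 1) + Re (S $ 2 $ 2) + Re (S $ 3 $ 3)"
  "form_of S (bb 1) (bb 3) (bb 6) = - Im (S $ 1 $ 1) - Im (S $ 2 $ 2) + Im (S $ 3 $ 3)"
  "form_of S (bb 1) (bb 4) (bb 5) = - Im (S $ 1 $ 1) + Im (S $ 2 $ 2) - Im (S $ 3 $ 3)"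
  "form_of S (bb 1) (bb 4) (bb 6) = - Re (S $ 1 $ 1) + Re (S $ 2 $ 2) + Re (S $ 3 $ 3)"
  "form_of S (bb 1) (bb 5) (bb 6) = - 2 * Im (S $ 2 $ 3)"
  "form_of S (bb 2) (bb 3) (bb 4) = 2 * Re (S $ 3 $ 2)"
  "form_of S (bb 2) (bb 3) (bb 5) = Im (S $ 1 $ 1) - Im (S $ 2 $ 2) - Im (S $ 3 $ 3)"
  "form_of S (bb 2) (bb 3) (bb 6) = Re (S $ 1 $ 1) - Re (S $ 2 $ 2) + Re (S $ 3 $ 3)"
  "form_of S (bb 2) (bb 4) (bb 5) = Re (S $ 1 $ 1) + Re (S $ 2 $ 2) - Re (S $ 3 $ 3)"
  "form_of S (bb 2) (bb 4) (bb 6) = - Im (S $ 1 $ 1) - Im (S $ 2 $ 2) - Im (S $ 3 $ 3)"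
  "form_of S (bb 2) (bb 5) (bb 6) = - 2 * Re (S $ 2 $ 3)"
  "form_of S (bb 3) (bb 4) (bb 5) = - 2 * Im (S $ 1 $ 2)"
  "form_of S (bb 3) (bb 4) (bb 6) = - 2 * Re (S $ 1 $ 2)"
  "form_of S (bb 3) (bb 5) (bb 6) = 2 * Im (S $ 1 $ 3)"
  "form_of S (bb 4) (bb 5) (bb 6) = 2 * Re (S $ 1 $ 3)"
  by (simp_all add: form_of_def pairing_expand to_C3_bb del: One_nat_def)

definition symmetric :: "'a^'n^'n \<Rightarrow> bool" where
  "symmetric S \<longleftrightarrow> transpose S = S"

lemma symmetric_nth: "symmetric S \<Longrightarrow> S $ i $ j = S $ j $ i"
  by (auto simp: symmetric_def transpose_def vec_eq_iff)

definition scal :: "complex \<Rightarrow> complex^'n^'m \<Rightarrow> complex^'n^'m" where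
  "scal c S = (\<chi> i j. c * S $ i $ j)"

lemma scal_nth [simp]: "scal c S $ i $ j = c * S $ i $ j"
  by (simp add: scal_def)

text \<open>Applying \<open>J\<close> to all arguments multiplies a form of type \<open>(2,1)\<close> by \<open>i \<cdot> i \<cdot> (-i) = i\<close>.\<close>

lemma J3_form_of: "J3 (form_of S) = form_of (scal \<i> S)"
proof -
  have "pairing (scal \<i> S) x y z = \<i> * pairing S x y z" for x y z
    by (simp add: pairing_expand algebra_simps)
  then show ?thesis
    by (simp add: J3_def form_of_def to_C3_J pairing_scale fun_eq_iff)
qed

text \<open>For antisymmetric \<open>S\<close> the same formula holds with the opposite sign; these are the forms
  \<open>\<Omega> \<and> v\<close>. So this is where symmetry of the matrix enters.\<close>

lemma hodge_form_of:
  assumes S: "symmetric S"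
  shows "hodge (form_of S) = form_of (scal \<i> S)"
  using hodge_Lambda3 form_of_Lambda3
  by (rule form3_eqI_bb)
     (simp_all add: hodge_bb[OF form_of_Lambda3] form_of_bb symmetric_nth[OF S, of 2 1]
        symmetric_nth[OF S, of 3 1] symmetric_nth[OF S, of 3 2] del: One_nat_def)

lemma sum_nth_linear:
  fixes f :: "real^6 \<Rightarrow> real"
  assumes "linear f"
  shows "(\<Sum>i\<in>UNIV. W $ i * f (ee i)) = f W"
  using linear_bb_expand[OF assms, of W] by (simp add: sum_6_nat bb_def)

text \<open>The covector \<open>Omega (e\<^sub>i, -)\<close> is \<open>J e\<^sub>i\<close>, hence \<open>\<tau>\<close> is, up to sign, the extension of \<open>J\<close> to forms as a
  derivation.\<close>

lemma tau_eq:
  assumes T: "T \<in> Lambda3"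
  shows "tau T = (\<lambda>X Y Z. - (T (J X) Y Z + T X (J Y) Z + T X Y (J Z)))"
proof (intro ext)
  fix X Y Z
  have O: "Omega (ee i) W = - (J W $ i)" for i W
    by (simp add: Omega_def J_skew ee_inner)
  have "tau T X Y Z = (\<Sum>i\<in>UNIV. - (J X $ i * T (ee i) Y Z) + J Y $ i * T (ee i) X Z - J Z $ i * T (ee i) X Y)"
    by (simp add: tau_def wedge12_def interior2_def interior3_def O)
  also have "\<dots> = - T (J X) Y Z + T (J Y) X Z - T (J Z) X Y"
    by (simp add: sum.distrib sum_subtractf sum_negf sum_nth_linear[OF Lambda3D(1)[OF T]])
  also have "\<dots> = - (T (J X) Y Z + T X (J Y) Z + T X Y (J Z))"
    using Lambda3_swap(1)[OF T, of "J Y" X Z] Lambda3_swap(1)[OF T, of "J Z" X Y]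
      Lambda3_swap(2)[OF T, of X "J Z" Y] by simp
  finally show "tau T X Y Z = - (T (J X) Y Z + T X (J Y) Z + T X Y (J Z))" .
qed

lemma tau_Lambda3:
  assumes T: "T \<in> Lambda3"
  shows "tau T \<in> Lambda3"
proof -
  have s: "T V (J V) Z = - T (J V) V Z" "T Z V (J V) = - T Z (J V) V" "T V Z (J V) = - T (J V) Z V" for V Z
    using Lambda3_swap(1)[OF T, of V "J V" Z] Lambda3_swap(2)[OF T, of Z V "J V"]
      Lambda3_swap(1)[OF T, of V "J V" Z] Lambda3_swap(2)[OF T, of V Z "J V"] Lambda3_swap(2)[OF T, of "J V" Z V]
    by simp_all
  have l: "T (V + W) Y Z = T V Y Z + T W Y Z" "T Y (V + W) Z = T Y V Z + T Y W Z"
    "T Y Z (V + W) = T Y Z V + T Y Z W" "T (r *\<^sub>R V) Y Z = r * T V Y Z" "T Y (r *\<^sub>R V) Z = r * T Y V Z"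
    "T Y Z (r *\<^sub>R V) = r * T Y Z V" for V W Y Z r
    using linear_add[OF Lambda3D(1)[OF T]] linear_add[OF Lambda3D(2)[OF T]] linear_add[OF Lambda3D(3)[OF T]]
      linear_cmul[OF Lambda3D(1)[OF T]] linear_cmul[OF Lambda3D(2)[OF T]] linear_cmul[OF Lambda3D(3)[OF T]]
    by auto
  show ?thesis
    unfolding Lambda3_def tau_eq[OF T]
    by (auto intro!: linearI simp: l linear_add[OF linear_J] linear_cmul[OF linear_J] Lambda3D(4-6)[OF T] s algebra_simps)
qed

text \<open>Squaring the derivation and using \<open>J\<^sup>2 = -1\<close>: the three pure second-order terms give \<open>-3 T\<close>, the
  mixed ones appear twice. On forms of type \<open>(p, q)\<close> the result is \<open>-(p - q)\<^sup>2\<close>.\<close>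

lemma tau_tau:
  assumes T: "T \<in> Lambda3"
  shows "tau (tau T) X Y Z = - 3 * T X Y Z + 2 * (T (J X) (J Y) Z + T (J X) Y (J Z) + T X (J Y) (J Z))"
  by (simp add: tau_eq[OF tau_Lambda3[OF T]]) (simp add: tau_eq[OF T] J_J Lambda3_neg[OF T])

lemma form_of_Lambda3_12:
  assumes S: "symmetric S"
  shows "form_of S \<in> Lambda3_12"
proof -
  have "tau (tau (form_of S)) X Y Z = - form_of S X Y Z" for X Y Z
    unfolding tau_tau[OF form_of_Lambda3] by (simp add: form_of_def to_C3_J pairing_scale)
  then show ?thesis
    by (simp add: Lambda3_12_def form_of_Lambda3 J3_form_of hodge_form_of[OF S] fun_eq_iff)
qed

lemma J_bb:
  "J (bb 1) = bb 2" "J (bb 2) = - bb 1" "J (bb 3) = bb 4" "J (bb 4) = - bb 3" "J (bb 5) = bb 6" "J (bb 6) = - bb 5"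
  by (simp_all add: vec_eq_iff forall_6 J_nth ee_nth del: One_nat_def flip: ee_bb)

text \<open>The matrix is recovered by polarisation. In \<open>T(x, y, z) - T(J x, J y, z)\<close> the two summands that are
  antilinear in \<open>x\<close> or in \<open>y\<close> cancel and the third one doubles, which leaves \<open>2 Re ((x \<times> y)\<^sup>t S cnj z)\<close>;
  replacing \<open>z\<close> by \<open>J z\<close> gives the imaginary part. Only the entries on and above the diagonal are read
  off, so that \<open>S\<close> is symmetric by construction; the Hodge condition shows that the entries below the
  diagonal fit.\<close>

lemma Lambda3_12_form_of:
  assumes "T \<in> Lambda3_12"
  obtains S where "symmetric S" "T = form_of S"
proof -
  have T: "T \<in> Lambda3" and tt: "tau (tau T) = (\<lambda>X Y Z. - T X Y Z)" and J3: "J3 T = hodge T"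
    using assms by (auto simp: Lambda3_12_def)
  have t: "T X Y Z = T (J X) (J Y) Z + T (J X) Y (J Z) + T X (J Y) (J Z)" for X Y Z
    using tau_tau[OF T, of X Y Z] by (simp add: tt)
  have h: "T (J X) (J Y) (J Z) = hodge T X Y Z" for X Y Z
    by (simp add: J3_def flip: J3)
  define S :: "complex^3^3" where "S =
    (let s = (\<lambda>i j l. Complex (T (bb i) (bb j) (bb l) - T (J (bb i)) (J (bb j)) (bb l))
                            (T (bb i) (bb j) (J (bb l)) - T (J (bb i)) (J (bb j)) (J (bb l))) / 2)
     in vector [vector [s 3 5 1, s 3 5 3, s 3 5 5], vector [s 3 5 3, s 5 1 3, s 5 1 5],
                vector [s 3 5 5, s 5 1 5, s 1 3 5]])"
  have sym: "symmetric S"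
    by (simp add: symmetric_def transpose_def vec_eq_iff forall_3 S_def Let_def)
  have sort: "j < i \<Longrightarrow> T (bb i) (bb j) Z = - T (bb j) (bb i) Z" "j < i \<Longrightarrow> T Z (bb i) (bb j) = - T Z (bb j) (bb i)" for i j Z
    using Lambda3_swap[OF T] by blast+
  note rules = J_bb Lambda3_neg[OF T] sort Lambda3D(4-6)[OF T] hodge_bb[OF T]
  \<comment> \<open>The tables are stated for the numeral 1, which must not be rewritten to \<open>Suc 0\<close>.\<close>
  note One_nat_def [simp del]
  have eqs:
    "T (bb 1) (bb 3) (bb 5) = T (bb 2) (bb 4) (bb 5) + T (bb 2) (bb 3) (bb 6) + T (bb 1) (bb 4) (bb 6)"
    "T (bb 2) (bb 4) (bb 6) = T (bb 1) (bb 3) (bb 6) + T (bb 1) (bb 4) (bb 5) + T (bb 2) (bb 3) (bb 5)"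
    "T (bb 4) (bb 5) (bb 6) = - T (bb 1) (bb 2) (bb 4)" "T (bb 3) (bb 5) (bb 6) = - T (bb 1) (bb 2) (bb 3)"
    "T (bb 3) (bb 4) (bb 6) = - T (bb 1) (bb 2) (bb 6)" "T (bb 3) (bb 4) (bb 5) = - T (bb 1) (bb 2) (bb 5)"
    "T (bb 2) (bb 5) (bb 6) = - T (bb 2) (bb 3) (bb 4)" "T (bb 1) (bb 5) (bb 6) = - T (bb 1) (bb 3) (bb 4)"
    using t[of "bb 1" "bb 3" "bb 5"] t[of "bb 2" "bb 4" "bb 6"]
      h[of "bb 1" "bb 2" "bb 3"] h[of "bb 1" "bb 2" "bb 4"] h[of "bb 1" "bb 2" "bb 5"]
      h[of "bb 1" "bb 2" "bb 6"] h[of "bb 1" "bb 3" "bb 4"] h[of "bb 2" "bb 3" "bb 4"]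
    by (simp_all add: rules)
  have "T = form_of S"
    by (rule form3_eqI_bb[OF T form_of_Lambda3])
       (simp_all add: form_of_bb S_def Let_def rules eqs, simp_all add: field_simps)
  with sym show ?thesis by (rule that)
qed

lemma form_of_inject: "form_of S = form_of S' \<longleftrightarrow> S = S'"
proof
  assume eq: "form_of S = form_of S'"
  note One_nat_def [simp del]
  note t = form_of_bb[of S, unfolded eq form_of_bb]
  show "S = S'"
    unfolding vec_eq_iff forall_3 complex_eq_iff using t by (intro conjI; linarith)
qed simp

lemma form_of_0: "form_of 0 = zero_form3"
  by (simp add: form_of_def zero_form3_def pairing_expand)

lemma pairing_scal: "pairing (scal c S) x y z = c * pairing S x y z"
  by (simp add: pairing_expand algebra_simps)

lemma cmul_form_of: "symmetric S \<Longrightarrow> cmul c (form_of S) = form_of (scal c S)"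
  by (simp add: cmul_def hodge_form_of fun_eq_iff) (simp add: form_of_def pairing_scal algebra_simps)

lemma T_U2_form_of: "T_U2 = form_of (\<chi> i j. if i = 3 \<and> j = 3 then 1 else 0)"
  by (simp add: T_U2_def e3_def wedge12_def wedge11_def covector_def ee_inner fun_eq_iff form_of_def
      pairing_expand to_C3_nth algebra_simps)

definition S_SO3 :: "complex^3^3" where
  "S_SO3 = vector [vector [0, 0, - \<i>], vector [0, \<i>, 0], vector [- \<i>, 0, 0]]"

lemma T_SO3_form_of: "T_SO3 = form_of S_SO3"
  by (simp add: T_SO3_def e3_def wedge12_def wedge11_def covector_def ee_inner fun_eq_iff form_of_def
      pairing_expand to_C3_nth S_SO3_def algebra_simps)

text \<open>The cross product is the second exterior power in disguise: \<open>N\<close> acts on it by its cofactor matrix.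
  For unitary \<open>N\<close> that matrix is the conjugate of \<open>N\<close> times the determinant.\<close>

lemma cofactor_cross:
  "transpose N *v ccross (N *v x) (N *v y) = det N *s ccross x y" for N :: "complex^3^3"
  by (simp add: vec_eq_iff forall_3 ccross_def vector_3 matrix_vector_mult_def transpose_def sum_3 det_3
      algebra_simps del: transpose_matrix_vector)

lemma cdot_transpose: "cdot (transpose M *v a) b = cdot a (M *v b)"
  by (simp add: cdot_def matrix_vector_mult_def sum_3 transpose_def algebra_simps del: transpose_matrix_vector)

lemma pairing_unitary:
  assumes M: "M \<in> unitary_group"
  shows "pairing S (adj M *v x) (adj M *v y) (adj M *v z) = pairing (scal (cnj (det M)) (M ** S ** transpose M)) x y z"
proof -
  have v: "vcnj (adj M *v z) = transpose M *v vcnj z"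
    by (simp add: vcnj_def vec_eq_iff matrix_vector_mult_def transpose_def del: transpose_matrix_vector)
  have "transpose M ** transpose (adj M) = mat 1"
    using M by (simp add: unitary_iff flip: matrix_transpose_mul)
  then have "ccross (adj M *v x) (adj M *v y) = transpose M *v (transpose (adj M) *v ccross (adj M *v x) (adj M *v y))"
    by (simp add: matrix_vector_mul_assoc del: transpose_matrix_vector)
  also have "\<dots> = cnj (det M) *s (transpose M *v ccross x y)"
    by (simp only: cofactor_cross det_adj vector_scalar_commute)
  finally have c: "ccross (adj M *v x) (adj M *v y) = cnj (det M) *s (transpose M *v ccross x y)" .
  have "pairing S (adj M *v x) (adj M *v y) (adj M *v z)
      = cnj (det M) * cdot (transpose M *v ccross x y) (S *v (transpose M *v vcnj z))"
    by (simp add: pairing_def v c cdot_def sum_distrib_left mult.assoc del: transpose_matrix_vector)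
  also have "\<dots> = cnj (det M) * pairing (M ** S ** transpose M) x y z"
    by (simp only: cdot_transpose pairing_def matrix_vector_mul_assoc matrix_mul_assoc)
  finally show ?thesis by (simp add: pairing_scal)
qed

lemma act_form_of:
  assumes "M \<in> unitary_group"
  shows "act (realify M) (form_of S) = form_of (scal (cnj (det M)) (M ** S ** transpose M))"
  by (simp add: act_def matrix_inv_realify[OF assms] form_of_def to_C3_realify pairing_unitary[OF assms])

text \<open>The isotropy group of \<open>form_of S\<close> as a group of complex matrices.\<close>

definition Stab :: "complex^3^3 \<Rightarrow> (complex^3^3) set" where
  "Stab S = {M \<in> unitary_group. M ** S ** transpose M = scal (det M) S}"

lemma scal_scal [simp]: "scal a (scal b S) = scal (a * b) S"
  by (simp add: vec_eq_iff mult.assoc)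

lemma scal_1 [simp]: "scal 1 S = S"
  by (simp add: vec_eq_iff)

lemma isotropy_form_of: "isotropy (form_of S) = realify ` Stab S"
proof -
  have "scal (cnj (det M)) (M ** S ** transpose M) = S \<longleftrightarrow> M ** S ** transpose M = scal (det M) S"
    if "M \<in> unitary_group" for M
  proof
    assume "scal (cnj (det M)) (M ** S ** transpose M) = S"
    then have "scal (det M) S = scal (det M) (scal (cnj (det M)) (M ** S ** transpose M))" by simp
    then show "M ** S ** transpose M = scal (det M) S"
      using unitary_det[OF that] by (simp add: mult.commute)
  next
    assume "M ** S ** transpose M = scal (det M) S"
    then show "scal (cnj (det M)) (M ** S ** transpose M) = S"
      using unitary_det[OF that] by simp
  qed
  then show ?thesis
    by (auto simp: isotropy_def U3_eq Stab_def act_form_of form_of_inject unitary_det)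
qed

section \<open>Takagi factorisation\<close>

text \<open>A maximiser \<open>u\<close> of the quadratic form \<open>x \<bullet> \<phi> x\<close> on the unit sphere of \<open>W\<close> is an eigenvector:
  otherwise moving from \<open>u\<close> in the direction of the defect \<open>y = \<phi> u - s u\<close> would increase the
  quotient at first order.\<close>

lemma selfadjoint_eigenvector:
  fixes \<phi> :: "'a::euclidean_space \<Rightarrow> 'a"
  assumes lin: "linear \<phi>" and sym: "\<And>x y. x \<bullet> \<phi> y = \<phi> x \<bullet> y"
    and W: "subspace W" and inv: "\<And>x. x \<in> W \<Longrightarrow> \<phi> x \<in> W" and ne: "w \<in> W" "w \<noteq> 0"
  obtains u where "u \<in> W" "norm u = 1" "\<phi> u = (u \<bullet> \<phi> u) *\<^sub>R u"
    "\<And>x. x \<in> W \<Longrightarrow> norm x = 1 \<Longrightarrow> x \<bullet> \<phi> x \<le> u \<bullet> \<phi> u"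
proof -
  let ?K = "W \<inter> sphere 0 1"
  have "compact ?K"
    using closed_subspace[OF W] by (simp add: closed_Int_compact)
  moreover have "w /\<^sub>R norm w \<in> ?K"
    using ne W by (simp add: subspace_scale)
  moreover have "continuous_on ?K (\<lambda>x. x \<bullet> \<phi> x)"
    by (intro continuous_intros linear_continuous_on_compose[OF continuous_on_id lin])
  ultimately obtain u where u: "u \<in> ?K" and max: "\<forall>x\<in>?K. x \<bullet> \<phi> x \<le> u \<bullet> \<phi> u"
    using continuous_attains_sup[of ?K "\<lambda>x. x \<bullet> \<phi> x"] by blast
  define s where "s = u \<bullet> \<phi> u"
  have uW: "u \<in> W" and un: "norm u = 1" and uu: "u \<bullet> u = 1"
    using u by (auto simp: dot_square_norm)
  have le: "x \<bullet> \<phi> x \<le> s * (x \<bullet> x)" if "x \<in> W" for x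
  proof (cases "x = 0")
    case True then show ?thesis by simp
  next
    case False
    then have "x /\<^sub>R norm x \<in> ?K" using that W by (simp add: subspace_scale)
    then have "(x /\<^sub>R norm x) \<bullet> \<phi> (x /\<^sub>R norm x) \<le> s" using max s_def by blast
    then have "(x \<bullet> \<phi> x) / (norm x)\<^sup>2 \<le> s"
      by (simp add: linear_cmul[OF lin] power2_eq_square divide_inverse mult_ac)
    then show ?thesis using False by (simp add: pos_divide_le_eq dot_square_norm)
  qed
  define y where "y = \<phi> u - s *\<^sub>R u"
  have yW: "y \<in> W" using uW W inv by (simp add: y_def subspace_diff subspace_scale)
  have yu: "y \<bullet> u = 0" by (simp add: y_def inner_diff_left s_def uu inner_commute[of "\<phi> u" u])
  have yy: "y \<bullet> \<phi> u = y \<bullet> y"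
  proof -
    have "y \<bullet> y = y \<bullet> \<phi> u - s * (y \<bullet> u)" by (simp add: y_def inner_diff_right)
    then show ?thesis by (simp add: yu)
  qed
  have key: "2 * t * (y \<bullet> y) \<le> t\<^sup>2 * (s * (y \<bullet> y) - y \<bullet> \<phi> y)" for t
  proof -
    have "(u + t *\<^sub>R y) \<bullet> \<phi> (u + t *\<^sub>R y) \<le> s * ((u + t *\<^sub>R y) \<bullet> (u + t *\<^sub>R y))"
      by (rule le) (simp add: uW yW W subspace_add subspace_scale)
    moreover have "(u + t *\<^sub>R y) \<bullet> (u + t *\<^sub>R y) = 1 + t\<^sup>2 * (y \<bullet> y)"
      by (simp add: inner_add_left inner_add_right uu yu inner_commute[of u y] power2_eq_square)
    moreover have "(u + t *\<^sub>R y) \<bullet> \<phi> (u + t *\<^sub>R y) = s + 2 * t * (y \<bullet> y) + t\<^sup>2 * (y \<bullet> \<phi> y)"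
      using sym[of u y] by (simp add: linear_add[OF lin] linear_cmul[OF lin] inner_add_left inner_add_right
          yy power2_eq_square algebra_simps inner_commute flip: s_def)
    ultimately have "s + 2 * t * (y \<bullet> y) + t\<^sup>2 * (y \<bullet> \<phi> y) \<le> s * (1 + t\<^sup>2 * (y \<bullet> y))"
      by (simp only:)
    then show ?thesis by (simp add: algebra_simps)
  qed
  have "y \<bullet> y \<le> 0"
  proof (rule ccontr)
    assume "\<not> ?thesis"
    then have p: "y \<bullet> y > 0" by linarith
    define c where "c = s * (y \<bullet> y) - y \<bullet> \<phi> y"
    have "2 * (y \<bullet> y) \<le> c" using key[of 1] by (simp add: c_def)
    then have "c > 0" using p by linarith
    \<comment> \<open>At this step size the quadratic term is only half of the linear one.\<close>
    have "2 * (y \<bullet> y / c) * (y \<bullet> y) \<le> (y \<bullet> y / c)\<^sup>2 * c"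
      unfolding c_def by (rule key)
    also have "\<dots> = (y \<bullet> y / c) * (y \<bullet> y)" using \<open>c > 0\<close> by (simp add: power2_eq_square)
    finally have "(y \<bullet> y) * (y \<bullet> y) \<le> 0" using \<open>c > 0\<close> by (simp add: field_simps)
    then show False using mult_pos_pos[OF p p] by linarith
  qed
  then have "y = 0" by (meson inner_gt_zero_iff not_le)
  then have "\<phi> u = (u \<bullet> \<phi> u) *\<^sub>R u" by (simp add: y_def s_def)
  then show ?thesis using that uW un max by auto
qed

lemma cdot_commute: "cdot a b = cdot b a" by (simp add: cdot_def mult.commute)

lemma cdot_linear: "cdot a (b + c) = cdot a b + cdot a c" "cdot a (r *s b) = r * cdot a b"
  "cdot (b + c) a = cdot b a + cdot c a" "cdot (r *s b) a = r * cdot b a"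
  by (simp_all add: cdot_def sum_3 algebra_simps)

lemma vcnj_simps [simp]: "vcnj (vcnj x) = x" "vcnj (a + b) = vcnj a + vcnj b" "vcnj (r *s b) = cnj r *s vcnj b"
  by (simp_all add: vcnj_def vec_eq_iff)

lemma inner_cdot: "x \<bullet> y = Re (cdot x (vcnj y))"
  by (simp add: inner_vec_def inner_complex_def cdot_def vcnj_def sum_3)

lemma cdot_vcnj: "cdot (vcnj x) (vcnj y) = cnj (cdot x y)"
  by (simp add: cdot_def vcnj_def)

lemma scaleR_vector_scalar: "r *\<^sub>R (x :: complex^'n) = complex_of_real r *s x"
  by (simp add: vec_eq_iff complex_eq_iff)

lemma cdot_self: "cdot (vcnj x) x = complex_of_real ((norm x)\<^sup>2)"
proof -
  have "Im (cdot (vcnj x) x) = 0" by (simp add: cdot_def vcnj_def sum_3)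
  then show ?thesis
    by (simp add: complex_eq_iff cdot_commute[of "vcnj x"] flip: inner_cdot dot_square_norm)
qed

text \<open>Since \<open>S\<close> is symmetric, the antilinear map sending \<open>x\<close> to the conjugate of \<open>S x\<close> is self-adjoint for
  the real inner product, and its real eigenvectors are the vectors sought. The hypothesis on \<open>P\<close>, the
  set of vectors found before, makes the complex orthogonal complement of \<open>P\<close> invariant. The maximal
  value is nonnegative because multiplication by \<open>i\<close> changes the sign of the quadratic form.\<close>

lemma takagi_step:
  fixes S :: "complex^3^3" and P :: "(complex^3) set"
  assumes S: "symmetric S"
    and P: "\<And>u. u \<in> P \<Longrightarrow> \<exists>r::real. S *v u = of_real r *s vcnj u"
    and w: "w \<noteq> 0" "\<And>u. u \<in> P \<Longrightarrow> cdot (vcnj u) w = 0"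
  obtains u and r :: real where "r \<ge> 0" "S *v u = of_real r *s vcnj u" "cdot (vcnj u) u = 1"
    "\<And>v. v \<in> P \<Longrightarrow> cdot (vcnj v) u = 0"
proof -
  define W where "W = {x. \<forall>u\<in>P. cdot (vcnj u) x = 0}"
  define \<phi> where "\<phi> x = vcnj (S *v x)" for x
  have St: "cdot x (S *v y) = cdot (S *v x) y" for x y
    using S cdot_transpose[of S x y] by (simp add: symmetric_def)
  have "subspace W"
    by (rule subspaceI) (auto simp: W_def cdot_linear scaleR_vector_scalar, simp add: cdot_def)
  moreover have "linear \<phi>"
    by (rule linearI) (simp_all add: \<phi>_def matrix_vector_right_distrib scaleR_vector_scalar vector_scalar_commute)
  moreover have "x \<bullet> \<phi> y = \<phi> x \<bullet> y" for x y
    using St[of x y] by (simp add: inner_cdot \<phi>_def cdot_vcnj)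
  moreover have "\<phi> x \<in> W" if "x \<in> W" for x
  proof -
    have "cdot (vcnj u) (\<phi> x) = 0" if u: "u \<in> P" for u
    proof -
      obtain r :: real where "S *v u = of_real r *s vcnj u" using P[OF u] by blast
      then have "cdot (vcnj u) (\<phi> x) = cnj (of_real r * cdot (vcnj u) x)"
        by (simp add: \<phi>_def cdot_vcnj St cdot_linear)
      then show ?thesis using \<open>x \<in> W\<close> u by (simp add: W_def)
    qed
    then show ?thesis by (simp add: W_def)
  qed
  moreover have "w \<in> W" "w \<noteq> 0" using w by (auto simp: W_def)
  note facts = calculation this
  obtain u where u: "u \<in> W" "norm u = 1" "\<phi> u = (u \<bullet> \<phi> u) *\<^sub>R u"
    and max: "\<And>x. x \<in> W \<Longrightarrow> norm x = 1 \<Longrightarrow> x \<bullet> \<phi> x \<le> u \<bullet> \<phi> u"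
    using selfadjoint_eigenvector[of \<phi> W w] facts by blast
  show ?thesis
  proof (rule that[of "u \<bullet> \<phi> u" u])
    have "\<i> *s u \<in> W" using u(1) by (simp add: W_def cdot_linear)
    moreover have "norm (\<i> *s u) = 1" using u(2) by (simp add: norm_vec_def norm_mult)
    ultimately have "(\<i> *s u) \<bullet> \<phi> (\<i> *s u) \<le> u \<bullet> \<phi> u" by (rule max)
    moreover have "(\<i> *s u) \<bullet> \<phi> (\<i> *s u) = - (u \<bullet> \<phi> u)"
      unfolding \<phi>_def inner_cdot vcnj_simps(1) vector_scalar_commute cdot_linear by simp
    ultimately show "0 \<le> u \<bullet> \<phi> u" by simp
    have "vcnj (\<phi> u) = vcnj ((u \<bullet> \<phi> u) *\<^sub>R u)" using u(3) by simp
    then show "S *v u = of_real (u \<bullet> \<phi> u) *s vcnj u"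
      by (simp add: \<phi>_def scaleR_vector_scalar)
    show "cdot (vcnj u) u = 1" using u(2) by (simp add: cdot_self)
    show "cdot (vcnj v) u = 0" if "v \<in> P" for v using u(1) that by (simp add: W_def)
  qed
qed

definition diag :: "real^3 \<Rightarrow> complex^3^3" where
  "diag s = (\<chi> i j. if i = j then of_real (s $ i) else 0)"

text \<open>Three applications of the previous step produce a unitary basis. The vectors \<open>w\<close> and \<open>a\<close> below only
  witness that the orthogonal complement of the vectors already found is nonzero.\<close>

theorem takagi:
  assumes S: "symmetric S"
  obtains U s where "U \<in> unitary_group" "\<And>i. s $ i \<ge> 0" "S = U ** diag s ** transpose U"
proof -
  obtain u1 and r1 :: real where 1: "r1 \<ge> 0" "S *v u1 = of_real r1 *s vcnj u1" "cdot (vcnj u1) u1 = 1"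
    by (rule takagi_step[OF S, of "{}" "axis 1 1"]) (auto simp: axis_eq_0_iff)
  obtain w where w: "w \<noteq> 0" "cdot (vcnj u1) w = 0"
  proof -
    define a where "a = vcnj u1"
    have "a \<noteq> 0" using 1(3) by (auto simp: a_def cdot_def)
    then consider "a$1 \<noteq> 0" | "a$2 \<noteq> 0" | "a$3 \<noteq> 0" by (auto simp: vec_eq_iff forall_3)
    then show ?thesis
    proof cases
      case 1 then show ?thesis
        by (intro that[of "vector [- a$2, a$1, 0]"]) (auto simp: vec_eq_iff forall_3 cdot_def sum_3 a_def)
    next
      case 2 then show ?thesis
        by (intro that[of "vector [- a$2, a$1, 0]"]) (auto simp: vec_eq_iff forall_3 cdot_def sum_3 a_def)
    next
      case 3 then show ?thesis
        by (intro that[of "vector [a$3, 0, - a$1]"]) (auto simp: vec_eq_iff forall_3 cdot_def sum_3 a_def)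
    qed
  qed
  obtain u2 and r2 :: real where 2: "r2 \<ge> 0" "S *v u2 = of_real r2 *s vcnj u2" "cdot (vcnj u2) u2 = 1"
    "cdot (vcnj u1) u2 = 0"
    by (rule takagi_step[OF S, of "{u1}" w]) (use 1 w in auto)
  have o: "cdot (vcnj u2) u1 = 0"
    using 2(4) cdot_vcnj[of "vcnj u1" u2] by (simp add: cdot_commute)
  define a where "a = ccross (vcnj u1) (vcnj u2)"
  have "a \<noteq> 0"
  proof
    assume "a = 0"
    then have "ccross a u1 = 0" by (simp add: ccross_def vec_eq_iff forall_3)
    moreover have "ccross a u1 = cdot (vcnj u1) u1 *s vcnj u2 + (- cdot (vcnj u2) u1) *s vcnj u1"
      by (simp add: a_def ccross_def vec_eq_iff forall_3 cdot_def sum_3 algebra_simps)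
    ultimately have "vcnj u2 = 0" by (simp add: 1 o)
    then show False using 2(3) by (simp add: cdot_def)
  qed
  moreover have "cdot (vcnj u1) a = 0" "cdot (vcnj u2) a = 0"
    by (simp_all add: a_def cdot_def ccross_def sum_3 algebra_simps)
  note a = calculation this
  obtain u3 and r3 :: real where 3: "r3 \<ge> 0" "S *v u3 = of_real r3 *s vcnj u3" "cdot (vcnj u3) u3 = 1"
    "cdot (vcnj u1) u3 = 0" "cdot (vcnj u2) u3 = 0"
    by (rule takagi_step[OF S, of "{u1, u2}" a]) (use a 1 2 in auto)
  have o': "cdot (vcnj u3) u1 = 0" "cdot (vcnj u3) u2 = 0"
    using 3(4,5) cdot_vcnj[of "vcnj u1" u3] cdot_vcnj[of "vcnj u2" u3] by (simp_all add: cdot_commute)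
  define V :: "complex^3^3" where "V = (\<chi> i j. vector [u1, u2, u3] $ j $ i)"
  define s :: "real^3" where "s = vector [r1, r2, r3]"
  have V1: "adj V ** V = mat 1"
    using 1(3) 2(3,4) 3(3-5) o o'
    by (simp add: V_def vec_eq_iff forall_3 matrix_matrix_mult_def mat_def cdot_def vcnj_def)
  define U where "U = map_matrix cnj V"
  have SV: "S ** V = U ** diag s"
    using 1(2) 2(2) 3(2)
    by (simp add: V_def U_def vec_eq_iff forall_3 matrix_matrix_mult_def matrix_vector_mult_def
        diag_def s_def sum_3 vcnj_def)
  show ?thesis
  proof (rule that[of U s])
    have "adj U ** U = map_matrix cnj (adj V ** V)"
      by (simp add: U_def vec_eq_iff matrix_matrix_mult_def)
    then show "U \<in> unitary_group" by (simp add: V1 unitary_iff vec_eq_iff mat_def)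
    show "s $ i \<ge> 0" for i using 1(1) 2(1) 3(1) exhaust_3[of i] by (auto simp: s_def)
    have "transpose U = adj V" by (simp add: U_def vec_eq_iff transpose_def)
    moreover have "S = S ** (V ** adj V)"
      using V1 unitary_iff unitary_iff' by (metis matrix_mul_rid)
    ultimately show "S = U ** diag s ** transpose U"
      by (metis SV matrix_mul_assoc)
  qed
qed

section \<open>The groups U(2), SU(2) and SO(3)\<close>

lemma continuous_on_matrix:
  fixes f :: "'a::topological_space \<Rightarrow> 'b::topological_space^'n^'m"
  assumes "\<And>i j. continuous_on A (\<lambda>x. f x $ i $ j)"
  shows "continuous_on A f"
proof -
  have "continuous_on A (\<lambda>x. \<chi> i j. f x $ i $ j)"
    by (intro continuous_on_vec_lambda assms)
  then show ?thesis by simp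
qed

definition su2 :: "complex \<Rightarrow> complex \<Rightarrow> complex^2^2" where
  "su2 a b = vector [vector [a, - cnj b], vector [b, cnj a]]"

lemma su2_nth [simp]: "su2 a b $ 1 $ 1 = a" "su2 a b $ 1 $ 2 = - cnj b" "su2 a b $ 2 $ 1 = b" "su2 a b $ 2 $ 2 = cnj a"
  by (simp_all add: su2_def)

lemma cnj_mult_self: "a * cnj a = of_real ((cmod a)\<^sup>2)" "cnj a * a = of_real ((cmod a)\<^sup>2)"
  by (simp_all add: complex_norm_square mult.commute del: of_real_power)

lemma su2_in: "(cmod a)\<^sup>2 + (cmod b)\<^sup>2 = 1 \<Longrightarrow> su2 a b \<in> SU2"
proof -
  assume *: "(cmod a)\<^sup>2 + (cmod b)\<^sup>2 = 1"
  then have 1: "a * cnj a + b * cnj b = 1"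
    unfolding cnj_mult_self by (metis of_real_1 of_real_add)
  then show ?thesis
    by (auto simp: SU2_def U2_def unitary_iff vec_eq_iff forall_2 matrix_matrix_mult_def sum_2 mat_def det_2 algebra_simps)
qed

text \<open>The second column of a unitary matrix is determined by the first one and the determinant.\<close>

lemma U2_entries:
  assumes "g \<in> U2"
  shows "(cmod (g $ 1 $ 1))\<^sup>2 + (cmod (g $ 2 $ 1))\<^sup>2 = 1"
    and "g $ 1 $ 2 = - det g * cnj (g $ 2 $ 1)" and "g $ 2 $ 2 = det g * cnj (g $ 1 $ 1)"
    and "cmod (det g) = 1"
proof -
  have g: "adj g ** g = mat 1" using assms by (simp add: U2_def unitary_iff)
  have 1: "cnj (g$1$1) * g$1$1 + cnj (g$2$1) * g$2$1 = 1" and 2: "cnj (g$1$1) * g$1$2 + cnj (g$2$1) * g$2$2 = 0"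
    using g by (simp_all add: vec_eq_iff forall_2 matrix_matrix_mult_def sum_2 mat_def)
  have "complex_of_real ((cmod (g $ 1 $ 1))\<^sup>2 + (cmod (g $ 2 $ 1))\<^sup>2) = 1"
    using 1 unfolding cnj_mult_self by simp
  then show "(cmod (g $ 1 $ 1))\<^sup>2 + (cmod (g $ 2 $ 1))\<^sup>2 = 1" by (metis of_real_eq_1_iff)
  have "- det g * cnj (g $ 2 $ 1) = - g$1$1 * (cnj (g$2$1) * g$2$2) + (cnj (g$2$1) * g$2$1) * g$1$2"
    by (simp add: det_2 algebra_simps)
  also have "\<dots> = (cnj (g$1$1) * g$1$1 + cnj (g$2$1) * g$2$1) * g$1$2"
    using 2 by (simp add: add_eq_0_iff2 algebra_simps)
  finally show "g $ 1 $ 2 = - det g * cnj (g $ 2 $ 1)" by (simp add: 1)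
  have "det g * cnj (g $ 1 $ 1) = cnj (g$1$1) * g$1$1 * g$2$2 - (cnj (g$1$1) * g$1$2) * g$2$1"
    by (simp add: det_2 algebra_simps)
  also have "\<dots> = (cnj (g$1$1) * g$1$1 + cnj (g$2$1) * g$2$1) * g$2$2"
    using 2 by (simp add: add_eq_0_iff algebra_simps)
  finally show "g $ 2 $ 2 = det g * cnj (g $ 1 $ 1)" by (simp add: 1)
  have "cnj (det g) * det g = 1" using assms by (simp add: U2_def unitary_det)
  then have "complex_of_real ((cmod (det g))\<^sup>2) = 1" unfolding cnj_mult_self .
  then have "(cmod (det g))\<^sup>2 = 1" by (metis of_real_eq_1_iff)
  then have "cmod (det g) = 1 \<or> cmod (det g) = - 1" by (simp add: power2_eq_1_iff)
  then show "cmod (det g) = 1" using norm_ge_zero[of "det g"] by linarith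
qed

lemma SU2_eq: "SU2 = {su2 a b | a b. (cmod a)\<^sup>2 + (cmod b)\<^sup>2 = 1}"
proof (intro subset_antisym subsetI)
  fix g assume g: "g \<in> SU2"
  then have u: "g \<in> U2" "det g = 1" by (auto simp: SU2_def)
  then have "g = su2 (g$1$1) (g$2$1)"
    using U2_entries(2,3)[OF u(1)] by (simp add: vec_eq_iff forall_2)
  then show "g \<in> {su2 a b | a b. (cmod a)\<^sup>2 + (cmod b)\<^sup>2 = 1}" using U2_entries(1)[OF u(1)] by blast
qed (auto intro: su2_in)

lemma sphere_pair: "(a, b) \<in> sphere (0::complex \<times> complex) 1 \<longleftrightarrow> (cmod a)\<^sup>2 + (cmod b)\<^sup>2 = 1"
  by (simp add: norm_Pair)

text \<open>\<open>SU(2)\<close> is the 3-sphere of its first columns.\<close>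

lemma connected_SU2: "connected SU2"
proof -
  have "continuous_on UNIV (\<lambda>x. su2 (fst x) (snd x))"
  proof (rule continuous_on_matrix)
    fix i j :: 2
    show "continuous_on UNIV (\<lambda>x. su2 (fst x) (snd x) $ i $ j)"
      using exhaust_2[of i] exhaust_2[of j] by (elim disjE) (simp_all; intro continuous_intros)+
  qed
  then have "connected ((\<lambda>x. su2 (fst x) (snd x)) ` sphere (0::complex \<times> complex) 1)"
    by (intro connected_continuous_image connected_sphere) (auto intro: continuous_on_subset)
  also have "(\<lambda>x. su2 (fst x) (snd x)) ` sphere (0::complex \<times> complex) 1 = SU2"
  proof (intro subset_antisym subsetI)
    fix g assume "g \<in> SU2"
    then obtain a b where "g = su2 a b" "(a, b) \<in> sphere 0 1" unfolding SU2_eq sphere_pair by blast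
    then show "g \<in> (\<lambda>x. su2 (fst x) (snd x)) ` sphere 0 1" by (intro image_eqI) simp_all
  qed (use su2_in sphere_pair in \<open>auto simp del: mem_sphere\<close>)
  finally show ?thesis .
qed

text \<open>A unitary matrix is an element of \<open>SU(2)\<close> times \<open>diag(1, u)\<close>, where \<open>u\<close> is its determinant.\<close>

lemma connected_U2: "connected U2"
proof -
  define F where "F = (\<lambda>x. su2 (fst (fst x)) (snd (fst x)) ** (\<chi> i j. if i = j then (if i = 2 then snd x else 1) else 0) :: complex^2^2)"
  have Fe: "F x = vector [vector [fst (fst x), - snd x * cnj (snd (fst x))], vector [snd (fst x), snd x * cnj (fst (fst x))]]" for x
    by (simp add: F_def vec_eq_iff forall_2 matrix_matrix_mult_def sum_2)
  have "continuous_on UNIV F"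
  proof (rule continuous_on_matrix)
    fix i j :: 2
    show "continuous_on UNIV (\<lambda>x. F x $ i $ j)"
      unfolding Fe using exhaust_2[of i] exhaust_2[of j] by (elim disjE) (simp_all; intro continuous_intros)+
  qed
  then have "connected (F ` (sphere (0::complex \<times> complex) 1 \<times> sphere (0::complex) 1))"
    by (intro connected_continuous_image connected_Times connected_sphere) (auto intro: continuous_on_subset)
  also have "F ` (sphere (0::complex \<times> complex) 1 \<times> sphere (0::complex) 1) = U2"
  proof (intro subset_antisym subsetI)
    fix g assume "g \<in> F ` (sphere (0::complex \<times> complex) 1 \<times> sphere (0::complex) 1)"
    then obtain x u where g': "g = F (x, u)" and x: "x \<in> sphere 0 1" and u: "cmod u = 1"
      by auto
    obtain a b where ab: "x = (a, b)" by (cases x)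
    have g: "g = F ((a, b), u)" and 1: "(cmod a)\<^sup>2 + (cmod b)\<^sup>2 = 1" "cmod u = 1"
      using g' u x unfolding ab sphere_pair by auto
    have "su2 a b \<in> unitary_group" using su2_in[OF 1(1)] by (simp add: SU2_def U2_def)
    moreover have "cnj u * u = 1" using 1(2) unfolding cnj_mult_self by simp
    then have "(\<chi> i j. if i = j then (if i = 2 then u else 1) else 0) \<in> (unitary_group :: (complex^2^2) set)"
      by (simp add: unitary_iff vec_eq_iff forall_2 matrix_matrix_mult_def sum_2 mat_def)
    ultimately show "g \<in> U2" unfolding g F_def U2_def fst_conv snd_conv by (rule unitary_mult)
  next
    fix g assume g: "g \<in> U2"
    have "g = F ((g$1$1, g$2$1), det g)"
      using U2_entries[OF g] by (simp add: Fe vec_eq_iff forall_2)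
    moreover have "(g$1$1, g$2$1) \<in> sphere 0 1" unfolding sphere_pair by (rule U2_entries(1)[OF g])
    moreover have "det g \<in> sphere 0 1" using U2_entries(4)[OF g] by simp
    ultimately show "g \<in> F ` (sphere (0::complex \<times> complex) 1 \<times> sphere (0::complex) 1)" by blast
  qed
  finally show ?thesis .
qed

text \<open>The action of \<open>su2 a b\<close> by conjugation on the Hermitian matrices with rows
  \<open>(x\<^sub>3, x\<^sub>1 - i x\<^sub>2)\<close> and \<open>(x\<^sub>1 + i x\<^sub>2, -x\<^sub>3)\<close>, in the coordinates \<open>x\<^sub>1, x\<^sub>2, x\<^sub>3\<close>. The formula makes
  sense, and is multiplicative, for all quaternions \<open>(a, b)\<close>.\<close>

definition rot :: "complex \<Rightarrow> complex \<Rightarrow> real^3^3" where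
  "rot a b = vector [
     vector [Re ((cnj a)\<^sup>2 - b\<^sup>2), - Im ((cnj a)\<^sup>2 + b\<^sup>2), 2 * Re (cnj a * b)],
     vector [Im ((cnj a)\<^sup>2 - b\<^sup>2), Re ((cnj a)\<^sup>2 + b\<^sup>2), 2 * Im (cnj a * b)],
     vector [- 2 * Re (a * b), - 2 * Im (a * b), (cmod a)\<^sup>2 - (cmod b)\<^sup>2]]"

lemma rot_mult: "rot a b ** rot c d = rot (a * c - cnj b * d) (b * c + cnj a * d)"
  unfolding rot_def cmod_power2
  by (simp add: vec_eq_iff forall_3 matrix_matrix_mult_def sum_3 power2_eq_square algebra_simps)

lemma rot_transpose: "rot a b ** transpose (rot a b) = mat (((cmod a)\<^sup>2 + (cmod b)\<^sup>2)\<^sup>2)"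
  unfolding rot_def cmod_power2
  by (simp add: vec_eq_iff forall_3 matrix_matrix_mult_def sum_3 transpose_def mat_def power2_eq_square
      algebra_simps)

lemma rot_det: "det (rot a b) = ((cmod a)\<^sup>2 + (cmod b)\<^sup>2)^3"
  unfolding rot_def cmod_power2
  by (simp add: det_3 power2_eq_square power3_eq_cube algebra_simps)

lemma rot_SO3: "(cmod a)\<^sup>2 + (cmod b)\<^sup>2 = 1 \<Longrightarrow> rot a b \<in> SO3"
  using rot_transpose[of a b] rot_det[of a b]
  by (simp add: SO3_def rotation_matrix_def orthogonal_matrix_def matrix_left_right_inverse)

definition spin :: "complex^2^2 \<Rightarrow> real^3^3" where
  "spin g = rot (g $ 1 $ 1) (g $ 2 $ 1)"

lemma SU2_mult: "g \<in> SU2 \<Longrightarrow> h \<in> SU2 \<Longrightarrow> g ** h \<in> SU2"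
  by (simp add: SU2_def U2_def unitary_mult det_mul)

lemma SU2_adj: "g \<in> SU2 \<Longrightarrow> adj g \<in> SU2"
  by (simp add: SU2_def U2_def unitary_adj det_adj)

lemma SU2_1: "mat 1 \<in> SU2"
  by (simp add: SU2_def U2_def unitary_mat1)

lemma spin_mult:
  assumes "g \<in> SU2" "h \<in> SU2"
  shows "spin (g ** h) = spin g ** spin h"
proof -
  have "(g ** h) $ 1 $ 1 = g$1$1 * h$1$1 - cnj (g$2$1) * h$2$1" "(g ** h) $ 2 $ 1 = g$2$1 * h$1$1 + cnj (g$1$1) * h$2$1"
    using assms unfolding SU2_eq by (auto simp: matrix_matrix_mult_def sum_2)
  then show ?thesis by (simp add: spin_def rot_mult)
qed

lemma spin_SO3: "g \<in> SU2 \<Longrightarrow> spin g \<in> SO3"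
  unfolding SU2_eq by (auto simp: spin_def rot_SO3)

lemma spin_kernel:
  assumes "g \<in> SU2"
  shows "spin g = mat 1 \<longleftrightarrow> g = mat 1 \<or> g = - mat 1"
proof
  assume s: "spin g = mat 1"
  obtain a b where g: "g = su2 a b" and n: "(cmod a)\<^sup>2 + (cmod b)\<^sup>2 = 1"
    using assms unfolding SU2_eq by blast
  have "(cmod a)\<^sup>2 - (cmod b)\<^sup>2 = 1" "Re ((cnj a)\<^sup>2 - b\<^sup>2) = 1" "Im ((cnj a)\<^sup>2 - b\<^sup>2) = 0"
    using s by (simp_all add: spin_def g rot_def vec_eq_iff forall_3 mat_def vector_3)
  moreover have "b = 0"
  proof -
    have "(cmod b)\<^sup>2 = 0" using \<open>(cmod a)\<^sup>2 - (cmod b)\<^sup>2 = 1\<close> n by linarith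
    then show ?thesis by simp
  qed
  ultimately have "(cnj a)\<^sup>2 = 1" by (simp add: complex_eq_iff)
  then have "a = 1 \<or> a = - 1" by (metis complex_cnj_cnj complex_cnj_minus complex_cnj_one power2_eq_1_iff)
  then show "g = mat 1 \<or> g = - mat 1" using \<open>b = 0\<close> by (auto simp: g vec_eq_iff forall_2 mat_def)
next
  assume "g = mat 1 \<or> g = - mat 1"
  then show "spin g = mat 1" by (auto simp: spin_def mat_def rot_def vec_eq_iff forall_3)
qed

lemma SO3_mult: "R \<in> SO3 \<Longrightarrow> Q \<in> SO3 \<Longrightarrow> R ** Q \<in> SO3"
  by (simp add: SO3_def rotation_matrix_def orthogonal_matrix_mul det_mul)

lemma SO3_transpose: "R \<in> SO3 \<Longrightarrow> transpose R \<in> SO3"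
  by (simp add: SO3_def rotation_matrix_def orthogonal_matrix_transpose det_transpose)

text \<open>Rotations about the third axis come from diagonal matrices; the angle is halved by the square
  root.\<close>

lemma rot_fix_e3:
  assumes "Q \<in> SO3" and c: "Q $ 1 $ 3 = 0" "Q $ 2 $ 3 = 0" "Q $ 3 $ 3 = 1"
  obtains a where "cmod a = 1" "Q = rot a 0"
proof -
  have t: "transpose Q ** Q = mat 1" "Q ** transpose Q = mat 1" and d: "det Q = 1"
    using assms(1) by (auto simp: SO3_def rotation_matrix_def orthogonal_matrix_def)
  have r: "Q $ 3 $ 1 * Q $ 3 $ 1 + Q $ 3 $ 2 * Q $ 3 $ 2 + 1 = 1"
    using t(2) c by (simp add: vec_eq_iff forall_3 matrix_matrix_mult_def sum_3 transpose_def mat_def)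
  then have z: "Q $ 3 $ 1 = 0" "Q $ 3 $ 2 = 0" by (simp_all add: sum_squares_eq_zero_iff)
  have e: "Q$1$1 * Q$1$1 + Q$2$1 * Q$2$1 = 1" "Q$1$1 * Q$1$2 + Q$2$1 * Q$2$2 = 0" "Q$1$1 * Q$2$2 - Q$1$2 * Q$2$1 = 1"
    using t(1) d c z by (simp_all add: vec_eq_iff forall_3 matrix_matrix_mult_def sum_3 transpose_def mat_def det_3)
  have f: "Q$2$2 = Q$1$1" "Q$1$2 = - Q$2$1"
  proof -
    have "Q$2$2 = (Q$1$1 * Q$1$1 + Q$2$1 * Q$2$1) * Q$2$2" by (simp add: e)
    also have "\<dots> = Q$1$1 * (Q$1$1 * Q$2$2 - Q$1$2 * Q$2$1) + Q$2$1 * (Q$1$1 * Q$1$2 + Q$2$1 * Q$2$2)"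
      by (simp add: algebra_simps)
    finally show "Q$2$2 = Q$1$1" by (simp add: e)
    have "Q$1$2 = (Q$1$1 * Q$1$1 + Q$2$1 * Q$2$1) * Q$1$2" by (simp add: e)
    also have "\<dots> = Q$1$1 * (Q$1$1 * Q$1$2 + Q$2$1 * Q$2$2) - Q$2$1 * (Q$1$1 * Q$2$2 - Q$1$2 * Q$2$1)"
      by (simp add: algebra_simps)
    finally show "Q$1$2 = - Q$2$1" by (simp add: e)
  qed
  define a where "a = cnj (csqrt (Complex (Q$1$1) (Q$2$1)))"
  have aa: "(cnj a)\<^sup>2 = Complex (Q$1$1) (Q$2$1)" by (simp add: a_def)
  have "cmod ((cnj a)\<^sup>2) = 1" unfolding aa using e(1) by (simp add: cmod_def power2_eq_square)
  then have "cmod a = 1 \<or> cmod a = - 1" by (simp add: norm_power power2_eq_1_iff)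
  then have "cmod a = 1" using norm_ge_zero[of a] by linarith
  moreover have "Q = rot a 0"
    using \<open>cmod a = 1\<close> by (simp add: vec_eq_iff forall_3 rot_def vector_3 aa c z f)
  ultimately show ?thesis by (rule that)
qed

text \<open>The last column of \<open>rot a b\<close> is the Hopf map from the 3-sphere onto the 2-sphere. Since that map
  is onto, every rotation can be composed with an element of the image so as to fix the third basis vector.\<close>

lemma spin_surj: "spin ` SU2 = SO3"
proof (intro subset_antisym subsetI)
  fix R assume R: "R \<in> SO3"
  define v1 v2 v3 where "v1 = R $ 1 $ 3" and "v2 = R $ 2 $ 3" and "v3 = R $ 3 $ 3"
  have "transpose R ** R = mat 1" using R by (simp add: SO3_def rotation_matrix_def orthogonal_matrix_def)
  then have v: "v1 * v1 + v2 * v2 + v3 * v3 = 1"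
    by (simp add: vec_eq_iff forall_3 matrix_matrix_mult_def sum_3 transpose_def mat_def v1_def v2_def v3_def)
  have "v3 * v3 \<le> 1" using v zero_le_square[of v1] zero_le_square[of v2] by linarith
  then have v3: "v3 \<ge> - 1" by (metis abs_le_iff abs_square_le_1 minus_le_iff power2_eq_square)
  obtain a b where ab: "(cmod a)\<^sup>2 + (cmod b)\<^sup>2 = 1" "2 * (cnj a * b) = Complex v1 v2" "(cmod a)\<^sup>2 - (cmod b)\<^sup>2 = v3"
  proof (cases "v3 = - 1")
    case True
    then have "v1 * v1 + v2 * v2 = 0" using v by simp
    then have "v1 = 0" "v2 = 0" by (simp_all add: sum_squares_eq_zero_iff)
    then show ?thesis using True by (intro that[of 0 1]) (simp_all add: complex_eq_iff)
  next
    case False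
    define r where "r = sqrt ((1 + v3) / 2)"
    have r: "r > 0" "r\<^sup>2 = (1 + v3) / 2" using False v3 by (simp_all add: r_def)
    have "(cmod (Complex v1 v2))\<^sup>2 = (1 - v3) * (1 + v3)" using v by (simp add: cmod_power2) (simp add: power2_eq_square algebra_simps)
    then have "(cmod (Complex v1 v2 / of_real (2 * r)))\<^sup>2 = (1 - v3) * (1 + v3) / (4 * r\<^sup>2)"
      using r by (simp add: norm_divide power_divide power_mult_distrib)
    also have "\<dots> = (1 - v3) / 2" using False v3 by (simp add: r(2) field_simps)
    finally have b: "(cmod (Complex v1 v2 / of_real (2 * r)))\<^sup>2 = (1 - v3) / 2" .
    show ?thesis
      by (rule that[of "of_real r" "Complex v1 v2 / of_real (2 * r)"])
         (use r b in \<open>simp_all add: field_simps\<close>)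
  qed
  define Q where "Q = transpose (rot a b) ** R"
  have "rot a b \<in> SO3" by (rule rot_SO3[OF ab(1)])
  then have Q: "Q \<in> SO3" and o: "rot a b ** transpose (rot a b) = mat 1" "transpose (rot a b) ** rot a b = mat 1"
    using R by (simp_all add: Q_def SO3_mult SO3_transpose) (simp_all add: SO3_def rotation_matrix_def orthogonal_matrix_def)
  have RQ: "R = rot a b ** Q" by (simp add: Q_def matrix_mul_assoc o)
  have col: "R $ i $ 3 = rot a b $ i $ 3" for i
  proof -
    have "Re (2 * (cnj a * b)) = v1" "Im (2 * (cnj a * b)) = v2" by (simp_all add: ab(2))
    then show ?thesis using exhaust_3[of i] ab(3) by (auto simp: rot_def v1_def v2_def v3_def)
  qed
  then have "Q $ i $ 3 = (transpose (rot a b) ** rot a b) $ i $ 3" for i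
    by (simp add: Q_def matrix_matrix_mult_def)
  then have "Q $ 1 $ 3 = 0" "Q $ 2 $ 3 = 0" "Q $ 3 $ 3 = 1" by (simp_all add: o mat_def)
  then obtain c where c: "cmod c = 1" "Q = rot c 0" using rot_fix_e3[OF Q] by blast
  have "R = spin (su2 a b ** su2 c 0)"
    using spin_mult[of "su2 a b" "su2 c 0"] su2_in[of a b] su2_in[of c 0] ab(1) c
    by (simp add: RQ spin_def)
  moreover have "su2 a b ** su2 c 0 \<in> SU2"
    using su2_in[of a b] su2_in[of c 0] ab(1) c by (simp add: SU2_mult)
  ultimately show "R \<in> spin ` SU2" by blast
qed (auto simp: spin_SO3)

lemma continuous_spin: "continuous_on A spin"
proof (rule continuous_on_matrix)
  fix i j :: 3
  show "continuous_on A (\<lambda>x. spin x $ i $ j)"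
    using exhaust_3[of i] exhaust_3[of j]
    by (elim disjE) (simp_all add: spin_def rot_def; intro continuous_intros)+
qed

lemma connected_SO3: "connected SO3"
  unfolding spin_surj[symmetric] by (rule connected_continuous_image[OF continuous_spin connected_SU2])

section \<open>The stabiliser of a symmetric matrix\<close>

lemma scal_mult: "scal c A ** B = scal c (A ** B)" "A ** scal c B = scal c (A ** B)"
  by (simp_all add: vec_eq_iff matrix_matrix_mult_def sum_distrib_left algebra_simps)

lemma scal_cancel: "c \<noteq> 0 \<Longrightarrow> scal c A = scal c B \<longleftrightarrow> A = B"
  by (simp add: vec_eq_iff)

lemma unitary_cancel:
  assumes "U \<in> unitary_group"
  shows "adj U ** U = mat 1" "U ** adj U = mat 1"
    "transpose U ** transpose (adj U) = mat 1" "transpose (adj U) ** transpose U = mat 1"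
    "adj U ** (U ** X) = X" "U ** (adj U ** X) = X"
    "transpose U ** (transpose (adj U) ** X) = X" "transpose (adj U) ** (transpose U ** X) = X"
proof -
  show 1: "adj U ** U = mat 1" "U ** adj U = mat 1"
    using assms unitary_iff unitary_iff' by blast+
  then show 2: "transpose U ** transpose (adj U) = mat 1" "transpose (adj U) ** transpose U = mat 1"
    by (simp_all flip: matrix_transpose_mul)
  show "adj U ** (U ** X) = X" "U ** (adj U ** X) = X"
    "transpose U ** (transpose (adj U) ** X) = X" "transpose (adj U) ** (transpose U ** X) = X"
    by (simp_all add: matrix_mul_assoc 1 2)
qed

lemma det_unitary_conj:
  assumes "U \<in> unitary_group"
  shows "det (U ** N ** adj U) = det N"
proof -
  have "det (U ** N ** adj U) = (cnj (det U) * det U) * det N" by (simp add: det_mul det_adj)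
  then show ?thesis using unitary_det[OF assms] by simp
qed

lemma unitary_congruence_inject:
  assumes U: "U \<in> unitary_group"
  shows "U ** A ** transpose U = U ** B ** transpose U \<longleftrightarrow> A = B"
proof
  assume "U ** A ** transpose U = U ** B ** transpose U"
  then have "adj U ** (U ** A ** transpose U) ** transpose (adj U) = adj U ** (U ** B ** transpose U) ** transpose (adj U)"
    by simp
  then show "A = B" by (simp add: unitary_cancel[OF U] flip: matrix_mul_assoc)
qed simp

lemma conj_in_Stab_iff:
  assumes U: "U \<in> unitary_group" and "c \<noteq> 0" and N: "N \<in> unitary_group"
  shows "U ** N ** adj U \<in> Stab (scal c (U ** A ** transpose U)) \<longleftrightarrow> N \<in> Stab A"
proof -
  let ?M = "U ** N ** adj U" and ?S = "scal c (U ** A ** transpose U)"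
  have M: "?M \<in> unitary_group" using U N by (simp add: unitary_mult unitary_adj)
  have "?M ** ?S ** transpose ?M = scal c (U ** (N ** A ** transpose N) ** transpose U)"
    by (simp add: scal_mult matrix_transpose_mul unitary_cancel[OF U] flip: matrix_mul_assoc)
  moreover have "scal (det ?M) ?S = scal c (U ** scal (det N) A ** transpose U)"
    by (simp add: det_unitary_conj[OF U] scal_mult mult.commute)
  ultimately show ?thesis
    using M N assms(2) by (simp add: Stab_def scal_cancel unitary_congruence_inject[OF U])
qed

text \<open>Replacing \<open>S\<close> by an equivalent matrix conjugates the stabiliser, because conjugation by a unitary
  matrix preserves determinants.\<close>

lemma Stab_conj:
  assumes U: "U \<in> unitary_group" and "c \<noteq> 0"
  shows "Stab (scal c (U ** A ** transpose U)) = (\<lambda>N. U ** N ** adj U) ` Stab A"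
proof (intro subset_antisym subsetI)
  fix M assume M: "M \<in> Stab (scal c (U ** A ** transpose U))"
  define N where "N = adj U ** M ** U"
  have "N \<in> unitary_group" using M U by (simp add: N_def Stab_def unitary_mult unitary_adj)
  moreover have "M = U ** N ** adj U"
    by (simp add: N_def unitary_cancel[OF U] flip: matrix_mul_assoc)
  ultimately show "M \<in> (\<lambda>N. U ** N ** adj U) ` Stab A"
    using conj_in_Stab_iff[OF assms, of N] M by blast
next
  fix M assume "M \<in> (\<lambda>N. U ** N ** adj U) ` Stab A"
  then obtain N where "M = U ** N ** adj U" "N \<in> Stab A" by blast
  moreover from this have "N \<in> unitary_group" by (simp add: Stab_def)
  ultimately show "M \<in> Stab (scal c (U ** A ** transpose U))"
    using conj_in_Stab_iff[OF assms, of N] by blast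
qed

section \<open>The Lie algebra of the stabiliser\<close>

text \<open>The conditions on \<open>a\<close> are the derivatives at the identity of the two equations that define the
  stabiliser of \<open>diag s\<close>: \<open>a\<close> is skew-Hermitian, and \<open>a D + D a\<^sup>t = tr(a) D\<close>.\<close>

definition stab_lie :: "real^3 \<Rightarrow> (complex^3^3) set" where
  "stab_lie s = {a. (\<forall>i j. a $ j $ i = - cnj (a $ i $ j)) \<and>
     (\<forall>i j. a $ i $ j * of_real (s $ j) + of_real (s $ i) * a $ j $ i
        = (if i = j then (a$1$1 + a$2$2 + a$3$3) * of_real (s $ i) else 0))}"

lemma stab_lieD:
  assumes "a \<in> stab_lie s"
  shows "a $ j $ i = - cnj (a $ i $ j)"
    and "a $ i $ j * of_real (s $ j) + of_real (s $ i) * a $ j $ i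
        = (if i = j then (a$1$1 + a$2$2 + a$3$3) * of_real (s $ i) else 0)"
  using assms unfolding stab_lie_def by blast+

lemma stab_lieI:
  assumes "\<And>i j. a $ j $ i = - cnj (a $ i $ j)"
    and "\<And>i j. a $ i $ j * of_real (s $ j) + of_real (s $ i) * a $ j $ i
        = (if i = j then (a$1$1 + a$2$2 + a$3$3) * of_real (s $ i) else 0)"
  shows "a \<in> stab_lie s"
  using assms unfolding stab_lie_def by blast

lemma subspace_stab_lie: "subspace (stab_lie s)"
proof (rule subspaceI)
  show "0 \<in> stab_lie s" by (rule stab_lieI) simp_all
next
  fix x y assume xy: "x \<in> stab_lie s" "y \<in> stab_lie s"
  show "x + y \<in> stab_lie s"
  proof (rule stab_lieI)
    fix i j
    show "(x + y) $ j $ i = - cnj ((x + y) $ i $ j)"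
      using stab_lieD(1)[OF xy(1), of j i] stab_lieD(1)[OF xy(2), of j i] by simp
    show "(x + y) $ i $ j * of_real (s $ j) + of_real (s $ i) * (x + y) $ j $ i
        = (if i = j then ((x + y)$1$1 + (x + y)$2$2 + (x + y)$3$3) * of_real (s $ i) else 0)"
      using arg_cong2[where f="(+)", OF stab_lieD(2)[OF xy(1), of i j] stab_lieD(2)[OF xy(2), of i j]]
      by (simp add: algebra_simps split: if_splits)
  qed
next
  fix x and c :: real assume x: "x \<in> stab_lie s"
  show "c *\<^sub>R x \<in> stab_lie s"
  proof (rule stab_lieI)
    fix i j
    show "(c *\<^sub>R x) $ j $ i = - cnj ((c *\<^sub>R x) $ i $ j)"
      using stab_lieD(1)[OF x, of j i] by simp
    show "(c *\<^sub>R x) $ i $ j * of_real (s $ j) + of_real (s $ i) * (c *\<^sub>R x) $ j $ i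
        = (if i = j then ((c *\<^sub>R x)$1$1 + (c *\<^sub>R x)$2$2 + (c *\<^sub>R x)$3$3) * of_real (s $ i) else 0)"
      using arg_cong[where f="\<lambda>z. c *\<^sub>R z", OF stab_lieD(2)[OF x, of i j]]
      unfolding vector_scaleR_component scaleR_conv_of_real[of c "z::complex" for z]
      by (simp add: algebra_simps split: if_splits)
  qed
qed

text \<open>An off-diagonal entry satisfies \<open>s\<^sub>j a\<^sub>i\<^sub>j = s\<^sub>i cnj a\<^sub>i\<^sub>j\<close>. As at most one \<open>s\<^sub>i\<close> is zero, it is real, and it
  vanishes unless \<open>s\<^sub>i = s\<^sub>j\<close>, which happens for at most one pair. So the sum of the three entries above the
  diagonal controls them all. The diagonal entries are imaginary, and with vanishing trace each
  nonzero \<open>s\<^sub>i\<close> kills \<open>a\<^sub>i\<^sub>i\<close>; the remaining one is killed by the trace.\<close>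

lemma stab_lie_eq_0:
  assumes s: "\<And>i. s $ i \<ge> 0" "\<And>i j. s $ i = 0 \<Longrightarrow> s $ j = 0 \<Longrightarrow> i = j"
    and ne: "\<not> (s $ 1 = s $ 2 \<and> s $ 2 = s $ 3)"
    and a: "a \<in> stab_lie s" and z: "Re (a$1$2 + a$1$3 + a$2$3) = 0" "Im (a$1$1 + a$2$2 + a$3$3) = 0"
  shows "a = 0"
proof -
  have sk: "a $ j $ i = - cnj (a $ i $ j)" for i j using a by (rule stab_lieD(1))
  have e: "a $ i $ j * of_real (s $ j) = of_real (s $ i) * cnj (a $ i $ j)" if "i \<noteq> j" for i j
  proof -
    have "a $ i $ j * of_real (s $ j) + of_real (s $ i) * a $ j $ i = 0" using stab_lieD(2)[OF a, of i j] that by simp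
    then show ?thesis by (simp add: sk[of j i])
  qed
  have re: "Re (a $ i $ j) = 0" if "s $ i \<noteq> s $ j" for i j
  proof -
    have "i \<noteq> j" using that by auto
    from arg_cong[OF e[OF this], of Re] show ?thesis using that by (simp add: mult.commute)
  qed
  have im: "Im (a $ i $ j) = 0" if "i \<noteq> j" for i j
  proof -
    have "Im (a $ i $ j) * (s $ i + s $ j) = 0"
      using arg_cong[OF e[OF that], of Im] by (simp add: algebra_simps)
    moreover have "s $ i + s $ j \<noteq> 0"
      using s(1)[of i] s(1)[of j] s(2)[of i j] that by linarith
    ultimately show ?thesis by simp
  qed
  have off: "a$1$2 = 0" "a$1$3 = 0" "a$2$3 = 0"
  proof -
    have "(s$1 \<noteq> s$2 \<and> s$1 \<noteq> s$3) \<or> (s$1 \<noteq> s$2 \<and> s$2 \<noteq> s$3) \<or> (s$1 \<noteq> s$3 \<and> s$2 \<noteq> s$3)"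
      using ne by auto
    then have "Re (a$1$2) = 0 \<and> Re (a$1$3) = 0 \<and> Re (a$2$3) = 0"
      using z(1) re[of 1 2] re[of 1 3] re[of 2 3] by auto
    then show "a$1$2 = 0" "a$1$3 = 0" "a$2$3 = 0"
      using im[of 1 2] im[of 1 3] im[of 2 3] by (simp_all add: complex_eq_iff)
  qed
  have dr: "Re (a $ i $ i) = 0" for i using arg_cong[OF sk[of i i], of Re] by simp
  have di: "Im (a $ i $ i) * s $ i = 0" for i
  proof -
    have "a $ i $ i * of_real (s $ i) + of_real (s $ i) * a $ i $ i = (a$1$1 + a$2$2 + a$3$3) * of_real (s $ i)"
      using stab_lieD(2)[OF a, of i i] by simp
    from arg_cong[OF this, of Im] show ?thesis using z(2) by auto
  qed
  have "Im (a$1$1) = 0 \<and> Im (a$2$2) = 0 \<and> Im (a$3$3) = 0"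
    using di[of 1] di[of 2] di[of 3] s(2)[of 1 2] s(2)[of 1 3] s(2)[of 2 3] z(2) by auto
  then have "a$1$1 = 0" "a$2$2 = 0" "a$3$3 = 0" using dr by (simp_all add: complex_eq_iff)
  then show "a = 0"
    using off sk[of 2 1] sk[of 3 1] sk[of 3 2] by (simp add: vec_eq_iff forall_3)
qed

lemma tangent_stab_lie:
  fixes n :: "real \<Rightarrow> complex^3^3"
  assumes n: "\<And>t. n t \<in> Stab (diag s)" and n0: "n 0 = mat 1"
    and d: "(n has_vector_derivative a) (at 0)"
  shows "a \<in> stab_lie s"
proof -
  have dn: "((\<lambda>t. n t $ i $ j) has_vector_derivative a $ i $ j) (at 0)" for i j
    using bounded_linear.has_vector_derivative[OF bounded_linear_compose[OF bounded_linear_vec_nth bounded_linear_vec_nth] d] .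
  have dc: "((\<lambda>t. cnj (n t $ i $ j)) has_vector_derivative cnj (a $ i $ j)) (at 0)" for i j
    using has_vector_derivative_cnj[OF dn] .
  have n0': "n 0 $ i $ j = (if i = j then 1 else 0)" for i j by (simp add: n0 mat_def)
  note der = has_vector_derivative_add has_vector_derivative_diff has_vector_derivative_mult dn dc
    has_vector_derivative_mult_left has_vector_derivative_mult_right
  have skew: "a $ j $ i = - cnj (a $ i $ j)" for i j
  proof -
    have "((\<lambda>t. cnj (n t $ 1 $ i) * n t $ 1 $ j + cnj (n t $ 2 $ i) * n t $ 2 $ j + cnj (n t $ 3 $ i) * n t $ 3 $ j)
       has_vector_derivative (cnj (a $ j $ i) + a $ i $ j)) (at 0)"
      by (rule has_vector_derivative_eq_rhs, (rule der)+)
         (use exhaust_3[of i] exhaust_3[of j] in \<open>auto simp: n0'\<close>)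
    moreover have "cnj (n t $ 1 $ i) * n t $ 1 $ j + cnj (n t $ 2 $ i) * n t $ 2 $ j + cnj (n t $ 3 $ i) * n t $ 3 $ j
        = (if i = j then 1 else 0)" for t
    proof -
      have "(adj (n t) ** n t) $ i $ j = mat 1 $ i $ j" using n[of t] by (simp add: Stab_def unitary_iff)
      then show ?thesis by (simp add: matrix_matrix_mult_def sum_3 mat_def)
    qed
    ultimately have "((\<lambda>t. if i = j then 1 else 0) has_vector_derivative (cnj (a $ j $ i) + a $ i $ j)) (at 0)"
      by simp
    then have "cnj (a $ j $ i) + a $ i $ j = 0"
      by (rule vector_derivative_unique_at) (rule has_vector_derivative_const)
    from arg_cong[OF this, of cnj] show ?thesis by (simp add: eq_neg_iff_add_eq_0)
  qed
  have "a $ i $ j * of_real (s $ j) + of_real (s $ i) * a $ j $ i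
        = (if i = j then (a$1$1 + a$2$2 + a$3$3) * of_real (s $ i) else 0)" for i j
  proof -
    have dd: "((\<lambda>t. det (n t)) has_vector_derivative (a$1$1 + a$2$2 + a$3$3)) (at 0)"
      unfolding det_3
      by (rule has_vector_derivative_eq_rhs, (rule der)+) (simp add: n0')
    have "((\<lambda>t. (n t $ i $ 1 * of_real (s $ 1)) * n t $ j $ 1 + (n t $ i $ 2 * of_real (s $ 2)) * n t $ j $ 2
         + (n t $ i $ 3 * of_real (s $ 3)) * n t $ j $ 3)
       has_vector_derivative (a $ i $ j * of_real (s $ j) + of_real (s $ i) * a $ j $ i)) (at 0)"
      by (rule has_vector_derivative_eq_rhs, (rule der)+)
         (use exhaust_3[of i] exhaust_3[of j] in \<open>auto simp: n0'\<close>)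
    moreover have "(n t $ i $ 1 * of_real (s $ 1)) * n t $ j $ 1 + (n t $ i $ 2 * of_real (s $ 2)) * n t $ j $ 2
         + (n t $ i $ 3 * of_real (s $ 3)) * n t $ j $ 3 = det (n t) * (if i = j then of_real (s $ i) else 0)" for t
    proof -
      have "(n t ** diag s ** transpose (n t)) $ i $ j = scal (det (n t)) (diag s) $ i $ j"
        using n[of t] by (simp add: Stab_def)
      then show ?thesis by (simp add: matrix_matrix_mult_def sum_3 diag_def transpose_def)
    qed
    ultimately have "((\<lambda>t. det (n t) * (if i = j then of_real (s $ i) else 0)) has_vector_derivative
        (a $ i $ j * of_real (s $ j) + of_real (s $ i) * a $ j $ i)) (at 0)" by simp
    then have "a $ i $ j * of_real (s $ j) + of_real (s $ i) * a $ j $ i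
        = (a$1$1 + a$2$2 + a$3$3) * (if i = j then of_real (s $ i) else 0)"
      by (rule vector_derivative_unique_at) (rule has_vector_derivative_mult_left[OF dd])
    then show ?thesis by simp
  qed
  with skew show ?thesis by (rule stab_lieI)
qed

lemma linear_matrix_sandwich: "linear (\<lambda>X. A ** complexify X ** B)" for A B :: "complex^3^3"
proof (rule linearI)
  show "A ** complexify (X + Y) ** B = A ** complexify X ** B + A ** complexify Y ** B" for X Y
    unfolding linear_add[OF linear_complexify]
    by (simp add: vec_eq_iff matrix_matrix_mult_def sum_3 algebra_simps)
  show "A ** complexify (r *\<^sub>R X) ** B = r *\<^sub>R (A ** complexify X ** B)" for r X
    unfolding linear_cmul[OF linear_complexify]
    by (simp add: vec_eq_iff matrix_matrix_mult_def sum_3 algebra_simps)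
qed

text \<open>The two real functionals of the previous lemma are the real and imaginary part of one real-linear
  map \<open>g\<close> into \<open>\<complex>\<close>. It is injective on a subspace that contains the tangent space.\<close>

lemma group_dim_le_2:
  assumes U: "U \<in> unitary_group" and s: "\<And>i. s $ i \<ge> 0" "\<And>i j. s $ i = 0 \<Longrightarrow> s $ j = 0 \<Longrightarrow> i = j"
    and ne: "\<not> (s $ 1 = s $ 2 \<and> s $ 2 = s $ 3)"
  shows "group_dim (isotropy0 (form_of (U ** diag s ** transpose U))) \<le> 2"
proof -
  let ?G = "isotropy0 (form_of (U ** diag s ** transpose U))"
  define l where "l X = adj U ** complexify X ** U" for X
  have linl: "linear l" unfolding l_def by (rule linear_matrix_sandwich)
  define g where "g X = (let a = l X in Complex (Re (a$1$2 + a$1$3 + a$2$3)) (Im (a$1$1 + a$2$2 + a$3$3)))" for X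
  have ling: "linear g"
    by (rule linearI)
       (simp_all add: g_def Let_def linear_add[OF linl] linear_cmul[OF linl] complex_eq_iff algebra_simps)
  define V where "V = {X. realify (complexify X) = X \<and> l X \<in> stab_lie s}"
  have "subspace V"
  proof (rule subspaceI)
    show "0 \<in> V"
      by (simp add: V_def linear_0[OF linl] linear_0[OF linear_complexify] linear_0[OF linear_realify]
          subspace_0[OF subspace_stab_lie])
    show "x + y \<in> V" if "x \<in> V" "y \<in> V" for x y
      using that by (simp add: V_def linear_add[OF linl] linear_add[OF linear_complexify]
          linear_add[OF linear_realify] subspace_add[OF subspace_stab_lie])
    show "c *\<^sub>R x \<in> V" if "x \<in> V" for c x
      using that by (simp add: V_def linear_cmul[OF linl] linear_cmul[OF linear_complexify]
          linear_cmul[OF linear_realify] subspace_scale[OF subspace_stab_lie])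
  qed
  have "X = 0" if "X \<in> V" "g X = 0" for X
  proof -
    have "l X = 0"
      using that by (intro stab_lie_eq_0[OF s ne]) (auto simp: V_def g_def Let_def complex_eq_iff)
    then have "complexify X = U ** 0 ** adj U"
      by (simp add: l_def unitary_cancel[OF U] flip: \<open>l X = 0\<close> matrix_mul_assoc)
    then have "complexify X = 0" by (simp add: vec_eq_iff matrix_matrix_mult_def)
    then have "realify (complexify X) = 0" by (simp add: linear_0[OF linear_realify])
    then show "X = 0" using that by (simp add: V_def)
  qed
  then have "inj_on g (span V)"
    using linear_injective_on_subspace_0[OF ling \<open>subspace V\<close>] \<open>subspace V\<close> by (simp add: span_eq_iff[THEN iffD2])
  then have "dim V = dim (g ` V)" by (simp add: dim_image_eq[OF ling])
  also have "\<dots> \<le> 2" using dim_subset_UNIV[of "g ` V"] by simp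
  finally have "dim V \<le> 2" .
  moreover have "tangent_space ?G \<subseteq> V"
  proof
    fix X assume "X \<in> tangent_space ?G"
    then obtain \<gamma> where g: "\<And>t. \<gamma> t \<in> ?G" "\<gamma> 0 = mat 1" and d: "(\<gamma> has_vector_derivative X) (at 0)"
      by (auto simp: tangent_space_def)
    have "?G \<subseteq> isotropy (form_of (U ** diag s ** transpose U))"
      by (simp add: isotropy0_def connected_component_subset)
    then have gi: "\<gamma> t \<in> realify ` Stab (U ** diag s ** transpose U)" for t
      using g(1)[of t] by (auto simp: isotropy_form_of)
    have rc: "realify (complexify (\<gamma> t)) = \<gamma> t" for t using gi[of t] by auto
    have "((\<lambda>t. realify (complexify (\<gamma> t))) has_vector_derivative realify (complexify X)) (at 0)"
      using bounded_linear.has_vector_derivative[OF linear_conv_bounded_linear[THEN iffD1, OF linear_compose[OF linear_complexify linear_realify]] d]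
      by (simp add: o_def)
    then have "realify (complexify X) = X"
      unfolding rc by (rule vector_derivative_unique_at[OF _ d])
    moreover have "l X \<in> stab_lie s"
    proof (rule tangent_stab_lie)
      show "l (\<gamma> t) \<in> Stab (diag s)" for t
      proof -
        obtain M where M: "\<gamma> t = realify M" "M \<in> Stab (U ** diag s ** transpose U)" using gi by blast
        then have "M \<in> (\<lambda>N. U ** N ** adj U) ` Stab (diag s)" using Stab_conj[OF U, of 1] by simp
        then obtain N where N: "M = U ** N ** adj U" "N \<in> Stab (diag s)" by blast
        have "l (\<gamma> t) = N" by (simp add: l_def M(1) N(1) unitary_cancel[OF U] flip: matrix_mul_assoc)
        then show ?thesis using N by simp
      qed
      have "complexify (mat 1) = mat 1" by (metis complexify_realify realify_mat1)
      then show "l (\<gamma> 0) = mat 1" by (simp add: l_def g(2) unitary_cancel[OF U])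
      show "((\<lambda>t. l (\<gamma> t)) has_vector_derivative l X) (at 0)"
        using bounded_linear.has_vector_derivative[OF linear_conv_bounded_linear[THEN iffD1, OF linl] d] .
    qed
    ultimately show "X \<in> V" by (simp add: V_def)
  qed
  ultimately show ?thesis
    unfolding group_dim_def using dim_subset le_trans by blast
qed

definition E33 :: "complex^3^3" where
  "E33 = (\<chi> i j. if i = 3 \<and> j = 3 then 1 else 0)"

definition rank_one :: "complex^3^3 \<Rightarrow> bool" where
  "rank_one S \<longleftrightarrow> (\<exists>U c. U \<in> unitary_group \<and> c \<noteq> 0 \<and> S = scal c (U ** E33 ** transpose U))"

text \<open>The nonzero multiples of unitary symmetric matrices. The factor \<open>mat 1\<close> makes the shape the
  same as in \<open>rank_one\<close>, so that the results about \<open>U ** A ** transpose U\<close> apply to both.\<close>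

definition conformal :: "complex^3^3 \<Rightarrow> bool" where
  "conformal S \<longleftrightarrow> (\<exists>U c. U \<in> unitary_group \<and> c \<noteq> 0 \<and> S = scal c (U ** mat 1 ** transpose U))"

text \<open>Permuting coordinates moves any diagonal matrix unit to the last place.\<close>

lemma diag_unit:
  obtains P where "P \<in> unitary_group" "(\<chi> i j. if i = k \<and> j = k then 1 else 0) = P ** E33 ** transpose P"
proof -
  consider "k = 1" | "k = 2" | "k = 3" using exhaust_3 by blast
  then show ?thesis
  proof cases
    case 1 then show ?thesis
      by (intro that[of "vector [vector [0,0,1], vector [0,1,0], vector [1,0,0]]"])
         (simp_all add: unitary_iff E33_def vec_eq_iff forall_3 matrix_matrix_mult_def sum_3 transpose_def mat_def)
  next
    case 2 then show ?thesis
      by (intro that[of "vector [vector [1,0,0], vector [0,0,1], vector [0,1,0]]"])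
         (simp_all add: unitary_iff E33_def vec_eq_iff forall_3 matrix_matrix_mult_def sum_3 transpose_def mat_def)
  next
    case 3 then show ?thesis
      by (intro that[of "mat 1"]) (simp_all add: unitary_mat1 E33_def)
  qed
qed

lemma diag_conformal:
  assumes "U \<in> unitary_group" "s $ 1 = s $ 2" "s $ 2 = s $ 3" "U ** diag s ** transpose U \<noteq> 0"
  shows "conformal (U ** diag s ** transpose U)"
proof -
  have d: "diag s = scal (of_real (s $ 1)) (mat 1)"
    using assms by (simp add: diag_def vec_eq_iff forall_3 mat_def)
  have "s $ 1 \<noteq> 0"
  proof
    assume "s $ 1 = 0"
    then have "U ** diag s ** transpose U = 0" by (simp add: d vec_eq_iff matrix_matrix_mult_def)
    with assms show False by simp
  qed
  then show ?thesis
    unfolding conformal_def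
    by (intro exI[of _ U] exI[of _ "of_real (s $ 1)"]) (simp add: assms d scal_mult)
qed

lemma group_dim_ge_3:
  assumes S: "symmetric S" "S \<noteq> 0" and dim: "3 \<le> group_dim (isotropy0 (form_of S))"
  shows "rank_one S \<or> conformal S"
proof -
  obtain U s where U: "U \<in> unitary_group" and s: "\<And>i. s $ i \<ge> 0" and Su: "S = U ** diag s ** transpose U"
    using takagi[OF S(1)] by metis
  consider "s $ 1 = s $ 2 \<and> s $ 2 = s $ 3" | i j where "i \<noteq> j" "s $ i = 0" "s $ j = 0" "\<not> (s $ 1 = s $ 2 \<and> s $ 2 = s $ 3)"
    | "\<And>i j. s $ i = 0 \<Longrightarrow> s $ j = 0 \<Longrightarrow> i = j" "\<not> (s $ 1 = s $ 2 \<and> s $ 2 = s $ 3)" by metis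
  then show ?thesis
  proof cases
    case 1
    then show ?thesis using diag_conformal[OF U] S(2) Su by blast
  next
    case 2
    obtain k where k: "\<And>l. l \<noteq> k \<Longrightarrow> s $ l = 0"
    proof -
      have ex3: "(\<exists>k::3. Q k) \<longleftrightarrow> Q 1 \<or> Q 2 \<or> Q 3" for Q by (metis exhaust_3)
      have "\<exists>k. \<forall>l. l = k \<or> l = i \<or> l = j"
        using exhaust_3[of i] exhaust_3[of j] \<open>i \<noteq> j\<close>
        by (elim disjE) (simp_all add: ex3 forall_3)
      then obtain k where "\<forall>l. l = k \<or> l = i \<or> l = j" by blast
      then have "l \<noteq> k \<Longrightarrow> s $ l = 0" for l using 2 by blast
      then show ?thesis by (rule that)
    qed
    obtain P where P: "P \<in> unitary_group" "(\<chi> i j. if i = k \<and> j = k then 1 else 0) = P ** E33 ** transpose P"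
      by (rule diag_unit)
    have "diag s = scal (of_real (s $ k)) (\<chi> i j. if i = k \<and> j = k then 1 else 0)"
      using k by (auto simp: diag_def vec_eq_iff)
    then have "S = scal (of_real (s $ k)) ((U ** P) ** E33 ** transpose (U ** P))"
      by (simp add: Su P(2) scal_mult matrix_transpose_mul matrix_mul_assoc)
    moreover have "s $ k \<noteq> 0" using 2(4) k by metis
    ultimately show ?thesis
      unfolding rank_one_def using unitary_mult[OF U P(1)] by (metis of_real_eq_0_iff)
  next
    case 3
    then show ?thesis using group_dim_le_2[OF U s] dim Su by force
  qed
qed

section \<open>Forms whose matrix has rank one\<close>

lemma continuous_sandwich:
  fixes f :: "'a::topological_space \<Rightarrow> complex^3^3"
  assumes "continuous_on A f"
  shows "continuous_on A (\<lambda>x. P ** f x ** Q)"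
proof (rule continuous_on_matrix)
  have "continuous_on A (\<lambda>x. f x $ k $ l)" for k l
    using assms by (intro bounded_linear.continuous_on[OF bounded_linear_vec_nth])
  note entry = this
  show "continuous_on A (\<lambda>x. (P ** f x ** Q) $ i $ j)" for i j
    unfolding matrix_matrix_mult_def vec_lambda_beta
    by (intro continuous_on_sum continuous_on_mult continuous_on_const entry)
qed

lemma continuous_realify: "continuous_on A f \<Longrightarrow> continuous_on A (\<lambda>x. realify (f x))"
  by (rule bounded_linear.continuous_on[OF linear_conv_bounded_linear[THEN iffD1, OF linear_realify]])

lemma continuous_complexify: "continuous_on A f \<Longrightarrow> continuous_on A (\<lambda>x. complexify (f x))"
  by (rule bounded_linear.continuous_on[OF linear_conv_bounded_linear[THEN iffD1, OF linear_complexify]])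

lemma isotropy0_form_of:
  assumes "connected (Stab S)"
  shows "isotropy0 (form_of S) = realify ` Stab S"
proof -
  have "connected (realify ` Stab S)"
    by (intro connected_continuous_image continuous_realify continuous_on_id assms)
  moreover have "mat 1 \<in> Stab S" by (simp add: Stab_def unitary_mat1)
  then have "mat 1 \<in> realify ` Stab S" by (metis image_eqI realify_mat1)
  ultimately show ?thesis
    unfolding isotropy0_def isotropy_form_of by (rule connected_component_eq_self)
qed

lemma diag_det_nth [simp]:
  "diag_det g $ 1 $ 1 = g $ 1 $ 1" "diag_det g $ 1 $ 2 = g $ 1 $ 2" "diag_det g $ 1 $ 3 = 0"
  "diag_det g $ 2 $ 1 = g $ 2 $ 1" "diag_det g $ 2 $ 2 = g $ 2 $ 2" "diag_det g $ 2 $ 3 = 0"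
  "diag_det g $ 3 $ 1 = 0" "diag_det g $ 3 $ 2 = 0" "diag_det g $ 3 $ 3 = det g"
  by (simp_all add: diag_det_def)

lemma diag_det_mult: "diag_det (g ** h) = diag_det g ** diag_det h"
  by (simp add: vec_eq_iff forall_3 det_mul) (simp add: matrix_matrix_mult_def sum_3 sum_2)

lemma diag_det_unitary:
  assumes "g \<in> U2"
  shows "diag_det g \<in> unitary_group"
proof -
  have "adj g ** g = mat 1" using assms by (simp add: U2_def unitary_iff)
  moreover have "cnj (det g) * det g = 1" using assms by (simp add: U2_def unitary_det)
  ultimately show ?thesis
    by (simp add: unitary_iff vec_eq_iff forall_3 forall_2 matrix_matrix_mult_def sum_3 sum_2 mat_def)
qed

lemma det_diag_det: "det (diag_det g) = det g * det g"
  by (simp add: det_3) (simp add: det_2 algebra_simps)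

text \<open>Comparing entries in \<open>M E33 M\<^sup>t = det(M) E33\<close> shows that the last column of \<open>M\<close> is \<open>\<mu> e\<^sub>3\<close> with
  \<open>\<mu>\<^sup>2 = det M\<close>. By unitarity \<open>M\<close> is block diagonal with blocks \<open>g\<close> and \<open>\<mu>\<close>, so
  \<open>\<mu>\<^sup>2 = det(g) \<mu>\<close>.\<close>

lemma Stab_E33: "Stab E33 = diag_det ` U2"
proof (intro subset_antisym subsetI)
  fix M assume "M \<in> Stab E33"
  then have M: "M \<in> unitary_group" and e: "M ** E33 ** transpose M = scal (det M) E33"
    by (auto simp: Stab_def)
  have "M $ i $ 3 * M $ j $ 3 = (if i = 3 \<and> j = 3 then det M else 0)" for i j
  proof -
    have "(M ** E33 ** transpose M) $ i $ j = M $ i $ 3 * M $ j $ 3"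
      by (simp add: matrix_matrix_mult_def sum_3 E33_def transpose_def)
    then show ?thesis unfolding e by (auto simp: E33_def)
  qed
  from this[of 1 1] this[of 2 2] this[of 3 3]
  have c: "M $ 1 $ 3 = 0" "M $ 2 $ 3 = 0" "M $ 3 $ 3 * M $ 3 $ 3 = det M" by simp_all
  have u: "adj M ** M = mat 1" "M ** adj M = mat 1" using unitary_cancel[OF M] by auto
  have n: "cnj (M$3$3) * M$3$3 = 1"
    using u(1) c by (simp add: vec_eq_iff forall_3 matrix_matrix_mult_def sum_3 mat_def)
  have "cnj (M$3$3) * M$3$1 = 0" "cnj (M$3$3) * M$3$2 = 0"
    using u(1) c by (simp_all add: vec_eq_iff forall_3 matrix_matrix_mult_def sum_3 mat_def)
  then have r: "M$3$1 = 0" "M$3$2 = 0" using n by auto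
  define g :: "complex^2^2" where "g = vector [vector [M$1$1, M$1$2], vector [M$2$1, M$2$2]]"
  have "g \<in> U2"
    using u(1) c r by (simp add: U2_def unitary_iff g_def vec_eq_iff forall_3 forall_2
        matrix_matrix_mult_def sum_3 sum_2 mat_def)
  have "det M = det g * M$3$3" using c r by (simp add: det_3 g_def det_2 algebra_simps)
  then have "M$3$3 = det g" using c(3) n by (metis mult_right_cancel mult_zero_right zero_neq_one)
  then have "M = diag_det g" using c r by (simp add: vec_eq_iff forall_3) (simp add: g_def)
  with \<open>g \<in> U2\<close> show "M \<in> diag_det ` U2" by blast
next
  fix M assume "M \<in> diag_det ` U2"
  then obtain g where g: "M = diag_det g" "g \<in> U2" by blast
  have "M ** E33 ** transpose M = scal (det M) E33"
    by (simp add: g det_diag_det vec_eq_iff forall_3 matrix_matrix_mult_def sum_3 transpose_def E33_def)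
  then show "M \<in> Stab E33" using diag_det_unitary[OF g(2)] by (simp add: Stab_def g)
qed

lemma continuous_diag_det: "continuous_on A diag_det"
proof (rule continuous_on_matrix)
  fix i j :: 3
  show "continuous_on A (\<lambda>x. diag_det x $ i $ j)"
    using exhaust_3[of i] exhaust_3[of j]
    by (elim disjE) (simp_all add: det_2; intro continuous_intros)+
qed

lemma connected_Stab_conj:
  assumes "connected (Stab A)" "U \<in> unitary_group" "c \<noteq> 0"
  shows "connected (Stab (scal c (U ** A ** transpose U)))"
  unfolding Stab_conj[OF assms(2,3)]
  by (intro connected_continuous_image continuous_sandwich continuous_on_id assms)

lemma connected_Stab_E33: "connected (Stab E33)"
  unfolding Stab_E33 by (intro connected_continuous_image continuous_diag_det connected_U2)

lemma top_group_isoI: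
  assumes mult: "\<And>a b. a \<in> H \<Longrightarrow> b \<in> H \<Longrightarrow> a ** b \<in> H"
    and hom: "\<And>a b. a \<in> H \<Longrightarrow> b \<in> H \<Longrightarrow> \<phi> (a ** b) = \<phi> a ** \<phi> b"
    and cont: "continuous_on H \<phi>" "continuous_on (\<phi> ` H) \<psi>" and inv: "\<And>a. a \<in> H \<Longrightarrow> \<psi> (\<phi> a) = a"
  shows "top_group_iso (\<phi> ` H) H"
proof -
  have "\<psi> \<in> hom (mat_grp (\<phi> ` H)) (mat_grp H)"
    using inv hom mult by (auto simp: hom_def mat_grp_def) (metis hom inv mult)
  moreover have "bij_betw \<psi> (\<phi> ` H) H"
    using inv by (intro bij_betw_byWitness[where f' = \<phi>]) auto
  ultimately have "\<psi> \<in> iso (mat_grp (\<phi> ` H)) (mat_grp H)"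
    by (simp add: iso_def mat_grp_def)
  moreover have "homeomorphism (\<phi> ` H) H \<psi> \<phi>"
    unfolding homeomorphism_def using inv cont by (auto simp: image_image)
  ultimately show ?thesis unfolding top_group_iso_def by blast
qed

lemma U2_mult: "g \<in> U2 \<Longrightarrow> h \<in> U2 \<Longrightarrow> g ** h \<in> U2"
  by (simp add: U2_def unitary_mult)

lemma rank_one_type_U2:
  assumes "rank_one S"
  shows "type_U2 (form_of S)"
proof -
  obtain U c where U: "U \<in> unitary_group" and c: "c \<noteq> 0" and S: "S = scal c (U ** E33 ** transpose U)"
    using assms by (auto simp: rank_one_def)
  define \<phi> where "\<phi> g = realify (U ** diag_det g ** adj U)" for g
  have i: "isotropy0 (form_of S) = \<phi> ` U2"
    using isotropy0_form_of[OF connected_Stab_conj[OF connected_Stab_E33 U c]]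
    by (simp add: S Stab_conj[OF U c] Stab_E33 image_image \<phi>_def)
  define \<psi> :: "real^6^6 \<Rightarrow> complex^2^2"
    where "\<psi> A = (let M = adj U ** complexify A ** U in vector [vector [M$1$1, M$1$2], vector [M$2$1, M$2$2]])" for A
  have "top_group_iso (\<phi> ` U2) U2"
  proof (rule top_group_isoI)
    show "\<phi> (a ** b) = \<phi> a ** \<phi> b" for a b
      by (simp add: \<phi>_def diag_det_mult unitary_cancel[OF U] flip: realify_mult matrix_mul_assoc)
    show "continuous_on U2 \<phi>"
      unfolding \<phi>_def by (intro continuous_realify continuous_sandwich continuous_diag_det)
    have "continuous_on (\<phi> ` U2) (\<lambda>A. adj U ** complexify A ** U)"
      by (intro continuous_sandwich continuous_complexify continuous_on_id)
    then have 1: "continuous_on (\<phi> ` U2) (\<lambda>A. (adj U ** complexify A ** U) $ i $ j)" for i j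
      by (intro bounded_linear.continuous_on[OF bounded_linear_vec_nth])
    show "continuous_on (\<phi> ` U2) \<psi>"
    proof (rule continuous_on_matrix)
      fix i j :: 2
      show "continuous_on (\<phi> ` U2) (\<lambda>x. \<psi> x $ i $ j)"
        using exhaust_2[of i] exhaust_2[of j] 1 by (elim disjE) (simp_all add: \<psi>_def Let_def)
    qed
    show "\<psi> (\<phi> a) = a" for a
      by (simp add: \<psi>_def \<phi>_def Let_def unitary_cancel[OF U] vec_eq_iff forall_2 flip: matrix_mul_assoc)
  qed (rule U2_mult)
  moreover have "\<phi> = (\<lambda>g. realify U ** realify (diag_det g) ** matrix_inv (realify U))"
    by (simp add: \<phi>_def fun_eq_iff matrix_inv_realify[OF U] realify_mult)
  moreover have "realify U \<in> U3" using U by (simp add: U3_eq)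
  ultimately show ?thesis unfolding type_U2_def i by blast
qed

text \<open>The scalar matrices \<open>exp(i t)\<close> join \<open>1\<close> to \<open>-1\<close> in the isotropy group of the zero form. This element
  distinguishes that group from those of both types.\<close>

lemma minus_one_isotropy0: "- mat 1 \<in> isotropy0 zero_form3"
proof -
  have Stab0: "Stab 0 = unitary_group"
    by (auto simp: Stab_def vec_eq_iff matrix_matrix_mult_def)
  define f where "f t = realify (\<chi> i j. if i = j then cis t else 0)" for t :: real
  have "continuous_on UNIV (\<lambda>t. (\<chi> i j. if i = j then cis t else 0) :: complex^3^3)"
  proof (rule continuous_on_matrix)
    show "continuous_on UNIV (\<lambda>t. (\<chi> i j. if i = j then cis t else 0 :: complex^3^3) $ i $ j)" for i j :: 3
      by (cases "i = j") (simp_all, intro continuous_intros)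
  qed
  then have "continuous_on UNIV f" unfolding f_def by (rule continuous_realify)
  then have "connected (f ` UNIV)" by (intro connected_continuous_image connected_UNIV)
  moreover have "f t \<in> isotropy zero_form3" for t
  proof -
    have "(\<chi> i j. if i = j then cis t else 0) \<in> (unitary_group :: (complex^3^3) set)"
      by (simp add: unitary_iff vec_eq_iff forall_3 matrix_matrix_mult_def sum_3 mat_def cis_cnj cis_mult)
    then show ?thesis
      unfolding form_of_0[symmetric] isotropy_form_of Stab0 f_def by blast
  qed
  then have "f ` UNIV \<subseteq> isotropy zero_form3" by blast
  moreover have "f 0 = mat 1"
  proof -
    have "(\<chi> i j. if i = j then cis 0 else 0) = (mat 1 :: complex^3^3)" by (simp add: vec_eq_iff mat_def)
    then show ?thesis by (simp add: f_def del: cis_zero)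
  qed
  moreover have "f pi = - mat 1"
  proof -
    have "(\<chi> i j. if i = j then cis pi else 0) = - (mat 1 :: complex^3^3)" by (simp add: vec_eq_iff mat_def)
    then show ?thesis by (simp add: f_def linear_neg[OF linear_realify] del: cis_pi)
  qed
  ultimately show ?thesis
    unfolding isotropy0_def connected_component_def mem_Collect_eq by (metis rangeI)
qed

text \<open>The zero form is excluded because \<open>diag(g, det g) = -1\<close> would give both \<open>g = -1\<close> and
  \<open>det g = -1\<close>. Otherwise take \<open>g = i\<close>: the matrix \<open>diag(i, i, -1)\<close> has determinant 1, so it
  fixes \<open>A\<close>, while it multiplies the entries of \<open>A\<close> other than the last diagonal one by \<open>-1\<close> or \<open>-i\<close>.\<close>

lemma type_U2_rank_one:
  assumes S: "symmetric S" and t: "type_U2 (form_of S)"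
  shows "rank_one S"
proof -
  obtain B where B: "B \<in> U3" and i: "isotropy0 (form_of S) = (\<lambda>g. B ** realify (diag_det g) ** matrix_inv B) ` U2"
    using t by (auto simp: type_U2_def)
  obtain V where V: "V \<in> unitary_group" and BV: "B = realify V" using B by (auto simp: U3_eq)
  have BB: "B ** realify (diag_det g) ** matrix_inv B = realify (V ** diag_det g ** adj V)" for g
    by (simp add: BV matrix_inv_realify[OF V] realify_mult)
  have "S \<noteq> 0"
  proof
    assume "S = 0"
    then have "- mat 1 \<in> isotropy0 (form_of S)" by (simp add: form_of_0 minus_one_isotropy0)
    then obtain g where "g \<in> U2" "- mat 1 = realify (V ** diag_det g ** adj V)" unfolding i BB by blast
    then have "complexify (- mat 1) = V ** diag_det g ** adj V" by simp
    moreover have "complexify (- mat 1) = - mat 1"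
      using linear_neg[OF linear_complexify, of "mat 1"] complexify_realify[of "mat 1"] by simp
    ultimately have "adj V ** (- mat 1) ** V = diag_det g"
      by (simp add: unitary_cancel[OF V] flip: matrix_mul_assoc)
    moreover have "adj V ** (- mat 1) ** V = - (adj V ** V)"
      by (simp add: vec_eq_iff forall_3 matrix_matrix_mult_def sum_3 mat_def)
    ultimately have "diag_det g = - mat 1" by (simp add: unitary_cancel[OF V])
    then have "g$1$1 = -1" "g$1$2 = 0" "g$2$1 = 0" "g$2$2 = -1" "det g = -1"
      by (simp_all add: vec_eq_iff forall_3 mat_def)
    then show False by (simp add: det_2)
  qed
  define A where "A = adj V ** S ** transpose (adj V)"
  have SA: "S = scal 1 (V ** A ** transpose V)"
    by (simp add: A_def unitary_cancel[OF V] flip: matrix_mul_assoc)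
  define g :: "complex^2^2" where "g = (\<chi> i j. if i = j then \<i> else 0)"
  have g: "g \<in> U2" by (simp add: g_def U2_def unitary_iff vec_eq_iff forall_2 matrix_matrix_mult_def sum_2 mat_def)
  have "isotropy0 (form_of S) \<subseteq> isotropy (form_of S)" by (simp add: isotropy0_def connected_component_subset)
  then have "realify (V ** diag_det g ** adj V) \<in> realify ` Stab S"
    using g unfolding i BB isotropy_form_of by blast
  then have "V ** diag_det g ** adj V \<in> Stab S" by (metis complexify_realify imageE)
  then have "diag_det g \<in> Stab A"
    using conj_in_Stab_iff[OF V _ diag_det_unitary[OF g], of 1 A] SA by simp
  then have e: "diag_det g ** A ** transpose (diag_det g) = scal (det g * det g) A"
    by (simp add: Stab_def det_diag_det)
  have "det g = -1" by (simp add: g_def det_2)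
  then have "A $ i $ j = 0" if "\<not> (i = 3 \<and> j = 3)" for i j
  proof -
    have "(diag_det g ** A ** transpose (diag_det g)) $ i $ j = A $ i $ j" using e \<open>det g = -1\<close> by simp
    then have "diag_det g $ i $ i * A $ i $ j * diag_det g $ j $ j = A $ i $ j"
      using exhaust_3[of i] exhaust_3[of j]
      by (elim disjE) (simp_all add: matrix_matrix_mult_def sum_3 transpose_def g_def)
    then show ?thesis
      using that exhaust_3[of i] exhaust_3[of j] \<open>det g = -1\<close>
      by (elim disjE) (auto simp: g_def complex_eq_iff)
  qed
  then have "A = scal (A$3$3) E33" by (auto simp: vec_eq_iff E33_def)
  then obtain a where A: "A = scal a E33" by blast
  have SS: "S = scal a (V ** E33 ** transpose V)"
    using SA by (simp add: A scal_mult)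
  have "a \<noteq> 0"
  proof
    assume "a = 0"
    then have "S = 0" by (simp add: SS vec_eq_iff)
    with \<open>S \<noteq> 0\<close> show False by simp
  qed
  then show ?thesis unfolding rank_one_def using V SS by blast
qed

section \<open>Forms whose matrix is a multiple of a unitary matrix\<close>

definition cplx :: "real^'n^'n \<Rightarrow> complex^'n^'n" where
  "cplx R = (\<chi> i j. of_real (R $ i $ j))"

lemma cplx_nth [simp]: "cplx R $ i $ j = of_real (R $ i $ j)"
  by (simp add: cplx_def)

lemma cplx_mult: "cplx (R ** Q) = cplx R ** cplx Q"
  by (simp add: vec_eq_iff matrix_matrix_mult_def)

lemma cplx_mat1 [simp]: "cplx (mat 1) = mat 1"
  by (simp add: vec_eq_iff mat_def)

lemma cplx_inject: "cplx R = cplx Q \<longleftrightarrow> R = Q"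
  by (simp add: vec_eq_iff)

lemma cplx_transpose: "transpose (cplx R) = cplx (transpose R)" "adj (cplx R) = cplx (transpose R)"
  by (simp_all add: vec_eq_iff transpose_def)

lemma det_cplx: "det (cplx R) = of_real (det R)" for R :: "real^3^3"
  by (simp add: det_3)

lemma cplx_unitary: "R \<in> SO3 \<Longrightarrow> cplx R \<in> unitary_group"
  by (simp add: unitary_iff cplx_transpose SO3_def rotation_matrix_def orthogonal_matrix_def flip: cplx_mult)

lemma scal_mat1: "scal c (mat 1) = mat c"
  by (simp add: vec_eq_iff mat_def)

text \<open>Taking determinants in \<open>M M\<^sup>t = det(M)\<close> gives \<open>det(M)\<^sup>2 = det(M)\<^sup>3\<close>, so \<open>det M = 1\<close>. Then the
  transpose and the adjoint of \<open>M\<close> are both its inverse, so \<open>M\<close> is real.\<close>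

lemma Stab_mat1: "Stab (mat 1) = cplx ` SO3"
proof (intro subset_antisym subsetI)
  fix M :: "complex^3^3" assume "M \<in> Stab (mat 1)"
  then have M: "M \<in> unitary_group" and e: "M ** transpose M = mat (det M)"
    by (auto simp: Stab_def scal_mat1)
  have "det M * det M = det M ^ 3"
    using arg_cong[OF e, of det] by (simp add: det_mul det_transpose) (simp add: det_3 mat_def power3_eq_cube)
  moreover have "det M \<noteq> 0" using unitary_det[OF M] by auto
  ultimately have d: "det M = 1" by (simp add: power3_eq_cube)
  have "adj M = adj M ** (M ** transpose M)" by (simp add: e d)
  also have "\<dots> = transpose M" by (simp add: unitary_cancel[OF M])
  finally have t: "adj M = transpose M" .
  have real: "Im (M $ i $ j) = 0" for i j
  proof -
    have "adj M $ j $ i = transpose M $ j $ i" by (simp only: t)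
    then show ?thesis by (simp add: transpose_def complex_eq_iff)
  qed
  define R :: "real^3^3" where "R = (\<chi> i j. Re (M $ i $ j))"
  have MR: "M = cplx R" using real by (simp add: R_def vec_eq_iff complex_eq_iff)
  have "cplx (transpose R ** R) = cplx (mat 1)"
    using unitary_cancel(1)[OF M] by (simp add: MR cplx_transpose cplx_mult)
  then have "transpose R ** R = mat 1" by (simp only: cplx_inject)
  then have "orthogonal_matrix R" by (simp add: orthogonal_matrix)
  moreover have "det R = 1" using d by (simp add: MR det_cplx)
  ultimately have "R \<in> SO3" by (simp add: SO3_def rotation_matrix_def)
  then show "M \<in> cplx ` SO3" using MR by blast
next
  fix M :: "complex^3^3" assume "M \<in> cplx ` SO3"
  then obtain R where R: "M = cplx R" "R \<in> SO3" by blast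
  have "det R = 1" "R ** transpose R = mat 1" using R(2) by (simp_all add: SO3_def rotation_matrix_def orthogonal_matrix_def)
  then have "M ** mat 1 ** transpose M = scal (det M) (mat 1)"
    by (simp add: R(1) cplx_transpose det_cplx flip: cplx_mult)
  then show "M \<in> Stab (mat 1)" using cplx_unitary[OF R(2)] by (simp add: Stab_def R(1))
qed

lemma continuous_cplx: "continuous_on A f \<Longrightarrow> continuous_on A (\<lambda>x. cplx (f x))" for f :: "'a::topological_space \<Rightarrow> real^'n^'n"
proof (rule continuous_on_matrix)
  assume f: "continuous_on A f"
  show "continuous_on A (\<lambda>x. cplx (f x) $ i $ j)" for i j
    unfolding cplx_nth
    by (intro continuous_on_of_real bounded_linear.continuous_on[OF bounded_linear_vec_nth] f)
qed

lemma connected_Stab_mat1: "connected (Stab (mat 1))"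
  unfolding Stab_mat1 by (intro connected_continuous_image continuous_cplx continuous_on_id connected_SO3)

text \<open>Two half-turns about coordinate axes and a cyclic permutation of the axes. These three rotations
  suffice to see that \<open>SO(3)\<close> is irreducible on \<open>\<complex>\<^sup>3\<close> and has trivial centre.\<close>

definition turn1 :: "real^3^3" where
  "turn1 = vector [vector [1,0,0], vector [0,-1,0], vector [0,0,-1]]"

definition turn2 :: "real^3^3" where
  "turn2 = vector [vector [-1,0,0], vector [0,1,0], vector [0,0,-1]]"

definition cycle3 :: "real^3^3" where
  "cycle3 = vector [vector [0,0,1], vector [1,0,0], vector [0,1,0]]"

lemmas turns_def = turn1_def turn2_def cycle3_def

lemma turns_SO3: "turn1 \<in> SO3" "turn2 \<in> SO3" "cycle3 \<in> SO3"
  by (simp_all add: turns_def SO3_def rotation_matrix_def orthogonal_matrix vec_eq_iff forall_3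
      matrix_matrix_mult_def sum_3 transpose_def mat_def det_3)

text \<open>Averaging a vector over a half-turn projects it to the axis, so a nonzero invariant subspace
  contains a coordinate vector, and the cyclic permutation then produces the others.\<close>

lemma SO3_irreducible:
  fixes W :: "(complex^3) set"
  assumes W: "vec.subspace W" and inv: "\<And>R w. R \<in> SO3 \<Longrightarrow> w \<in> W \<Longrightarrow> cplx R *v w \<in> W" and ne: "W \<noteq> {0}"
  shows "W = UNIV"
proof -
  obtain w where w: "w \<in> W" "w \<noteq> 0" using ne vec.subspace_0[OF W] by auto
  have C_step: "axis 2 1 \<in> W \<Longrightarrow> axis 3 1 \<in> W" "axis 1 1 \<in> W \<Longrightarrow> axis 2 1 \<in> W" "axis 3 1 \<in> W \<Longrightarrow> axis 1 1 \<in> W"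
  proof -
    have "cplx cycle3 *v axis 2 1 = axis 3 1" "cplx cycle3 *v axis 1 1 = axis 2 1" "cplx cycle3 *v axis 3 1 = axis 1 1"
      by (simp_all add: cycle3_def vec_eq_iff forall_3 matrix_vector_mult_def sum_3 axis_def)
    then show "axis 2 1 \<in> W \<Longrightarrow> axis 3 1 \<in> W" "axis 1 1 \<in> W \<Longrightarrow> axis 2 1 \<in> W" "axis 3 1 \<in> W \<Longrightarrow> axis 1 1 \<in> W"
      using inv[OF turns_SO3(3)] by metis+
  qed
  have sc: "c *s x \<in> W" if "x \<in> W" for c x using vec.subspace_scale[OF W that] .
  have ad: "x + y \<in> W" if "x \<in> W" "y \<in> W" for x y using vec.subspace_add[OF W that] .
  have "axis 1 1 \<in> W"
  proof -
    consider "w$1 \<noteq> 0" | "w$2 \<noteq> 0" | "w$3 \<noteq> 0" using w(2) by (auto simp: vec_eq_iff forall_3)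
    then show ?thesis
    proof cases
      case 1
      have "(1 / (2 * w$1)) *s (w + cplx turn1 *v w) \<in> W" by (intro sc ad w(1) inv turns_SO3)
      also have "(1 / (2 * w$1)) *s (w + cplx turn1 *v w) = axis 1 1"
        using 1 by (simp add: turn1_def vec_eq_iff forall_3 matrix_vector_mult_def sum_3 axis_def)
      finally show ?thesis .
    next
      case 2
      have "(1 / (2 * w$2)) *s (w + cplx turn2 *v w) \<in> W" by (intro sc ad w(1) inv turns_SO3)
      also have "(1 / (2 * w$2)) *s (w + cplx turn2 *v w) = axis 2 1"
        using 2 by (simp add: turn2_def vec_eq_iff forall_3 matrix_vector_mult_def sum_3 axis_def)
      finally show ?thesis using C_step by blast
    next
      case 3
      have "(1 / (2 * w$3)) *s (w + cplx turn1 *v (cplx turn2 *v w)) \<in> W" by (intro sc ad w(1) inv turns_SO3)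
      also have "(1 / (2 * w$3)) *s (w + cplx turn1 *v (cplx turn2 *v w)) = axis 3 1"
        using 3 by (simp add: turn1_def turn2_def vec_eq_iff forall_3 matrix_vector_mult_def sum_3 axis_def)
      finally show ?thesis using C_step by blast
    qed
  qed
  then have ax: "axis 1 1 \<in> W" "axis 2 1 \<in> W" "axis 3 1 \<in> W" using C_step by blast+
  have "x \<in> W" for x
  proof -
    have "x$1 *s axis 1 1 + x$2 *s axis 2 1 + x$3 *s axis 3 1 \<in> W" by (intro ad sc ax)
    also have "x$1 *s axis 1 1 + x$2 *s axis 2 1 + x$3 *s axis 3 1 = x"
      by (simp add: vec_eq_iff forall_3 axis_def)
    finally show ?thesis .
  qed
  then show ?thesis by blast
qed

lemma group_mat_grp:
  fixes H :: "('a::semiring_1^'n^'n) set"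
  assumes "\<And>a b. a \<in> H \<Longrightarrow> b \<in> H \<Longrightarrow> a ** b \<in> H" "mat 1 \<in> H" "\<And>a. a \<in> H \<Longrightarrow> \<exists>b\<in>H. b ** a = mat 1"
  shows "group (mat_grp H)"
  by (rule groupI) (use assms in \<open>auto simp: mat_grp_def matrix_mul_assoc\<close>)

lemma group_SU2: "group (mat_grp SU2)"
proof (rule group_mat_grp)
  fix a :: "complex^2^2" assume "a \<in> SU2"
  then have "adj a \<in> SU2" "adj a ** a = mat 1" using SU2_adj by (auto simp: SU2_def U2_def unitary_iff)
  then show "\<exists>b\<in>SU2. b ** a = mat 1" by blast
qed (rule SU2_mult SU2_1; assumption)+

text \<open>The representation is the double cover \<open>spin\<close>, followed by the inclusion of real into complex
  matrices and conjugation by \<open>U\<close>. The quotient statement is the first isomorphism theorem.\<close>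

lemma conformal_type_SO3:
  assumes "conformal S"
  shows "type_SO3 (form_of S)"
proof -
  obtain U c where U: "U \<in> unitary_group" and c: "c \<noteq> 0" and S: "S = scal c (U ** mat 1 ** transpose U)"
    using assms by (auto simp: conformal_def)
  define \<phi> where "\<phi> R = realify (U ** cplx R ** adj U)" for R
  define \<rho> where "\<rho> g = U ** cplx (spin g) ** adj U" for g
  have \<phi>_mult: "\<phi> (a ** b) = \<phi> a ** \<phi> b" for a b
    by (simp add: \<phi>_def cplx_mult unitary_cancel[OF U] flip: realify_mult matrix_mul_assoc)
  have \<rho>_mult: "\<rho> (a ** b) = \<rho> a ** \<rho> b" if "a \<in> SU2" "b \<in> SU2" for a b
    by (simp add: \<rho>_def spin_mult[OF that] cplx_mult unitary_cancel[OF U] flip: matrix_mul_assoc)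
  have i: "isotropy0 (form_of S) = \<phi> ` SO3"
    unfolding S isotropy0_form_of[OF connected_Stab_conj[OF connected_Stab_mat1 U c]]
      Stab_conj[OF U c] Stab_mat1 image_image \<phi>_def ..
  then have i': "isotropy0 (form_of S) = realify ` \<rho> ` SU2"
    by (simp add: spin_surj[symmetric] image_image \<phi>_def \<rho>_def)
  define \<psi> :: "real^6^6 \<Rightarrow> real^3^3" where "\<psi> A = (\<chi> i j. Re ((adj U ** complexify A ** U) $ i $ j))" for A
  have iso: "top_group_iso (\<phi> ` SO3) SO3"
  proof (rule top_group_isoI)
    show "continuous_on SO3 \<phi>"
      unfolding \<phi>_def by (intro continuous_realify continuous_sandwich continuous_cplx continuous_on_id)
    have "continuous_on (\<phi> ` SO3) (\<lambda>A. adj U ** complexify A ** U)"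
      by (intro continuous_sandwich continuous_complexify continuous_on_id)
    then show "continuous_on (\<phi> ` SO3) \<psi>"
      unfolding \<psi>_def
      by (intro continuous_on_vec_lambda continuous_on_Re bounded_linear.continuous_on[OF bounded_linear_vec_nth])
    show "\<psi> (\<phi> a) = a" for a
      by (simp add: \<psi>_def \<phi>_def unitary_cancel[OF U] vec_eq_iff flip: matrix_mul_assoc)
  qed (simp_all add: SO3_mult \<phi>_mult)
  have \<rho>_unitary: "\<rho> g \<in> unitary_group" if "g \<in> SU2" for g
    using that U by (simp add: \<rho>_def unitary_mult unitary_adj cplx_unitary spin_SO3)
  have \<rho>_1: "\<rho> g = mat 1 \<longleftrightarrow> g = mat 1 \<or> g = - mat 1" if "g \<in> SU2" for g
  proof -
    have "\<rho> g = mat 1 \<longleftrightarrow> spin g = mat 1"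
    proof
      assume "\<rho> g = mat 1"
      then have "adj U ** \<rho> g ** U = adj U ** U" by simp
      then have "cplx (spin g) = cplx (mat 1)"
        by (simp add: \<rho>_def unitary_cancel[OF U] flip: matrix_mul_assoc)
      then show "spin g = mat 1" by (simp only: cplx_inject)
    qed (simp add: \<rho>_def unitary_cancel[OF U])
    then show ?thesis using spin_kernel[OF that] by simp
  qed
  have minus1: "- mat 1 \<in> SU2"
  proof -
    have "- mat 1 = su2 (-1) 0" by (simp add: vec_eq_iff forall_2 mat_def)
    then show ?thesis using su2_in[of "-1" 0] by simp
  qed
  have ker: "kernel (mat_grp SU2) (mat_grp unitary_group) \<rho> = {mat 1, - mat 1}"
    using \<rho>_1 SU2_1 minus1 by (auto simp: kernel_def mat_grp_def)
  have irr: "irreducible_rep3 \<rho>"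
    unfolding irreducible_rep3_def
  proof (intro conjI allI impI)
    show "\<rho> \<in> hom (mat_grp SU2) (mat_grp unitary_group)"
      using \<rho>_mult \<rho>_unitary by (auto simp: hom_def mat_grp_def)
    show "continuous_on SU2 \<rho>"
      unfolding \<rho>_def by (intro continuous_sandwich continuous_cplx continuous_spin)
    fix W assume W: "vec.subspace W \<and> (\<forall>g\<in>SU2. \<forall>w\<in>W. \<rho> g *v w \<in> W)"
    define W' where "W' = {x. U *v x \<in> W}"
    have "vec.subspace W'"
      using W unfolding W'_def vec.subspace_def
      by (auto simp: matrix_vector_right_distrib vector_scalar_commute)
    moreover have "cplx R *v x \<in> W'" if R: "R \<in> SO3" and x: "x \<in> W'" for R x
    proof -
      obtain g where g: "g \<in> SU2" "R = spin g" using R spin_surj by blast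
      have "\<rho> g *v (U *v x) \<in> W" using W g x by (simp add: W'_def)
      then show ?thesis
        by (simp add: W'_def \<rho>_def g(2) matrix_vector_mul_assoc unitary_cancel[OF U] flip: matrix_mul_assoc)
    qed
    ultimately have *: "W' = {0} \<or> W' = UNIV" using SO3_irreducible by blast
    have bk': "adj U *v w \<in> W' \<longleftrightarrow> w \<in> W" for w
      by (simp add: W'_def matrix_vector_mul_assoc unitary_cancel[OF U])
    show "W = {0} \<or> W = UNIV"
      using *
    proof
      assume W0: "W' = {0}"
      have "w = 0" if "w \<in> W" for w
      proof -
        have "adj U *v w = 0" using bk'[of w] that W0 by simp
        then have "U *v (adj U *v w) = 0" by simp
        then show ?thesis by (simp add: matrix_vector_mul_assoc unitary_cancel[OF U])
      qed
      moreover have "0 \<in> W" using W by (auto intro: vec.subspace_0)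
      ultimately show ?thesis by blast
    next
      assume "W' = UNIV"
      then show ?thesis using bk' by blast
    qed
  qed
  have quot: "mat_grp SU2 Mod {mat 1, - mat 1} \<cong> mat_grp (isotropy0 (form_of S))"
  proof -
    let ?h = "\<lambda>g. realify (\<rho> g)"
    have G: "group (mat_grp (isotropy0 (form_of S)))"
    proof (rule group_mat_grp)
      fix a b assume "a \<in> isotropy0 (form_of S)" "b \<in> isotropy0 (form_of S)"
      then obtain g h where "g \<in> SU2" "h \<in> SU2" "a = ?h g" "b = ?h h" unfolding i' by blast
      moreover from this have "a ** b = ?h (g ** h)" by (simp add: \<rho>_mult realify_mult)
      ultimately show "a ** b \<in> isotropy0 (form_of S)" unfolding i' using SU2_mult by blast
    next
      have "mat 1 = ?h (mat 1)" using \<rho>_1[OF SU2_1] by simp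
      then show "mat 1 \<in> isotropy0 (form_of S)" unfolding i' using SU2_1 by blast
    next
      fix a assume "a \<in> isotropy0 (form_of S)"
      then obtain g where g: "g \<in> SU2" "a = ?h g" unfolding i' by blast
      have "adj g \<in> SU2" "adj g ** g = mat 1" using g SU2_adj by (auto simp: SU2_def U2_def unitary_iff)
      then have "?h (adj g) ** a = ?h (mat 1)" using g by (metis \<rho>_mult realify_mult)
      moreover have "?h (mat 1) = mat 1" using \<rho>_1[OF SU2_1] by simp
      ultimately show "\<exists>b\<in>isotropy0 (form_of S). b ** a = mat 1"
        unfolding i' using \<open>adj g \<in> SU2\<close> by (intro bexI[of _ "?h (adj g)"]) simp_all
    qed
    have "group_hom (mat_grp SU2) (mat_grp (isotropy0 (form_of S))) ?h"
      unfolding group_hom_def group_hom_axioms_def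
      using group_SU2 G \<rho>_mult by (auto simp: hom_def mat_grp_def i' realify_mult)
    moreover have "?h ` carrier (mat_grp SU2) = carrier (mat_grp (isotropy0 (form_of S)))"
      by (simp add: mat_grp_def i' image_image)
    ultimately have "mat_grp SU2 Mod kernel (mat_grp SU2) (mat_grp (isotropy0 (form_of S))) ?h
        \<cong> mat_grp (isotropy0 (form_of S))"
      by (rule group_hom.FactGroup_iso)
    moreover have "kernel (mat_grp SU2) (mat_grp (isotropy0 (form_of S))) ?h = {mat 1, - mat 1}"
    proof -
      have "realify (\<rho> g) = mat 1 \<longleftrightarrow> \<rho> g = mat 1" for g
        by (metis complexify_realify realify_mat1)
      then show ?thesis using \<rho>_1 SU2_1 minus1 by (auto simp: kernel_def mat_grp_def)
    qed
    ultimately show ?thesis by simp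
  qed
  show ?thesis
    unfolding type_SO3_def using iso[folded i] irr quot i' ker by blast
qed

text \<open>Commuting with the half-turns makes \<open>z\<close> diagonal, commuting with the cyclic permutation makes it a
  scalar, and the only real cube root of the determinant 1 is 1.\<close>

lemma SO3_centre:
  assumes z: "z \<in> SO3" and c: "\<And>R. R \<in> SO3 \<Longrightarrow> R ** z = z ** R"
  shows "z = mat 1"
proof -
  have A: "z$1$2 = 0" "z$1$3 = 0" "z$2$1 = 0" "z$3$1 = 0"
    using c[OF turns_SO3(1)] by (simp_all add: turn1_def vec_eq_iff forall_3 matrix_matrix_mult_def sum_3)
  have B: "z$2$3 = 0" "z$3$2 = 0"
    using c[OF turns_SO3(2)] by (simp_all add: turn2_def vec_eq_iff forall_3 matrix_matrix_mult_def sum_3)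
  have "(cycle3 ** z)$2$1 = (z ** cycle3)$2$1" "(cycle3 ** z)$3$1 = (z ** cycle3)$3$1"
    "(cycle3 ** z)$3$2 = (z ** cycle3)$3$2"
    by (simp_all add: c[OF turns_SO3(3)])
  then have C: "z$2$2 = z$1$1" "z$3$3 = z$1$1"
    by (simp_all add: cycle3_def matrix_matrix_mult_def sum_3)
  have "det z = 1" using z by (simp add: SO3_def rotation_matrix_def)
  then have "z$1$1 ^ 3 = 1" by (simp add: det_3 A B C power3_eq_cube)
  then have "(z$1$1 - 1) * ((z$1$1 + 1/2)\<^sup>2 + 3/4) = 0"
    by (simp add: power2_eq_square power3_eq_cube algebra_simps)
  moreover have "(z$1$1 + 1/2)\<^sup>2 + 3/4 > 0" by (intro add_nonneg_pos) simp_all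
  ultimately have "z$1$1 = 1" by simp
  then show ?thesis by (simp add: vec_eq_iff forall_3 mat_def A B C)
qed

text \<open>An isomorphism onto \<open>SO(3)\<close> would send the central element \<open>-1\<close> of the isotropy group into the
  trivial centre of \<open>SO(3)\<close>.\<close>

lemma not_type_SO3_zero: "\<not> type_SO3 zero_form3"
proof
  let ?G = "isotropy0 zero_form3" and ?m = "- mat 1 :: real^6^6"
  assume "type_SO3 zero_form3"
  then obtain f where f: "f \<in> iso (mat_grp ?G) (mat_grp SO3)"
    by (auto simp: type_SO3_def top_group_iso_def)
  then have hom: "\<And>a b. a \<in> ?G \<Longrightarrow> b \<in> ?G \<Longrightarrow> f (a ** b) = f a ** f b" and bij: "bij_betw f ?G SO3"
    by (auto simp: iso_def hom_def mat_grp_def)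
  have m: "?m \<in> ?G" by (rule minus_one_isotropy0)
  have "mat 1 \<in> isotropy zero_form3"
    unfolding form_of_0[symmetric] isotropy_form_of
    by (intro image_eqI[of _ _ "mat 1"]) (simp_all add: Stab_def unitary_mat1)
  then have one: "mat 1 \<in> ?G" by (simp add: isotropy0_def)
  have comm: "a ** ?m = ?m ** a" for a :: "real^6^6"
  proof -
    have "a ** (- b) = - (a ** b)" "(- b) ** a = - (b ** a)" for b :: "real^6^6"
      by (simp_all add: vec_eq_iff matrix_matrix_mult_def sum_negf)
    then show ?thesis by simp
  qed
  have fm: "f ?m = mat 1"
  proof (rule SO3_centre)
    show "f ?m \<in> SO3" using bij m by (auto simp: bij_betw_def)
    fix R assume "R \<in> SO3"
    then obtain a where a: "a \<in> ?G" "R = f a" using bij by (auto simp: bij_betw_def)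
    then show "R ** f ?m = f ?m ** R" using hom[OF a(1) m] hom[OF m a(1)] comm[of a] by simp
  qed
  have f1: "f (mat 1) = mat 1"
  proof (rule SO3_centre)
    show "f (mat 1) \<in> SO3" using bij one by (auto simp: bij_betw_def)
    fix R assume "R \<in> SO3"
    then obtain a where a: "a \<in> ?G" "R = f a" using bij by (auto simp: bij_betw_def)
    then show "R ** f (mat 1) = f (mat 1) ** R" using hom[OF one a(1)] hom[OF a(1) one] by simp
  qed
  have "?m = mat 1" using fm f1 bij m one by (auto simp: bij_betw_def inj_on_def)
  from arg_cong[OF this, of "\<lambda>A. A $ 1 $ 1"] show False by (simp add: mat_def)
qed

text \<open>Multiplying \<open>N D N\<^sup>t = det(N) D\<close> by its adjoint shows that \<open>N\<close> commutes with \<open>D\<^sup>2\<close>, so \<open>N\<close> preserves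
  the eigenspaces of \<open>D\<^sup>2\<close>. By nonnegativity these are indexed by the distinct values of \<open>s\<close>.\<close>

lemma Stab_diag_vanish:
  assumes "N \<in> Stab (diag s)" and s: "\<And>i. s $ i \<ge> 0" and ne: "s $ i \<noteq> s $ j"
  shows "N $ i $ j = 0"
proof -
  let ?D = "diag s"
  have N: "N \<in> unitary_group" and e: "N ** ?D ** transpose N = scal (det N) ?D"
    using assms(1) by (auto simp: Stab_def)
  have aD: "adj ?D = ?D" by (simp add: vec_eq_iff diag_def)
  have "adj (N ** ?D ** transpose N) = adj (transpose N) ** ?D ** adj N"
    by (simp add: adj_mult aD matrix_mul_assoc)
  moreover have "adj (scal (det N) ?D) = scal (cnj (det N)) ?D"
    by (simp add: vec_eq_iff diag_def)
  ultimately have e': "adj (transpose N) ** ?D ** adj N = scal (cnj (det N)) ?D" by (simp add: e)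
  have t: "transpose N ** adj (transpose N) = mat 1"
  proof -
    have "adj (transpose N) = transpose (adj N)" by (simp add: vec_eq_iff transpose_def)
    then show ?thesis using unitary_cancel(3)[OF N] by simp
  qed
  have cancel: "transpose N ** (adj (transpose N) ** X) = X" for X :: "complex^3^3"
    by (simp add: matrix_mul_assoc t)
  have "N ** ?D ** ?D ** adj N = (N ** ?D ** transpose N) ** (adj (transpose N) ** ?D ** adj N)"
    by (simp add: cancel flip: matrix_mul_assoc)
  also have "\<dots> = scal (cnj (det N) * det N) (?D ** ?D)"
    by (simp add: e e' scal_mult)
  also have "\<dots> = ?D ** ?D" by (simp add: unitary_det[OF N])
  finally have "N ** ?D ** ?D ** adj N ** N = ?D ** ?D ** N" by simp
  then have "N ** ?D ** ?D = ?D ** ?D ** N"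
    by (simp add: unitary_cancel[OF N] flip: matrix_mul_assoc)
  then have "(N ** ?D ** ?D) $ i $ j = (?D ** ?D ** N) $ i $ j" by simp
  then have "N $ i $ j * of_real (s $ j * s $ j) = of_real (s $ i * s $ i) * N $ i $ j"
    using exhaust_3[of i] exhaust_3[of j]
    by (elim disjE) (simp_all add: matrix_matrix_mult_def sum_3 diag_def algebra_simps)
  then have "N $ i $ j * of_real (s $ j * s $ j - s $ i * s $ i) = 0" by (simp add: algebra_simps)
  moreover have "s $ j * s $ j - s $ i * s $ i \<noteq> 0"
  proof
    assume "s $ j * s $ j - s $ i * s $ i = 0"
    then have "(s $ i)\<^sup>2 = (s $ j)\<^sup>2" by (simp add: power2_eq_square)
    then show False using ne s[of i] s[of j] by (simp add: power2_eq_iff_nonneg)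
  qed
  ultimately show ?thesis by (auto simp del: of_real_diff of_real_mult)
qed

text \<open>The sum of the coordinate lines on which \<open>s\<close> takes a fixed value is, after the change of basis
  \<open>U\<close>, an invariant subspace. Irreducibility leaves room for only one value.\<close>

lemma type_SO3_conformal:
  assumes S: "symmetric S" and t: "type_SO3 (form_of S)"
  shows "conformal S"
proof -
  have "S \<noteq> 0" using t not_type_SO3_zero form_of_0 by metis
  obtain U s where U: "U \<in> unitary_group" and s: "\<And>i. s $ i \<ge> 0" and Su: "S = U ** diag s ** transpose U"
    using takagi[OF S] by metis
  obtain \<rho> where \<rho>: "irreducible_rep3 \<rho>" and i: "isotropy0 (form_of S) = realify ` \<rho> ` SU2"
    using t by (auto simp: type_SO3_def)
  have iso_sub: "isotropy0 (form_of S) \<subseteq> isotropy (form_of S)"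
    by (simp add: isotropy0_def connected_component_subset)
  have sub: "\<rho> g \<in> Stab S" if "g \<in> SU2" for g
  proof -
    have "realify (\<rho> g) \<in> realify ` Stab S"
      using that iso_sub unfolding i isotropy_form_of by blast
    then show ?thesis by (simp add: inj_image_mem_iff[OF inj_realify])
  qed
  have "s $ k = s $ l" for k l
  proof (rule ccontr)
    assume kl: "s $ k \<noteq> s $ l"
    define W where "W = {w. \<forall>i. s $ i \<noteq> s $ k \<longrightarrow> (adj U *v w) $ i = 0}"
    have "vec.subspace W"
      unfolding vec.subspace_def W_def by (auto simp: matrix_vector_right_distrib vector_scalar_commute)
    moreover have "\<rho> g *v w \<in> W" if g: "g \<in> SU2" and w: "w \<in> W" for g w
    proof -
      have "\<rho> g \<in> (\<lambda>N. U ** N ** adj U) ` Stab (diag s)"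
        using sub[OF g] Stab_conj[OF U, of 1 "diag s"] Su by simp
      then obtain N where N: "\<rho> g = U ** N ** adj U" "N \<in> Stab (diag s)" by blast
      have "adj U *v (\<rho> g *v w) = N *v (adj U *v w)"
        by (simp add: N(1) matrix_vector_mul_assoc unitary_cancel[OF U] flip: matrix_mul_assoc)
      moreover have "(N *v (adj U *v w)) $ i = 0" if "s $ i \<noteq> s $ k" for i
      proof -
        have "N $ i $ j * (adj U *v w) $ j = 0" for j
        proof (cases "s $ j = s $ k")
          case True
          then show ?thesis using Stab_diag_vanish[OF N(2) s, of i j] that by simp
        next
          case False
          then show ?thesis using w by (simp add: W_def)
        qed
        then show ?thesis
          unfolding matrix_vector_mult_def[of N] vec_lambda_beta by (intro sum.neutral) blast
      qed
      ultimately show ?thesis by (simp add: W_def)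
    qed
    ultimately have "W = {0} \<or> W = UNIV" using \<rho> unfolding irreducible_rep3_def by blast
    moreover have bk: "adj U *v (U *v x) = x" for x by (simp add: matrix_vector_mul_assoc unitary_cancel[OF U])
    have "U *v axis k 1 \<in> W" by (auto simp: W_def bk axis_def)
    moreover have "U *v axis k 1 \<noteq> 0"
    proof
      assume "U *v axis k 1 = 0"
      then have "axis k 1 = adj U *v 0" using bk[of "axis k 1"] by simp
      then show False by (simp add: axis_eq_0_iff)
    qed
    moreover have "U *v axis l 1 \<notin> W" using kl by (auto simp: W_def bk axis_def)
    ultimately show False by blast
  qed
  then show ?thesis
    using diag_conformal[OF U, of s] \<open>S \<noteq> 0\<close> Su by metis
qed

section \<open>The orbits\<close>

lemma symmetric_congruence:
  "symmetric A \<Longrightarrow> symmetric (scal c (U ** A ** transpose U))" for A U :: "complex^3^3"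
proof -
  have tr: "transpose (scal c B) = scal c (transpose B)" for B :: "complex^3^3"
    by (simp add: vec_eq_iff transpose_def)
  assume "symmetric A"
  then show ?thesis by (simp add: symmetric_def tr matrix_transpose_mul matrix_mul_assoc)
qed

text \<open>The two actions, of complex factors and of \<open>U(3)\<close>, combine to \<open>A \<mapsto> c U A U\<^sup>t\<close>; the factor
  \<open>det(U)\<^sup>-\<^sup>1\<close> of the second one is absorbed into \<open>c\<close>.\<close>

lemma orbit_form_of:
  assumes A: "symmetric A"
  shows "{cmul c (act B (form_of A)) | c B. c \<noteq> 0 \<and> B \<in> U3}
    = {form_of (scal c (U ** A ** transpose U)) | c U. c \<noteq> 0 \<and> U \<in> unitary_group}"
proof (intro subset_antisym subsetI)
  have *: "cmul c (act (realify U) (form_of A)) = form_of (scal (c * cnj (det U)) (U ** A ** transpose U))"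
    if "U \<in> unitary_group" for c U
    by (simp add: act_form_of[OF that] cmul_form_of[OF symmetric_congruence[OF A]])
  {
    fix T assume "T \<in> {cmul c (act B (form_of A)) | c B. c \<noteq> 0 \<and> B \<in> U3}"
    then obtain c U where T: "T = cmul c (act (realify U) (form_of A))" "c \<noteq> 0" "U \<in> unitary_group"
      by (auto simp: U3_eq)
    moreover have "cnj (det U) \<noteq> 0" using unitary_det[OF T(3)] by auto
    ultimately show "T \<in> {form_of (scal c (U ** A ** transpose U)) | c U. c \<noteq> 0 \<and> U \<in> unitary_group}"
      unfolding T(1) *[OF T(3)] mem_Collect_eq using T(2,3)
      by (intro exI[of _ "c * cnj (det U)"] exI[of _ U]) simp
  next
    fix T assume "T \<in> {form_of (scal c (U ** A ** transpose U)) | c U. c \<noteq> 0 \<and> U \<in> unitary_group}"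
    then obtain c U where T: "T = form_of (scal c (U ** A ** transpose U))" "c \<noteq> 0" "U \<in> unitary_group"
      by blast
    have "T = cmul (c * det U) (act (realify U) (form_of A))"
      using unitary_det[OF T(3)] by (simp add: *[OF T(3)] T(1) mult.assoc mult.commute[of "det U"])
    moreover have "c * det U \<noteq> 0" using T(2) unitary_det[OF T(3)] by auto
    moreover have "realify U \<in> U3" using T(3) by (simp add: U3_eq)
    ultimately show "T \<in> {cmul c (act B (form_of A)) | c B. c \<noteq> 0 \<and> B \<in> U3}" by blast
  }
qed

text \<open>Apart from the factor \<open>i\<close>, the matrix of \<open>T_SO3\<close> is real symmetric and orthogonal. The columns
  of \<open>V\<close> are its normalised eigenvectors, the one with eigenvalue \<open>-1\<close> multiplied by \<open>i\<close>.\<close>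

lemma conformal_S_SO3:
  obtains V where "V \<in> unitary_group" "S_SO3 = scal \<i> (V ** mat 1 ** transpose V)"
proof -
  define r :: complex where "r = of_real (1 / sqrt 2)"
  have r: "r * r = 1 / 2" "cnj r = r"
    by (simp_all add: r_def flip: of_real_mult)
  define V :: "complex^3^3" where
    "V = vector [vector [r, 0, \<i> * r], vector [0, 1, 0], vector [- r, 0, \<i> * r]]"
  have "V \<in> unitary_group"
    by (simp add: unitary_iff V_def vec_eq_iff forall_3 matrix_matrix_mult_def sum_3 mat_def r algebra_simps)
  moreover have "S_SO3 = scal \<i> (V ** mat 1 ** transpose V)"
    by (simp add: S_SO3_def V_def vec_eq_iff forall_3 matrix_matrix_mult_def sum_3 mat_def transpose_def r algebra_simps)
  ultimately show ?thesis by (rule that)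
qed

lemma symmetric_E33: "symmetric E33"
  by (auto simp: symmetric_def transpose_def E33_def vec_eq_iff)

lemma symmetric_S_SO3: "symmetric S_SO3"
  by (simp add: symmetric_def transpose_def S_SO3_def vec_eq_iff forall_3)

lemma conformal_iff_S_SO3:
  "conformal S \<longleftrightarrow> (\<exists>c U. c \<noteq> 0 \<and> U \<in> unitary_group \<and> S = scal c (U ** S_SO3 ** transpose U))"
proof -
  obtain V where V: "V \<in> unitary_group" and SV: "S_SO3 = scal \<i> (V ** mat 1 ** transpose V)"
    by (rule conformal_S_SO3)
  show ?thesis
  proof
    assume "conformal S"
    then obtain U c where U: "U \<in> unitary_group" "c \<noteq> 0" "S = scal c (U ** mat 1 ** transpose U)"
      by (auto simp: conformal_def)
    have "\<i> * c * \<i> = - c" by (simp add: complex_eq_iff)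
    then have "S = scal (c / \<i>) ((U ** adj V) ** S_SO3 ** transpose (U ** adj V))"
      by (simp add: U(3) SV scal_mult matrix_transpose_mul unitary_cancel[OF V] flip: matrix_mul_assoc)
    then show "\<exists>c U. c \<noteq> 0 \<and> U \<in> unitary_group \<and> S = scal c (U ** S_SO3 ** transpose U)"
      using U V by (intro exI[of _ "c / \<i>"] exI[of _ "U ** adj V"]) (simp add: unitary_mult unitary_adj)
  next
    assume "\<exists>c U. c \<noteq> 0 \<and> U \<in> unitary_group \<and> S = scal c (U ** S_SO3 ** transpose U)"
    then obtain U c where U: "U \<in> unitary_group" "c \<noteq> 0" "S = scal c (U ** S_SO3 ** transpose U)" by blast
    have "S = scal (c * \<i>) ((U ** V) ** mat 1 ** transpose (U ** V))"
      by (simp add: U(3) SV scal_mult matrix_transpose_mul matrix_mul_assoc)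
    then show "conformal S"
      unfolding conformal_def using U V
      by (intro exI[of _ "U ** V"] exI[of _ "c * \<i>"]) (simp add: unitary_mult)
  qed
qed

theorem theorem4p4:
  shows "(\<forall>T\<in>Lambda3_12. T \<noteq> zero_form3 \<and> 3 \<le> group_dim (isotropy0 T) \<longrightarrow> type_U2 T \<or> type_SO3 T)
    \<and> isotropy0 T_U2 = realify ` diag_det ` U2
    \<and> {T \<in> Lambda3_12. type_U2 T} = {cmul c (act A T_U2) | c A. c \<noteq> 0 \<and> A \<in> U3}
    \<and> {T \<in> Lambda3_12. type_SO3 T} = {cmul c (act A T_SO3) | c A. c \<noteq> 0 \<and> A \<in> U3}"
proof (intro conjI ballI impI)
  fix T assume T: "T \<in> Lambda3_12" and d: "T \<noteq> zero_form3 \<and> 3 \<le> group_dim (isotropy0 T)"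
  obtain S where S: "symmetric S" "T = form_of S" using T by (rule Lambda3_12_form_of)
  have "S \<noteq> 0" using d S form_of_0 by auto
  then show "type_U2 T \<or> type_SO3 T"
    using group_dim_ge_3[OF S(1)] d rank_one_type_U2 conformal_type_SO3 unfolding S(2) by blast
next
  have TU: "T_U2 = form_of E33" by (simp add: T_U2_form_of E33_def)
  show "isotropy0 T_U2 = realify ` diag_det ` U2"
    unfolding TU isotropy0_form_of[OF connected_Stab_E33] Stab_E33 ..
  show "{T \<in> Lambda3_12. type_U2 T} = {cmul c (act A T_U2) | c A. c \<noteq> 0 \<and> A \<in> U3}"
    unfolding TU orbit_form_of[OF symmetric_E33]
  proof (intro subset_antisym subsetI)
    fix T assume "T \<in> {T \<in> Lambda3_12. type_U2 T}"
    then have T: "T \<in> Lambda3_12" "type_U2 T" by auto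
    obtain S where S: "symmetric S" "T = form_of S" using T(1) by (rule Lambda3_12_form_of)
    have "rank_one S" using type_U2_rank_one[OF S(1)] T(2) S(2) by simp
    then show "T \<in> {form_of (scal c (U ** E33 ** transpose U)) | c U. c \<noteq> 0 \<and> U \<in> unitary_group}"
      unfolding rank_one_def S(2) by blast
  next
    fix T assume "T \<in> {form_of (scal c (U ** E33 ** transpose U)) | c U. c \<noteq> 0 \<and> U \<in> unitary_group}"
    then obtain c U where T: "T = form_of (scal c (U ** E33 ** transpose U))" "c \<noteq> 0" "U \<in> unitary_group" by blast
    then have "rank_one (scal c (U ** E33 ** transpose U))" unfolding rank_one_def by blast
    then show "T \<in> {T \<in> Lambda3_12. type_U2 T}"
      using rank_one_type_U2 form_of_Lambda3_12[OF symmetric_congruence[OF symmetric_E33]] T(1) by simp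
  qed
  show "{T \<in> Lambda3_12. type_SO3 T} = {cmul c (act A T_SO3) | c A. c \<noteq> 0 \<and> A \<in> U3}"
    unfolding T_SO3_form_of orbit_form_of[OF symmetric_S_SO3]
  proof (intro subset_antisym subsetI)
    fix T assume "T \<in> {T \<in> Lambda3_12. type_SO3 T}"
    then have T: "T \<in> Lambda3_12" "type_SO3 T" by auto
    obtain S where S: "symmetric S" "T = form_of S" using T(1) by (rule Lambda3_12_form_of)
    have "conformal S" using type_SO3_conformal[OF S(1)] T(2) S(2) by simp
    then show "T \<in> {form_of (scal c (U ** S_SO3 ** transpose U)) | c U. c \<noteq> 0 \<and> U \<in> unitary_group}"
      unfolding conformal_iff_S_SO3 S(2) by blast
  next
    fix T assume "T \<in> {form_of (scal c (U ** S_SO3 ** transpose U)) | c U. c \<noteq> 0 \<and> U \<in> unitary_group}"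
    then obtain c U where T: "T = form_of (scal c (U ** S_SO3 ** transpose U))" "c \<noteq> 0" "U \<in> unitary_group" by blast
    then have "conformal (scal c (U ** S_SO3 ** transpose U))" unfolding conformal_iff_S_SO3 by blast
    then show "T \<in> {T \<in> Lambda3_12. type_SO3 T}"
      using conformal_type_SO3 form_of_Lambda3_12[OF symmetric_congruence[OF symmetric_S_SO3]] T(1) by simp
  qed
qed

end
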